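(* Suppose $f\in C$, i.e. $f$ is a continuous $2\pi$-periodic function, with $f(0)=1$. Let $\varepsilon>0$ and $N_0\in\mathbb{N}$. Then there exist $K_0=K_0(f)\in\mathbb{N}$ (an exponent depending on $f$) and a compactly supported Parseval wavelet frame $\{\psi_{r,j,k}\}_{j,k\in\mathbb{Z},\,r=1,\dots,q}$ for $L_2(\mathbb{R})$, with a refinement mask $m_0$ and corresponding refinable function $\varphi$, such that $$\|f-\tau^{-K_0}m_0\|_{C}<\varepsilon,$$ where $$ \tau(\xi):=1-\left(\int_{0}^{\pi}\sin^{2N_0+1}t\,dt\right)^{-1}\int_{0}^{\xi}\sin^{2N_0+1}t\,dt . $$ Moreover, this wavelet system has vanishing moments of order $N_0$, and the refinable function $\varphi$ has stable integer shifts.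
   Context: $C$ is the space of $2\pi$-periodic continuous functions with the uniform norm $\|\cdot\|_C$. $L_2$ is the space of $2\pi$-periodic functions that are square integrable over a period, and $\mathbb{T}=[-\pi,\pi)$. $\widehat{g}$ denotes the Fourier transform of $g$. The notation $K_0(f)$ indicates dependence on $f$; no dependence on $\varepsilon$ or $N_0$ is indicated. The function $\tau$ is $2\pi$-periodic and vanishes exactly on $\pi+2\pi\mathbb{Z}$; $\tau^{-K_0}m_0$ is the function $\xi\mapsto m_0(\xi)/\tau(\xi)^{K_0}$, understood at the zeros of $\tau$ by continuity. Parseval wavelet frame with refinement mask $m_0$ and refinable function $\varphi$ (setting of the unitary extension principle): $\varphi\in L_2(\mathbb{R})$, $m_0\in L_2$, $$\widehat{\varphi}(2\xi)=m_0(\xi)\widehat{\varphi}(\xi),\qquad \lim_{\xi\to0}\widehat{\varphi}(\xi)=1,$$ and there are wavelet masks $m_1,\dots,m_q\in L_2$ such that, for a.e. $\xi\in\mathbb{T}$, $$\sum_{r=0}^{q}|m_r(\xi)|^2=1,\qquad \sum_{r=0}^{q}m_r(\xi)\overline{m_r(\xi+\pi)}=0.$$ The wavelet generators $\psi_1,\dots,\psi_q\in L_2(\mathbb{R})$ are defined by $\widehat{\psi_r}(2\xi)=m_r(\xi)\widehat{\varphi}(\xi)$, $r=1,\dots,q$, and $\psi_{r,j,k}(x):=2^{j/2}\psi_r(2^jx+k)$. The system $\{\psi_{r,j,k}\}$ is a Parseval frame for $L_2(\mathbb{R})$ if it is a tight frame with frame bound $1$, i.e. $\sum_{r,j,k}|\langle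 g,\psi_{r,j,k}\rangle|^2=\|g\|^2$ for all $g\in L_2(\mathbb{R})$. It is compactly supported if every generator $\psi_r$ has compact support. The system $\{\psi_{r,j,k}\}$ has vanishing moments of order $N_0$ if $\widehat{\psi_r}^{(k)}(0)=0$ for $k=0,\dots,N_0$ and $r=1,\dots,q$. The function $\varphi$ has stable integer shifts if there are constants $0<A\le B<\infty$ such that $$A\sum_{k}|c_k|^2\le\Big\|\sum_{k}c_k\varphi(\cdot-k)\Big\|_{L_2(\mathbb{R})}^2\le B\sum_k|c_k|^2$$ for all finitely supported sequences $(c_k)_{k\in\mathbb{Z}}$.
   Formalization: The exponent K_0 may depend on ε and N_0 as well as on f; an exponent depending on f alone is impossible, e.g. for f = 1 + sin, since |m_0| ≤ 1 would force |f| ≤ τ^{-K_0} = 1 + O(ξ^{2N_0+2}) near 0. *)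

theory Defs
  imports "HOL-Analysis.Analysis"
begin

section \<open>Function spaces\<close>

definition space_C :: "(real \<Rightarrow> complex) set" where
  "space_C = {h. continuous_on UNIV h \<and> (\<forall>\<xi>. h (\<xi> + 2 * pi) = h \<xi>)}"

definition norm_C :: "(real \<Rightarrow> complex) \<Rightarrow> real" where
  "norm_C h = (SUP \<xi>. cmod (h \<xi>))"

definition L2_per :: "(real \<Rightarrow> complex) set" where
  "L2_per = {h. h \<in> borel_measurable lebesgue \<and> (\<forall>\<xi>. h (\<xi> + 2 * pi) = h \<xi>) \<and>
     set_integrable lebesgue {-pi..<pi} (\<lambda>\<xi>. (cmod (h \<xi>))\<^sup>2)}"

definition L2_R :: "(real \<Rightarrow> complex) set" where
  "L2_R = {g. g \<in> borel_measurable lebesgue \<and> integrable lebesgue (\<lambda>x. (cmod (g x))\<^sup>2)}"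

definition L2_inner :: "(real \<Rightarrow> complex) \<Rightarrow> (real \<Rightarrow> complex) \<Rightarrow> complex" where
  "L2_inner g h = (LINT x|lebesgue. g x * cnj (h x))"

definition L2_norm :: "(real \<Rightarrow> complex) \<Rightarrow> real" where
  "L2_norm g = sqrt (LINT x|lebesgue. (cmod (g x))\<^sup>2)"


section \<open>The Fourier transform\<close>

text \<open>
  The kernel is \<open>exp (- \<i> x \<xi>)\<close> without a normalising factor. For masks of period
  \<open>2 * pi\<close> and \<open>\<phi>\<close> with Fourier transform tending to 1 at 0, this is the normalisation under
  which the unitary extension principle yields frame bound 1 (the Haar system has
  \<open>\<phi> = indicator {0..<1}\<close>).
\<close>

definition fourier_integral :: "(real \<Rightarrow> complex) \<Rightarrow> real set \<Rightarrow> real \<Rightarrow> complex" where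
  "fourier_integral g S \<xi> = (LINT x:S|lebesgue. g x * exp (- (\<i> * of_real (x * \<xi>))))"

text \<open>\<open>G\<close> is the limit in \<open>L2_R\<close> of the transforms of the truncations of \<open>g\<close>.\<close>

definition is_plancherel_transform :: "(real \<Rightarrow> complex) \<Rightarrow> (real \<Rightarrow> complex) \<Rightarrow> bool" where
  "is_plancherel_transform g G \<longleftrightarrow> G \<in> L2_R \<and>
     ((\<lambda>R. \<integral>\<^sup>+ \<xi>. ennreal ((cmod (G \<xi> - fourier_integral g {-R..R} \<xi>))\<^sup>2) \<partial>lebesgue)
        \<longlongrightarrow> 0) at_top"

text \<open>
  For integrable \<open>g\<close> this is the continuous representative, so that pointwise values and
  derivatives make sense; for other \<open>g\<close> in \<open>L2_R\<close> it is determined up to a null set only.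
\<close>

definition fourier :: "(real \<Rightarrow> complex) \<Rightarrow> real \<Rightarrow> complex" where
  "fourier g = (if integrable lebesgue g then fourier_integral g UNIV
                else (SOME G. is_plancherel_transform g G))"


section \<open>Wavelet systems generated by the unitary extension principle\<close>

text \<open>
  The limit at 0 is required of some representative of the transform of \<open>\<phi>\<close>; if \<open>\<phi>\<close> is
  integrable this is the limit of the continuous function \<open>fourier \<phi>\<close>.
\<close>

definition refinable :: "(real \<Rightarrow> complex) \<Rightarrow> (real \<Rightarrow> complex) \<Rightarrow> bool" where
  "refinable m0 \<phi> \<longleftrightarrow> m0 \<in> L2_per \<and> \<phi> \<in> L2_R \<and>
     (AE \<xi> in lebesgue. fourier \<phi> (2 * \<xi>) = m0 \<xi> * fourier \<phi> \<xi>) \<and>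
     (\<exists>\<Phi>. (AE \<xi> in lebesgue. \<Phi> \<xi> = fourier \<phi> \<xi>) \<and> (\<Phi> \<longlongrightarrow> 1) (at 0))"

text \<open>
  The family \<open>m\<close> is indexed by \<open>0..q\<close>, with \<open>m 0\<close> the refinement mask; the family \<open>\<psi>\<close> of
  generators is indexed by \<open>1..q\<close>. Values at other indices are irrelevant.
\<close>

definition uep_masks :: "nat \<Rightarrow> (nat \<Rightarrow> real \<Rightarrow> complex) \<Rightarrow> bool" where
  "uep_masks q m \<longleftrightarrow> (\<forall>r\<in>{0..q}. m r \<in> L2_per) \<and>
     (AE \<xi> in lebesgue. \<xi> \<in> {-pi..<pi} \<longrightarrow>
        (\<Sum>r=0..q. (cmod (m r \<xi>))\<^sup>2) = 1 \<and>
        (\<Sum>r=0..q. m r \<xi> * cnj (m r (\<xi> + pi))) = 0)"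

definition wavelet_generators ::
  "nat \<Rightarrow> (nat \<Rightarrow> real \<Rightarrow> complex) \<Rightarrow> (real \<Rightarrow> complex) \<Rightarrow> (nat \<Rightarrow> real \<Rightarrow> complex) \<Rightarrow> bool" where
  "wavelet_generators q m \<phi> \<psi> \<longleftrightarrow> (\<forall>r\<in>{1..q}. \<psi> r \<in> L2_R \<and>
     (AE \<xi> in lebesgue. fourier (\<psi> r) (2 * \<xi>) = m r \<xi> * fourier \<phi> \<xi>))"

definition wavelet :: "(real \<Rightarrow> complex) \<Rightarrow> int \<Rightarrow> int \<Rightarrow> real \<Rightarrow> complex" where
  "wavelet \<psi> j k x =
     of_real (2 powr (of_int j / 2)) * \<psi> (2 powr of_int j * x + of_int k)"

definition parseval_frame :: "nat \<Rightarrow> (nat \<Rightarrow> real \<Rightarrow> complex) \<Rightarrow> bool" where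
  "parseval_frame q \<psi> \<longleftrightarrow> (\<forall>g\<in>L2_R.
     ((\<lambda>(r, j, k). (cmod (L2_inner g (wavelet (\<psi> r) j k)))\<^sup>2) has_sum (L2_norm g)\<^sup>2)
       ({1..q} \<times> UNIV \<times> UNIV))"

definition compactly_supported :: "(real \<Rightarrow> complex) \<Rightarrow> bool" where
  "compactly_supported g \<longleftrightarrow> compact (closure {x. g x \<noteq> 0})"

definition parseval_wavelet_frame ::
  "nat \<Rightarrow> (nat \<Rightarrow> real \<Rightarrow> complex) \<Rightarrow> (real \<Rightarrow> complex) \<Rightarrow> (nat \<Rightarrow> real \<Rightarrow> complex) \<Rightarrow> bool" where
  "parseval_wavelet_frame q m \<phi> \<psi> \<longleftrightarrow>
     refinable (m 0) \<phi> \<and> uep_masks q m \<and> wavelet_generators q m \<phi> \<psi> \<and> parseval_frame q \<psi>"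

definition nth_derivative :: "nat \<Rightarrow> (real \<Rightarrow> complex) \<Rightarrow> real \<Rightarrow> complex" where
  "nth_derivative k F = ((\<lambda>G \<xi>. vector_derivative G (at \<xi>)) ^^ k) F"

text \<open>
  The differentiability clause rules out the unspecified values of \<^const>\<open>vector_derivative\<close>.
\<close>

definition vanishing_moments :: "nat \<Rightarrow> (real \<Rightarrow> complex) \<Rightarrow> bool" where
  "vanishing_moments N \<psi> \<longleftrightarrow>
     (\<forall>k<N. \<forall>\<^sub>F \<xi> in nhds 0. nth_derivative k (fourier \<psi>) differentiable (at \<xi>)) \<and>
     (\<forall>k\<le>N. nth_derivative k (fourier \<psi>) 0 = 0)"

definition stable_integer_shifts :: "(real \<Rightarrow> complex) \<Rightarrow> bool" where
  "stable_integer_shifts \<phi> \<longleftrightarrow> (\<exists>A B. 0 < A \<and> A \<le> B \<and>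
     (\<forall>c :: int \<Rightarrow> complex. finite {k. c k \<noteq> 0} \<longrightarrow>
        A * (\<Sum>k | c k \<noteq> 0. (cmod (c k))\<^sup>2)
          \<le> (L2_norm (\<lambda>x. \<Sum>k | c k \<noteq> 0. c k * \<phi> (x - of_int k)))\<^sup>2 \<and>
        (L2_norm (\<lambda>x. \<Sum>k | c k \<noteq> 0. c k * \<phi> (x - of_int k)))\<^sup>2
          \<le> B * (\<Sum>k | c k \<noteq> 0. (cmod (c k))\<^sup>2)))"


section \<open>The function \<open>\<tau>\<close>\<close>

definition tau :: "nat \<Rightarrow> real \<Rightarrow> real" where
  "tau N \<xi> = 1 - inverse (LBINT t=ereal 0..ereal pi. sin t ^ (2 * N + 1))
                 * (LBINT t=ereal 0..ereal \<xi>. sin t ^ (2 * N + 1))"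

text \<open>
  The quotient \<open>m0 / tau N ^ K\<close>, extended to the zeros of \<^term>\<open>tau N\<close> by its limits. Whether
  these limits exist is not part of the definition: it follows from membership of the quotient in
  \<^const>\<open>space_C\<close>, the zeros being isolated.
\<close>

definition tau_quotient :: "nat \<Rightarrow> nat \<Rightarrow> (real \<Rightarrow> complex) \<Rightarrow> real \<Rightarrow> complex" where
  "tau_quotient N K m0 \<xi> =
     (if tau N \<xi> \<noteq> 0 then m0 \<xi> / of_real (tau N \<xi>) ^ K
      else Lim (at \<xi>) (\<lambda>\<eta>. m0 \<eta> / of_real (tau N \<eta>) ^ K))"

end

theory Submission
  imports Defs "HOL-Probability.Sinc_Integral" "HOL-Probability.Characteristic_Functions"
begin

text \<open>
  Put \<open>s(\<xi>) = \<tau>(\<xi> + \<pi>)\<close>, so that \<open>\<tau> + s = 1\<close>. The mask is \<open>m\<^sub>0 = \<tau>\<^sup>K p\<close> with \<open>p = 1 + s g\<close> for a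
  trigonometric polynomial \<open>g\<close>. As \<open>s\<close> vanishes on \<open>2\<pi>\<int>\<close> only, functions of this form are still
  dense in \<^const>\<open>space_C\<close> among the functions with value 1 at 0 (\<open>flat_approximation\<close>), and the
  factor \<open>s\<close> gives \<open>p\<close> the flatness of \<open>\<tau>\<close> at 0. A generic small constant added to \<open>g\<close> makes \<open>p\<close>
  free of zeros (\<open>zero_free_perturbation\<close>), so that \<open>m\<^sub>0\<close> has no zeros but those of \<open>\<tau>\<close>.

  A large exponent pays for the size of \<open>g\<close>: the function \<open>1 - \<tau>\<^sup>n |1 + s g|\<^sup>2\<close> is divisible by \<open>s\<close>, and
  for large \<open>n\<close> the quotient is a sum of squared moduli of trigonometric polynomials
  (\<open>sos_mask_defect\<close>). Therefore \<open>1 - |m\<^sub>0|\<^sup>2 - |m\<^sub>0(\<cdot> + \<pi>)|\<^sup>2\<close> is such a sum too, which is what it takes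
  to write down wavelet masks that satisfy the two identities of the unitary extension principle
  (\<open>filter_bank_completion\<close>). Working with sums of squares throughout makes a spectral factorisation
  unnecessary.

  The exponent also gives \<open>|m\<^sub>0| \<le> \<tau>\<close>. Hence the partial products of \<open>\<Prod>j. m\<^sub>0(w / 2\<^sup>j)\<close>, cut off
  at \<open>|w| = 2\<^sup>j \<pi>\<close>, are dominated by a multiple of \<open>1 / (1 + w\<^sup>2)\<close>, and \<open>\<phi>\<close> is the inverse Fourier
  integral of the product, a continuous function. It is the limit of the step functions built from
  the coefficients of the iterated masks; these step functions have integral 1 and live on a common
  bounded interval, so \<open>\<phi>\<close> has integral 1 and compact support.

  The unitary extension principle is proved in the time domain. The identities for the masks say
  that the filter bank conserves the energy of coefficient sequences (\<open>filter_bank_energy\<close>), so the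
  energies of \<open>g\<close> at consecutive levels telescope. For continuous \<open>g\<close> with compact support, the
  energy tends to \<open>\<parallel>g\<parallel>\<^sup>2\<close> at fine levels, being a Riemann sum, and to 0 at coarse levels; a density
  argument gives the Parseval frame.

  The moments vanish because \<open>|m\<^sub>r|\<^sup>2 \<le> 1 - |m\<^sub>0|\<^sup>2 = O(\<xi>\<^sup>2\<^sup>N\<^sup>+\<^sup>2)\<close>, \<open>N\<close> being the required order. The
  shifts are stable because the transform of \<open>\<phi>\<close> has no zero on \<open>[-\<pi>, \<pi>]\<close>, which bounds linear
  combinations of shifts from below through the Zak transform (\<open>zak_bound\<close>), while only boundedly
  many shifts overlap at any point.
\<close>

section \<open>Trigonometric polynomials\<close>

text \<open>
  Generation by monomials and sums reduces every closure property to single frequencies.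
\<close>

inductive trig_poly :: "(real \<Rightarrow> complex) \<Rightarrow> bool" where
  monomial: "trig_poly (\<lambda>x. c * cis (of_int k * x))"
| add: "trig_poly p \<Longrightarrow> trig_poly q \<Longrightarrow> trig_poly (\<lambda>x. p x + q x)"

lemma trig_poly_const: "trig_poly (\<lambda>x. c)"
  using trig_poly.monomial[of c 0] by simp

lemma trig_poly_cis: "trig_poly (\<lambda>x. cis (of_int k * x))"
  using trig_poly.monomial[of 1 k] by simp

lemma trig_poly_cmult: "trig_poly p \<Longrightarrow> trig_poly (\<lambda>x. c * p x)"
proof (induction rule: trig_poly.induct)
  case (monomial d k)
  show ?case using trig_poly.monomial[of "c * d" k] by (simp add: mult.assoc)
next
  case (add p q)
  then show ?case using trig_poly.add by (simp add: algebra_simps)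
qed

lemma trig_poly_mult:
  assumes "trig_poly p" "trig_poly q"
  shows "trig_poly (\<lambda>x. p x * q x)"
  using assms(1)
proof (induction rule: trig_poly.induct)
  case (monomial c k)
  show ?case using assms(2)
  proof (induction rule: trig_poly.induct)
    case (monomial d l)
    have "(\<lambda>x. c * cis (of_int k * x) * (d * cis (of_int l * x)))
        = (\<lambda>x. (c * d) * cis (of_int (k + l) * x))"
      by (auto simp: cis_mult[symmetric] algebra_simps)
    then show ?case using trig_poly.monomial[of "c * d" "k + l"] by simp
  next
    case (add p q)
    then show ?case using trig_poly.add by (simp add: algebra_simps)
  qed
next
  case (add p' q')
  then show ?case using trig_poly.add by (simp add: algebra_simps)
qed

lemma trig_poly_cnj: "trig_poly p \<Longrightarrow> trig_poly (\<lambda>x. cnj (p x))"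
proof (induction rule: trig_poly.induct)
  case (monomial c k)
  show ?case using trig_poly.monomial[of "cnj c" "-k"] by (simp add: cis_cnj)
next
  case (add p q)
  then show ?case using trig_poly.add by simp
qed

lemma trig_poly_minus: "trig_poly p \<Longrightarrow> trig_poly (\<lambda>x. - p x)"
  using trig_poly_cmult[of p "-1"] by simp

lemma trig_poly_diff: "trig_poly p \<Longrightarrow> trig_poly q \<Longrightarrow> trig_poly (\<lambda>x. p x - q x)"
  using trig_poly.add[OF _ trig_poly_minus, of p q] by simp

lemma trig_poly_power: "trig_poly p \<Longrightarrow> trig_poly (\<lambda>x. p x ^ n)"
  by (induction n) (auto intro: trig_poly_const trig_poly_mult)

lemma trig_poly_sum: "(\<And>i. i \<in> I \<Longrightarrow> trig_poly (p i)) \<Longrightarrow> trig_poly (\<lambda>x. \<Sum>i\<in>I. p i x)"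
  by (induction I rule: infinite_finite_induct) (auto intro: trig_poly_const trig_poly.add)

lemma trig_poly_shift: "trig_poly p \<Longrightarrow> trig_poly (\<lambda>x. p (x + a))"
proof (induction rule: trig_poly.induct)
  case (monomial c k)
  have "(\<lambda>x. c * cis (of_int k * (x + a))) = (\<lambda>x. (c * cis (of_int k * a)) * cis (of_int k * x))"
    by (auto simp: cis_mult[symmetric] algebra_simps)
  then show ?case using trig_poly.monomial[of "c * cis (of_int k * a)" k] by simp
next
  case (add p q)
  then show ?case using trig_poly.add by simp
qed

lemma trig_poly_cos: "trig_poly (\<lambda>x. of_real (cos x))"
proof -
  have "trig_poly (\<lambda>x. (1/2) * cis (of_int 1 * x) + (1/2) * cis (of_int (-1) * x))"
    by (intro trig_poly.intros)
  also have "(\<lambda>x. (1/2) * cis (of_int 1 * x) + (1/2) * cis (of_int (-1) * x)) = (\<lambda>x. of_real (cos x))"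
    by (auto simp: complex_eq_iff)
  finally show ?thesis .
qed

lemma trig_poly_sin: "trig_poly (\<lambda>x. of_real (sin x))"
proof -
  have "trig_poly (\<lambda>x. (-\<i>/2) * cis (of_int 1 * x) + (\<i>/2) * cis (of_int (-1) * x))"
    by (intro trig_poly.intros)
  also have "(\<lambda>x. (-\<i>/2) * cis (of_int 1 * x) + (\<i>/2) * cis (of_int (-1) * x)) = (\<lambda>x. of_real (sin x))"
    by (auto simp: complex_eq_iff)
  finally show ?thesis .
qed

lemma trig_poly_has_vector_derivative:
  assumes "trig_poly p"
  obtains p' where "\<And>x. (p has_vector_derivative p' x) (at x)" "trig_poly p'"
proof -
  from assms have "\<exists>p'. trig_poly p' \<and> (\<forall>x. (p has_vector_derivative p' x) (at x))"
  proof (induction rule: trig_poly.induct)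
    case (monomial c k)
    have "((\<lambda>x. c * cis (of_int k * x)) has_vector_derivative (c * (of_int k * \<i>)) * cis (of_int k * x)) (at x)" for x
      unfolding cis_conv_exp
      by (rule has_vector_derivative_eq_rhs, (rule derivative_intros has_vector_derivative_real_field | simp)+)
    then show ?case using trig_poly.monomial[of "c * (of_int k * \<i>)" k] by blast
  next
    case (add p q)
    then obtain p' q' where "trig_poly p'" "\<forall>x. (p has_vector_derivative p' x) (at x)"
      "trig_poly q'" "\<forall>x. (q has_vector_derivative q' x) (at x)" by blast
    then show ?case
      by (intro exI[of _ "\<lambda>x. p' x + q' x"]) (auto intro: trig_poly.add has_vector_derivative_add)
  qed
  then show ?thesis using that by blast
qed

lemma trig_poly_continuous: "trig_poly p \<Longrightarrow> continuous_on A p"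
  by (induction rule: trig_poly.induct) (auto simp: cis_conv_exp intro!: continuous_intros)

lemma trig_poly_differentiable: "trig_poly p \<Longrightarrow> p differentiable (at x within A)"
  by (metis trig_poly_has_vector_derivative differentiable_at_withinI differentiableI_vector)

lemma trig_poly_periodic: "trig_poly p \<Longrightarrow> p (x + 2 * pi) = p x"
proof (induction rule: trig_poly.induct)
  case (monomial c k)
  have "cis (of_int k * (x + 2 * pi)) = cis (of_int k * x) * cis (2 * pi * of_int k)"
    by (simp add: cis_mult algebra_simps)
  then show ?case by (metis cis_multiple_2pi Ints_of_int mult.right_neutral)
next
  case (add p q)
  then show ?case by simp
qed

lemma trig_poly_bounded:
  assumes "trig_poly p"
  obtains B where "\<And>x. cmod (p x) \<le> B" "B > 0"
proof -
  from assms have "\<exists>B. \<forall>x. cmod (p x) \<le> B"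
  proof (induction rule: trig_poly.induct)
    case (monomial c k)
    show ?case by (intro exI[of _ "cmod c"]) (auto simp: norm_mult)
  next
    case (add p q)
    then obtain A B where "\<forall>x. cmod (p x) \<le> A" "\<forall>x. cmod (q x) \<le> B" by blast
    then show ?case by (intro exI[of _ "A + B"]) (auto intro: norm_triangle_mono)
  qed
  then obtain B where "\<forall>x. cmod (p x) \<le> B" by blast
  then have "cmod (p x) \<le> max B 1" for x by (simp add: le_max_iff_disj)
  then show ?thesis using that[of "max B 1"] by simp
qed

lemma trig_poly_lipschitz:
  assumes "trig_poly p"
  obtains C where "\<And>x y. cmod (p x - p y) \<le> C * \<bar>x - y\<bar>" "C > 0"
proof -
  obtain p' where p': "\<And>x. (p has_vector_derivative p' x) (at x)" "trig_poly p'"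
    using trig_poly_has_vector_derivative[OF assms] by blast
  obtain C where C: "\<And>x. cmod (p' x) \<le> C" "C > 0" using trig_poly_bounded[OF p'(2)] by blast
  have "cmod (p x - p y) \<le> C * \<bar>x - y\<bar>" for x y
  proof -
    have "norm (p x - p y) \<le> C * norm (x - y)"
    proof (rule differentiable_bound)
      show "convex (UNIV :: real set)" by simp
      show "(p has_derivative (\<lambda>h. h *\<^sub>R p' x)) (at x within UNIV)" for x
        using p'(1)[of x] by (simp add: has_vector_derivative_def)
      show "onorm (\<lambda>h. h *\<^sub>R p' x) \<le> C" for x
        using C(1)[of x] by (simp add: onorm_scaleR_left[OF bounded_linear_ident] onorm_id)
    qed auto
    then show ?thesis by simp
  qed
  then show ?thesis using that C by blast
qed

lemma trig_poly_expansion: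
  assumes "trig_poly p"
  obtains S :: "int set" and c where "finite S" "\<And>x. p x = (\<Sum>k\<in>S. c k * cis (of_int k * x))"
    "\<And>k. k \<notin> S \<Longrightarrow> c k = 0"
proof -
  from assms have "\<exists>S c. finite (S :: int set) \<and> (\<forall>x. p x = (\<Sum>k\<in>S. c k * cis (of_int k * x))) \<and> (\<forall>k. k \<notin> S \<longrightarrow> c k = 0)"
  proof (induction rule: trig_poly.induct)
    case (monomial c k)
    show ?case by (intro exI[of _ "{k}"] exI[of _ "\<lambda>l. if l = k then c else 0"]) auto
  next
    case (add p q)
    obtain S c where S: "finite S" "\<And>x. p x = (\<Sum>k\<in>S. c k * cis (of_int k * x))" "\<And>k. k \<notin> S \<Longrightarrow> c k = 0"
      using add.IH(1) by blast
    obtain T d where T: "finite T" "\<And>x. q x = (\<Sum>k\<in>T. d k * cis (of_int k * x))" "\<And>k. k \<notin> T \<Longrightarrow> d k = 0"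
      using add.IH(2) by blast
    have "p x = (\<Sum>k\<in>S \<union> T. c k * cis (of_int k * x))" for x
      unfolding S(2) by (rule sum.mono_neutral_left) (use S T in auto)
    moreover have "q x = (\<Sum>k\<in>S \<union> T. d k * cis (of_int k * x))" for x
      unfolding T(2) by (rule sum.mono_neutral_left) (use S T in auto)
    ultimately show ?case using S T
      by (intro exI[of _ "S \<union> T"] exI[of _ "\<lambda>k. c k + d k"]) (auto simp: sum.distrib algebra_simps)
  qed
  then show ?thesis using that by blast
qed

section \<open>Mean values and Fourier coefficients of trigonometric polynomials\<close>

definition mean :: "(real \<Rightarrow> complex) \<Rightarrow> complex" where
  "mean p = (LINT x:{-pi..pi}|lborel. p x) / of_real (2 * pi)"

definition fcoef :: "(real \<Rightarrow> complex) \<Rightarrow> int \<Rightarrow> complex" where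
  "fcoef p k = mean (\<lambda>x. p x * cis (- (of_int k * x)))"

lemma continuous_set_integrable:
  fixes h :: "real \<Rightarrow> 'a :: {banach, second_countable_topology}"
  shows "continuous_on {a..b} h \<Longrightarrow> set_integrable lborel {a..b} h"
  by (rule borel_integrable_atLeastAtMost')

lemma trig_poly_set_integrable: "trig_poly p \<Longrightarrow> set_integrable lborel {a..b} p"
  by (intro continuous_set_integrable trig_poly_continuous)

lemma mean_add: "trig_poly p \<Longrightarrow> trig_poly q \<Longrightarrow> mean (\<lambda>x. p x + q x) = mean p + mean q"
  by (simp add: mean_def set_integral_add trig_poly_set_integrable add_divide_distrib)

lemma mean_cmult: "mean (\<lambda>x. c * p x) = c * mean p"
  by (simp add: mean_def)

lemma mean_sum:
  "(\<And>i. i \<in> I \<Longrightarrow> trig_poly (p i)) \<Longrightarrow> mean (\<lambda>x. \<Sum>i\<in>I. p i x) = (\<Sum>i\<in>I. mean (p i))"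
proof (induction I rule: infinite_finite_induct)
  case (insert i I)
  have "mean (\<lambda>x. \<Sum>i\<in>insert i I. p i x) = mean (\<lambda>x. p i x + (\<Sum>i\<in>I. p i x))"
    using insert.hyps by simp
  also have "\<dots> = mean (p i) + mean (\<lambda>x. \<Sum>i\<in>I. p i x)"
    by (intro mean_add trig_poly_sum) (use insert.prems in auto)
  finally show ?case using insert by simp
qed (auto simp: mean_def)

lemma mean_cis: "mean (\<lambda>x. cis (of_int k * x)) = (if k = 0 then 1 else 0)"
proof (cases "k = 0")
  case True
  have "(LINT x:{-pi..pi}|lborel. (1::complex)) = of_real (2 * pi)"
    by (simp add: set_lebesgue_integral_def scaleR_conv_of_real)
  then show ?thesis using True by (simp add: mean_def)
next
  case False
  define F where "F = (\<lambda>x::real. cis (of_int k * x) / (of_int k * \<i>))"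
  have "(F has_vector_derivative cis (of_int k * x)) (at x within A)" for x A
    unfolding F_def cis_conv_exp using False
    by (auto intro!: derivative_eq_intros has_vector_derivative_real_field simp: field_simps)
  then have "(LINT x:{-pi..pi}|lborel. cis (of_int k * x)) = F pi - F (-pi)"
    unfolding set_lebesgue_integral_def
    by (intro integral_FTC_Icc)
       (auto simp: cis_conv_exp intro!: continuous_intros)
  moreover have "F pi = F (-pi)"
    using trig_poly_periodic[OF trig_poly_cis[of k], of "-pi"] by (simp add: F_def)
  ultimately show ?thesis using False by (simp add: mean_def)
qed

lemma mean_shift: "trig_poly p \<Longrightarrow> mean (\<lambda>x. p (x + a)) = mean p"
proof (induction rule: trig_poly.induct)
  case (monomial c k)
  have "(\<lambda>x. c * cis (of_int k * (x + a))) = (\<lambda>x. (c * cis (of_int k * a)) * cis (of_int k * x))"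
    by (auto simp: cis_mult[symmetric] algebra_simps)
  then show ?case by (simp add: mean_cmult mean_cis)
next
  case (add p q)
  then show ?case by (simp add: mean_add trig_poly_shift)
qed

lemma mean_Re_mono:
  assumes "trig_poly p" "trig_poly q" "\<And>x. x \<in> {-pi..pi} \<Longrightarrow> Re (p x) \<le> Re (q x)"
  shows "Re (mean p) \<le> Re (mean q)"
proof -
  have "Re (LINT x:{-pi..pi}|lborel. p x) = (LINT x:{-pi..pi}|lborel. Re (p x))" if "trig_poly p" for p
    using trig_poly_set_integrable[OF that, of "-pi" pi]
    by (simp add: set_lebesgue_integral_def set_integrable_def flip: integral_Re)
  moreover have "(LINT x:{-pi..pi}|lborel. Re (p x)) \<le> (LINT x:{-pi..pi}|lborel. Re (q x))"
    by (intro set_integral_mono continuous_set_integrable continuous_intros trig_poly_continuous assms)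
  ultimately show ?thesis using assms by (simp add: mean_def divide_right_mono)
qed

lemma fcoef_expansion:
  assumes "finite S" "\<And>x. p x = (\<Sum>k\<in>S. c k * cis (of_int k * x))"
  shows "fcoef p k = (if k \<in> S then c k else 0)"
proof -
  have "(\<lambda>x. p x * cis (- (of_int k * x))) = (\<lambda>x. \<Sum>l\<in>S. c l * cis (of_int (l - k) * x))"
  proof
    fix x
    have *: "c l * cis (of_int l * x) * cis (- (of_int k * x)) = c l * cis (of_int (l - k) * x)" for l
      by (simp add: cis_mult left_diff_distrib mult.assoc)
    show "p x * cis (- (of_int k * x)) = (\<Sum>l\<in>S. c l * cis (of_int (l - k) * x))"
      by (simp only: assms(2) sum_distrib_right *)
  qed
  then have "fcoef p k = (\<Sum>l\<in>S. mean (\<lambda>x. c l * cis (of_int (l - k) * x)))"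
    unfolding fcoef_def by (simp only: mean_sum trig_poly.monomial)
  also have "\<dots> = (\<Sum>l\<in>S. if l = k then c l else 0)"
    by (intro sum.cong refl) (simp add: mean_cmult mean_cis del: of_int_diff)
  finally show ?thesis using assms(1) by simp
qed

lemma fcoef_finite_support:
  assumes "trig_poly p" shows "finite {k. fcoef p k \<noteq> 0}"
proof -
  obtain S c where S: "finite S" "\<And>x. p x = (\<Sum>k\<in>S. c k * cis (of_int k * x))"
      "\<And>k. k \<notin> S \<Longrightarrow> c k = 0"
    by (rule trig_poly_expansion[OF assms]) (rule that)
  have "{k. fcoef p k \<noteq> 0} \<subseteq> S" using fcoef_expansion[OF S(1,2)] by auto
  then show ?thesis using S finite_subset by blast
qed

lemma fcoef_sum:
  assumes "trig_poly p" "finite S" "{k. fcoef p k \<noteq> 0} \<subseteq> S"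
  shows "p x = (\<Sum>k\<in>S. fcoef p k * cis (of_int k * x))"
proof -
  obtain T c where T: "finite T" "\<And>x. p x = (\<Sum>k\<in>T. c k * cis (of_int k * x))"
      "\<And>k. k \<notin> T \<Longrightarrow> c k = 0"
    by (rule trig_poly_expansion[OF assms(1)]) (rule that)
  have "p x = (\<Sum>k\<in>T. fcoef p k * cis (of_int k * x))"
    unfolding T(2)[of x] by (intro sum.cong refl) (simp add: fcoef_expansion[OF T(1,2)])
  also have "\<dots> = (\<Sum>k\<in>S \<union> T. fcoef p k * cis (of_int k * x))"
    by (rule sum.mono_neutral_left) (use fcoef_expansion[OF T(1,2)] assms(2) T(1) in auto)
  also have "\<dots> = (\<Sum>k\<in>S. fcoef p k * cis (of_int k * x))"
    by (rule sum.mono_neutral_right) (use assms T in auto)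
  finally show ?thesis .
qed

lemma mean_cmod_sum:
  assumes "finite S"
  shows "mean (\<lambda>x. of_real ((cmod (\<Sum>k\<in>S. c k * cis (of_int k * x)))\<^sup>2)) = of_real (\<Sum>k\<in>S. (cmod (c k))\<^sup>2)"
proof -
  have "(\<lambda>x. of_real ((cmod (\<Sum>k\<in>S. c k * cis (of_int k * x)))\<^sup>2))
      = (\<lambda>x. \<Sum>k\<in>S. \<Sum>l\<in>S. (c k * cnj (c l)) * cis (of_int (k - l) * x))"
  proof
    fix x
    have *: "c k * cis (of_int k * x) * cnj (c l * cis (of_int l * x))
        = (c k * cnj (c l)) * cis (of_int (k - l) * x)" for k l
      by (simp add: cis_cnj cis_mult left_diff_distrib flip: mult.assoc)
    show "of_real ((cmod (\<Sum>k\<in>S. c k * cis (of_int k * x)))\<^sup>2)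
      = (\<Sum>k\<in>S. \<Sum>l\<in>S. (c k * cnj (c l)) * cis (of_int (k - l) * x))"
      by (simp only: complex_norm_square cnj_sum sum_product *)
  qed
  then have "mean (\<lambda>x. of_real ((cmod (\<Sum>k\<in>S. c k * cis (of_int k * x)))\<^sup>2))
      = (\<Sum>k\<in>S. \<Sum>l\<in>S. mean (\<lambda>x. (c k * cnj (c l)) * cis (of_int (k - l) * x)))"
    by (simp only: mean_sum trig_poly_sum trig_poly.monomial)
  also have "\<dots> = (\<Sum>k\<in>S. \<Sum>l\<in>S. if l = k then c k * cnj (c l) else 0)"
    by (intro sum.cong refl) (simp add: mean_cmult mean_cis del: of_int_diff)
  also have "\<dots> = of_real (\<Sum>k\<in>S. (cmod (c k))\<^sup>2)"
    using assms by (simp add: complex_norm_square del: of_real_power)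
  finally show ?thesis .
qed

lemma fcoef_parseval:
  assumes "trig_poly p" "finite S" "{k. fcoef p k \<noteq> 0} \<subseteq> S"
  shows "mean (\<lambda>x. of_real ((cmod (p x))\<^sup>2)) = of_real (\<Sum>k\<in>S. (cmod (fcoef p k))\<^sup>2)"
  using mean_cmod_sum[OF assms(2), of "fcoef p"] by (simp only: fcoef_sum[OF assms, symmetric])

lemma trig_poly_cmod_sq: "trig_poly p \<Longrightarrow> trig_poly (\<lambda>x. of_real ((cmod (p x))\<^sup>2))"
  by (subst complex_norm_square) (auto intro: trig_poly_mult trig_poly_cnj)

section \<open>Sums of squared moduli of trigonometric polynomials\<close>

text \<open>
  Sums, instead of single squares, keep the class closed under addition as well as under
  multiplication.
\<close>

inductive sos :: "(real \<Rightarrow> real) \<Rightarrow> bool" where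
  square: "trig_poly p \<Longrightarrow> sos (\<lambda>x. (cmod (p x))\<^sup>2)"
| add: "sos a \<Longrightarrow> sos b \<Longrightarrow> sos (\<lambda>x. a x + b x)"

lemma sos_nonneg: "sos a \<Longrightarrow> a x \<ge> 0"
  by (induction rule: sos.induct) auto

lemma sos_const: "c \<ge> 0 \<Longrightarrow> sos (\<lambda>x. c)"
  using sos.square[OF trig_poly_const[of "of_real (sqrt c)"]] by simp

lemma sos_mult:
  assumes "sos a" "sos b"
  shows "sos (\<lambda>x. a x * b x)"
  using assms(1)
proof (induction rule: sos.induct)
  case (square p)
  then have p: "trig_poly p" .
  show ?case using assms(2)
  proof (induction rule: sos.induct)
    case (square q)
    show ?case using sos.square[OF trig_poly_mult[OF p square]] by (simp add: norm_mult power_mult_distrib)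
  next
    case (add a b)
    then show ?case using sos.add by (simp add: algebra_simps)
  qed
next
  case (add a b)
  then show ?case using sos.add by (simp add: algebra_simps)
qed

lemma sos_cmult: "c \<ge> 0 \<Longrightarrow> sos a \<Longrightarrow> sos (\<lambda>x. c * a x)"
  by (intro sos_mult sos_const)

lemma sos_power: "sos a \<Longrightarrow> sos (\<lambda>x. a x ^ n)"
  by (induction n) (auto intro: sos_const sos_mult)

lemma sos_sum: "(\<And>i. i \<in> I \<Longrightarrow> sos (a i)) \<Longrightarrow> sos (\<lambda>x. \<Sum>i\<in>I. a i x)"
  by (induction I rule: infinite_finite_induct) (auto intro: sos_const sos.add)

lemma sos_shift: "sos a \<Longrightarrow> sos (\<lambda>x. a (x + t))"
  by (induction rule: sos.induct) (auto intro: sos.intros trig_poly_shift)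

lemma sos_trig_poly: "sos a \<Longrightarrow> trig_poly (\<lambda>x. of_real (a x))"
  by (induction rule: sos.induct)
     (auto intro: trig_poly.add trig_poly_cmod_sq simp del: of_real_power)

lemma sos_cos_half: "sos (\<lambda>x. (cos (x / 2))\<^sup>2)"
proof -
  have "sos (\<lambda>x. (cmod (1/2 + (1/2) * cis (of_int 1 * x)))\<^sup>2)"
    by (intro sos.intros trig_poly.intros trig_poly_const)
  moreover have "(cmod (1/2 + (1/2) * cis (of_int 1 * x)))\<^sup>2 = (cos (x / 2))\<^sup>2" for x
  proof -
    have "(cmod (1/2 + (1/2) * cis (of_int 1 * x)))\<^sup>2 = (1/2 + cos x / 2)\<^sup>2 + (sin x / 2)\<^sup>2"
      unfolding cmod_power2 by simp
    also have "\<dots> = 1 / 4 + cos x / 2 + ((sin x)\<^sup>2 + (cos x)\<^sup>2) / 4"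
      by (simp add: power2_eq_square add_divide_distrib distrib_left distrib_right del: sin_cos_squared_add3)
    also have "\<dots> = (cos (x / 2))\<^sup>2" unfolding sin_cos_squared_add using cos_double_cos[of "x/2"] by (simp add: diff_divide_distrib)
    finally show ?thesis .
  qed
  ultimately show ?thesis by simp
qed

lemma sos_sin_half: "sos (\<lambda>x. (sin (x / 2))\<^sup>2)"
proof -
  have "(cos ((x + pi) / 2))\<^sup>2 = (sin (x / 2))\<^sup>2" for x
    by (simp add: add_divide_distrib cos_add)
  then show ?thesis using sos_shift[OF sos_cos_half, of pi] by simp
qed

text \<open>
  One monomial at a time: \<open>(1 + |c|\<^sup>2) / 2 - Re (c e\<^sup>i\<^sup>k\<^sup>x) = |1 - c e\<^sup>i\<^sup>k\<^sup>x|\<^sup>2 / 2\<close>.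
\<close>

lemma sos_const_minus_Re:
  assumes "trig_poly p"
  obtains A where "A \<ge> 0" "sos (\<lambda>x. A - Re (p x))"
proof -
  from assms have "\<exists>A\<ge>0. sos (\<lambda>x. A - Re (p x))"
  proof (induction rule: trig_poly.induct)
    case (monomial c k)
    have "sos (\<lambda>x. (1/2) * (cmod (1 - c * cis (of_int k * x)))\<^sup>2)"
      by (intro sos_cmult sos.intros trig_poly_diff trig_poly_const trig_poly.monomial) auto
    moreover have "(1/2) * (cmod (1 - c * cis (of_int k * x)))\<^sup>2 = (1 + (cmod c)\<^sup>2) / 2 - Re (c * cis (of_int k * x))" for x
    proof -
      have "(cmod (1 - z))\<^sup>2 = 1 + (cmod z)\<^sup>2 - 2 * Re z" for z
        unfolding cmod_power2 by (simp add: power2_eq_square algebra_simps)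
      moreover have "cmod (c * cis (of_int k * x)) = cmod c" by (simp add: norm_mult)
      ultimately have "(cmod (1 - c * cis (of_int k * x)))\<^sup>2 = 1 + (cmod c)\<^sup>2 - 2 * Re (c * cis (of_int k * x))"
        by metis
      then show ?thesis by simp
    qed
    ultimately have "sos (\<lambda>x. (1 + (cmod c)\<^sup>2) / 2 - Re (c * cis (of_int k * x)))"
      by (simp only:)
    then show ?case by (intro exI[of _ "(1 + (cmod c)\<^sup>2) / 2"] conjI) auto
  next
    case (add p q)
    then obtain A B where "A \<ge> 0" "B \<ge> 0" "sos (\<lambda>x. A - Re (p x))" "sos (\<lambda>x. B - Re (q x))" by blast
    then show ?case using sos.add[of "\<lambda>x. A - Re (p x)" "\<lambda>x. B - Re (q x)"]
      by (intro exI[of _ "A + B"]) (auto simp: algebra_simps)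
  qed
  then show ?thesis using that by blast
qed

lemma sos_expansion:
  assumes "sos a"
  obtains n :: nat and p where "\<And>i. i < n \<Longrightarrow> trig_poly (p i)" "\<And>x. a x = (\<Sum>i<n. (cmod (p i x))\<^sup>2)"
proof -
  from assms have "\<exists>(n::nat) p. (\<forall>i<n. trig_poly (p i)) \<and> (\<forall>x. a x = (\<Sum>i<n. (cmod (p i x))\<^sup>2))"
  proof (induction rule: sos.induct)
    case (square p)
    then show ?case by (intro exI[of _ 1] exI[of _ "\<lambda>_. p"]) auto
  next
    case (add a b)
    then obtain n m :: nat and p q where *: "\<forall>i<n. trig_poly (p i)" "\<forall>x. a x = (\<Sum>i<n. (cmod (p i x))\<^sup>2)"
      "\<forall>i<m. trig_poly (q i)" "\<forall>x. b x = (\<Sum>i<m. (cmod (q i x))\<^sup>2)" by blast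
    define r where "r = (\<lambda>i. if i < n then p i else q (i - n))"
    have split: "(\<Sum>i<n+l. f i) = (\<Sum>i<n. f i) + (\<Sum>i<l. f (n + i))" for f :: "nat \<Rightarrow> real" and l
      by (induction l) (auto simp: algebra_simps)
    have "(\<Sum>i<n+m. (cmod (r i x))\<^sup>2) = a x + b x" for x
      using * by (simp add: split r_def)
    moreover have "\<forall>i<n+m. trig_poly (r i)" using * by (auto simp: r_def)
    ultimately show ?case by metis
  qed
  then show ?thesis using that by blast
qed

section \<open>The function \<open>\<tau>\<close> in Bernstein form\<close>

text \<open>
  The derivative of a Bernstein polynomial is a multiple of the difference of two neighbours of
  lower degree, so the derivative of a tail of them telescopes to one term.
\<close>

lemma bernstein_tail_deriv:
  fixes y :: real
  assumes "l \<le> M"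
  shows "((\<lambda>y. \<Sum>j=Suc l..Suc M. of_nat (Suc M choose j) * y ^ j * (1 - y) ^ (Suc M - j))
     has_field_derivative of_nat (Suc M) * of_nat (M choose l) * y ^ l * (1 - y) ^ (M - l)) (at y)"
  using assms
proof (induction l rule: inc_induct)
  case base
  have "((\<lambda>y::real. y ^ Suc M) has_field_derivative real (Suc M) * y ^ M) (at y)"
    using DERIV_pow[of "Suc M" y] by simp
  then show ?case by (simp only: atLeastAtMost_singleton sum.insert) simp
next
  case (step l)
  let ?b = "\<lambda>j y. of_nat (Suc M choose j) * y ^ j * (1 - y :: real) ^ (Suc M - j)"
  have split: "(\<lambda>y. \<Sum>j=Suc l..Suc M. ?b j y) = (\<lambda>y. ?b (Suc l) y + (\<Sum>j=Suc (Suc l)..Suc M. ?b j y))"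
    using step by (intro ext sum.atLeast_Suc_atMost) auto
  have M: "M - l = Suc (M - Suc l)" using step by simp
  have c1: "real (Suc l) * real (Suc M choose Suc l) = real (Suc M) * real (M choose l)"
    by (metis Suc_times_binomial_eq of_nat_mult mult.commute)
  have "Suc (M - Suc l) * (Suc M choose Suc l) = Suc M * (M choose Suc l)"
    using binomial_absorb_comp[of "Suc M" "Suc l"] M by simp
  then have c2: "real (Suc (M - Suc l)) * real (Suc M choose Suc l) = real (Suc M) * real (M choose Suc l)"
    by (metis of_nat_mult)
  have "((\<lambda>y. ?b (Suc l) y) has_field_derivative
      of_nat (Suc M choose Suc l) * (real (Suc l) * y ^ l) * (1 - y) ^ (M - l)
      - of_nat (Suc M choose Suc l) * y ^ Suc l * (real (Suc (M - Suc l)) * (1 - y) ^ (M - Suc l))) (at y)"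
    unfolding diff_Suc_Suc M
    by (rule derivative_eq_intros refl | simp)+
  also have "of_nat (Suc M choose Suc l) * (real (Suc l) * y ^ l) * (1 - y) ^ (M - l)
      = (real (Suc l) * real (Suc M choose Suc l)) * y ^ l * (1 - y) ^ (M - l)" by (simp only: ac_simps)
  also note c1
  also have "of_nat (Suc M choose Suc l) * y ^ Suc l * (real (Suc (M - Suc l)) * (1 - y) ^ (M - Suc l))
      = (real (Suc (M - Suc l)) * real (Suc M choose Suc l)) * y ^ Suc l * (1 - y) ^ (M - Suc l)"
    by (simp only: ac_simps)
  also note c2
  finally show ?case unfolding split
    using DERIV_add[OF _ step.IH] by fastforce
qed

text \<open>
  As a function of \<open>y = cos\<^sup>2(x/2)\<close>, the integral of \<open>sin\<^sup>2\<^sup>n\<^sup>+\<^sup>1\<close> is an incomplete beta integral, by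
  \<open>sin\<^sup>2 x = 4 y (1 - y)\<close>. Thus \<open>\<tau>\<close> is the upper half of the binomial expansion of
  \<open>(y + (1 - y))\<^sup>2\<^sup>n\<^sup>+\<^sup>1\<close>, and its nonnegative coefficients make it a sum of squares.
\<close>

lemma tau_bernstein:
  "tau n x = (\<Sum>j=Suc n..2*n+1. of_nat (2*n+1 choose j) * ((cos (x/2))\<^sup>2) ^ j * ((sin (x/2))\<^sup>2) ^ (2*n+1 - j))"
proof -
  define T where "T = (\<lambda>y::real. \<Sum>j=Suc n..Suc (2*n). of_nat (Suc (2*n) choose j) * y ^ j * (1 - y) ^ (Suc (2*n) - j))"
  define B where "B = (\<lambda>x. T ((cos (x/2))\<^sup>2))"
  define c where "c = of_nat (Suc (2*n)) * of_nat (2*n choose n) / 4 ^ n / (2::real)"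
  have "2 * n choose n > 0" by simp
  then have "c > 0" by (simp add: c_def)
  have T': "(T has_field_derivative of_nat (Suc (2*n)) * of_nat (2*n choose n) * y ^ n * (1 - y) ^ n) (at y)" for y
    using bernstein_tail_deriv[of n "2*n" y] unfolding T_def by simp
  have B': "(B has_real_derivative - c * sin x ^ (2*n+1)) (at x)" for x
  proof -
    let ?y = "(cos (x/2))\<^sup>2"
    have y: "((\<lambda>x. (cos (x/2))\<^sup>2) has_real_derivative - (sin x / 2)) (at x)"
      using sin_double[of "x/2"] by (auto intro!: derivative_eq_intros)
    have "?y * (1 - ?y) = (sin x)\<^sup>2 / 4"
      using sin_double[of "x/2"] by (simp add: power_mult_distrib flip: sin_squared_eq)
    then have "?y ^ n * (1 - ?y) ^ n = (sin x)^(2*n) / 4 ^ n"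
      by (simp only: power_divide power_mult flip: power_mult_distrib)
    then have "of_nat (Suc (2*n)) * of_nat (2*n choose n) * ?y ^ n * (1 - ?y) ^ n * - (sin x / 2)
        = - c * sin x ^ (2*n+1)"
      by (simp add: c_def mult.assoc)
    moreover have "(B has_real_derivative of_nat (Suc (2*n)) * of_nat (2*n choose n) * ?y ^ n * (1 - ?y) ^ n * - (sin x / 2)) (at x)"
      unfolding B_def by (rule DERIV_chain2[OF T' y])
    ultimately show ?thesis by (simp only:)
  qed
  have int: "(LBINT t=ereal 0..ereal x. sin t ^ (2 * n + 1)) = (1 - B x) / c" for x
  proof -
    have "(LBINT t=ereal 0..ereal x. sin t ^ (2 * n + 1)) = - B x / c - - B 0 / c"
    proof (rule interval_integral_FTC_finite)
      show "continuous_on {min 0 x..max 0 x} (\<lambda>t. sin t ^ (2 * n + 1))" by (intro continuous_intros)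
      show "((\<lambda>x. - B x / c) has_vector_derivative sin t ^ (2 * n + 1)) (at t within {min 0 x..max 0 x})" for t
      proof -
        have "((\<lambda>x. - B x / c) has_real_derivative - (- c * sin t ^ (2*n+1)) / c) (at t)"
          by (intro DERIV_cdivide DERIV_minus B')
        also have "- (- c * sin t ^ (2*n+1)) / c = sin t ^ (2*n+1)" using \<open>c > 0\<close> by simp
        finally show ?thesis
          by (simp only: has_real_derivative_iff_has_vector_derivative has_vector_derivative_at_within)
      qed
    qed
    moreover have "B 0 = 1"
    proof -
      have "B 0 = (\<Sum>j=Suc n..Suc (2*n). if j = Suc (2*n) then 1 else 0)"
        unfolding B_def T_def by (rule sum.cong) auto
      then show ?thesis by simp
    qed
    ultimately show ?thesis by (simp add: diff_divide_distrib)
  qed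
  have "B pi = 0" unfolding B_def T_def by (auto intro!: sum.neutral)
  then have "tau n x = B x" unfolding tau_def int using \<open>c > 0\<close> by simp
  moreover have "1 - (cos (x/2))\<^sup>2 = (sin (x/2))\<^sup>2" by (simp add: sin_squared_eq)
  ultimately show ?thesis by (simp add: B_def T_def)
qed

lemma cos_sin_half_shift:
  "(cos ((x + pi) / 2))\<^sup>2 = (sin (x / 2))\<^sup>2" "(sin ((x + pi) / 2))\<^sup>2 = (cos (x / 2))\<^sup>2" for x :: real
  by (simp_all add: add_divide_distrib cos_add sin_add)

lemma tau_shift_bernstein:
  "tau n (x + pi) = (\<Sum>j=0..n. of_nat (2*n+1 choose j) * ((cos (x/2))\<^sup>2) ^ j * ((sin (x/2))\<^sup>2) ^ (2*n+1 - j))"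
  unfolding tau_bernstein cos_sin_half_shift
proof (rule sum.reindex_bij_witness[of _ "\<lambda>j. 2*n+1-j" "\<lambda>j. 2*n+1-j"])
  fix j assume j: "j \<in> {Suc n..2*n+1}"
  show "real (2*n+1 choose (2*n+1-j)) * ((cos (x/2))\<^sup>2) ^ (2*n+1-j) * ((sin (x/2))\<^sup>2) ^ (2*n+1 - (2*n+1-j))
    = real (2*n+1 choose j) * ((sin (x/2))\<^sup>2) ^ j * ((cos (x/2))\<^sup>2) ^ (2*n+1-j)"
  proof -
    have le: "j \<le> 2*n+1" using j by simp
    show ?thesis unfolding diff_diff_cancel[OF le] binomial_symmetric[OF le, symmetric]
      by (simp only: ac_simps)
  qed
qed auto

text \<open>
  The shift by \<open>\<pi>\<close> exchanges \<open>cos\<^sup>2(x/2)\<close> and \<open>sin\<^sup>2(x/2)\<close>, and with them the two halves of the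
  binomial expansion.
\<close>

lemma tau_add_shift: "tau n x + tau n (x + pi) = 1"
proof -
  let ?b = "\<lambda>j. of_nat (2*n+1 choose j) * ((cos (x/2))\<^sup>2) ^ j * ((sin (x/2))\<^sup>2) ^ (2*n+1 - j)"
  have "1 = ((cos (x/2))\<^sup>2 + (sin (x/2))\<^sup>2) ^ (2*n+1)" by simp
  also have "\<dots> = (\<Sum>j\<le>2*n+1. ?b j)" by (rule binomial_ring)
  also have "{..2*n+1} = {0..n} \<union> {Suc n..2*n+1}" by auto
  also have "sum ?b ({0..n} \<union> {Suc n..2*n+1}) = sum ?b {0..n} + sum ?b {Suc n..2*n+1}"
    by (rule sum.union_disjoint) auto
  finally show ?thesis unfolding tau_shift_bernstein by (simp add: tau_bernstein)
qed

lemma sos_tau: "sos (tau n)"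
proof -
  have "sos (\<lambda>x. \<Sum>j=Suc n..2*n+1. of_nat (2*n+1 choose j) * ((cos (x/2))\<^sup>2) ^ j * ((sin (x/2))\<^sup>2) ^ (2*n+1 - j))"
    by (intro sos_sum sos_mult sos_power sos_cos_half sos_sin_half sos_const) auto
  then show ?thesis by (simp only: tau_bernstein[symmetric])
qed

lemma tau_nonneg: "tau n x \<ge> 0"
  by (rule sos_nonneg[OF sos_tau])

lemma tau_le_1: "tau n x \<le> 1"
  using tau_add_shift[of n x] tau_nonneg[of n "x + pi"] by simp

text \<open>
  Each term of the Bernstein form contains \<open>cos\<^sup>2\<^sup>n\<^sup>+\<^sup>2(x/2)\<close>, and half of the binomial coefficients add
  up to \<open>4\<^sup>n\<close>. That this constant is smaller than \<open>4\<^sup>n\<^sup>+\<^sup>1\<close> is the source of the decay of the refinable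
  function's transform.
\<close>

lemma tau_le_cos: "tau n x \<le> 4 ^ n * ((cos (x/2))\<^sup>2) ^ Suc n"
proof -
  have "tau n x \<le> (\<Sum>j=Suc n..2*n+1. of_nat (2*n+1 choose j) * ((cos (x/2))\<^sup>2) ^ Suc n)"
    unfolding tau_bernstein
  proof (rule sum_mono)
    fix j assume j: "j \<in> {Suc n..2*n+1}"
    have "c ^ j * s ^ (2*n+1 - j) \<le> c ^ Suc n * 1" if "0 \<le> c" "c \<le> 1" "0 \<le> s" "s \<le> 1" for c s :: real
      using j that by (intro mult_mono power_decreasing power_le_one zero_le_power) auto
    from this[of "(cos (x/2))\<^sup>2" "(sin (x/2))\<^sup>2"]
    have "((cos (x/2))\<^sup>2) ^ j * ((sin (x/2))\<^sup>2) ^ (2*n+1 - j) \<le> ((cos (x/2))\<^sup>2) ^ Suc n * 1"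
      by (simp add: abs_square_le_1)
    then show "real (2*n+1 choose j) * ((cos (x/2))\<^sup>2) ^ j * ((sin (x/2))\<^sup>2) ^ (2*n+1 - j)
        \<le> real (2*n+1 choose j) * ((cos (x/2))\<^sup>2) ^ Suc n"
      by (simp add: mult.assoc mult_left_mono)
  qed
  also have "\<dots> = real (\<Sum>j=Suc n..2*n+1. (2*n+1 choose j)) * ((cos (x/2))\<^sup>2) ^ Suc n"
    by (simp only: sum_distrib_right of_nat_sum)
  also have "(\<Sum>j=Suc n..2*n+1. (2*n+1 choose j)) = (\<Sum>j\<le>n. (2*n+1 choose j))"
  proof (rule sum.reindex_bij_witness[of _ "\<lambda>j. 2*n+1-j" "\<lambda>j. 2*n+1-j"])
    fix j assume "j \<in> {Suc n..2*n+1}"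
    then show "(2*n+1 choose (2*n+1-j)) = (2*n+1 choose j)"
      by (intro binomial_symmetric[symmetric]) simp
  qed auto
  also have "\<dots> = 4 ^ n" using binomial_r_part_sum[of n] by (simp add: power_mult)
  finally show ?thesis by simp
qed

lemma tau_eq_0_iff: "tau n x = 0 \<longleftrightarrow> cos (x/2) = 0"
proof
  assume "cos (x/2) = 0"
  then show "tau n x = 0" using tau_le_cos[of n x] tau_nonneg[of n x] by simp
next
  assume *: "tau n x = 0"
  have "of_nat (2*n+1 choose (2*n+1)) * ((cos (x/2))\<^sup>2) ^ (2*n+1) * ((sin (x/2))\<^sup>2) ^ (2*n+1 - (2*n+1)) \<le> tau n x"
    unfolding tau_bernstein by (rule member_le_sum) auto
  then have "((cos (x/2))\<^sup>2) ^ (2*n+1) \<le> 0" using * by simp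
  moreover have "((cos (x/2))\<^sup>2) ^ (2*n+1) \<ge> 0" by (intro zero_le_power zero_le_power2)
  ultimately have "((cos (x/2))\<^sup>2) ^ (2*n+1) = 0" by linarith
  then have "((cos (x/2))\<^sup>2) = 0 \<and> 0 < 2*n+1" by (simp only: power_eq_0_iff)
  then show "cos (x/2) = 0" by simp
qed

lemma tau_0: "tau n 0 = 1"
  using tau_add_shift[of n 0] tau_eq_0_iff[of n pi] by simp

lemma tau_periodic: "tau n (x + 2 * pi) = tau n x"
  using tau_add_shift[of n x] tau_add_shift[of n "x + pi"] by (simp add: algebra_simps)

text \<open>The flatness of \<open>\<tau>\<close> at 0, from which the vanishing moments come.\<close>

lemma tau_shift_le_power: "tau n (x + pi) \<le> (x\<^sup>2) ^ Suc n"
proof -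
  have "tau n (x + pi) \<le> 4 ^ n * ((sin (x/2))\<^sup>2) ^ Suc n"
    using tau_le_cos[of n "x + pi"] by (simp add: cos_sin_half_shift)
  also have "\<dots> \<le> 4 ^ n * ((x/2)\<^sup>2) ^ Suc n"
  proof -
    have "(sin (x/2))\<^sup>2 \<le> (x/2)\<^sup>2"
      using abs_sin_x_le_abs_x[of "x/2"] by (simp only: abs_le_square_iff)
    from power_mono[OF this zero_le_power2, of "Suc n"] show ?thesis
      by (rule mult_left_mono) simp
  qed
  also have "\<dots> = (x\<^sup>2) ^ Suc n / 4"
    by (simp add: power_divide field_simps)
  also have "\<dots> \<le> (x\<^sup>2) ^ Suc n" by simp
  finally show ?thesis .
qed

lemma tau_continuous: "continuous_on A (tau n)"
proof -
  have "continuous_on A (\<lambda>x. Re (of_real (tau n x)))"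
    by (intro continuous_on_Re trig_poly_continuous sos_trig_poly sos_tau)
  then show ?thesis by simp
qed

section \<open>Approximation by zero-free trigonometric polynomials\<close>

lemma periodic_int_shift:
  fixes h :: "real \<Rightarrow> 'a"
  assumes "\<And>x. h (x + 2 * pi) = h x"
  shows "h (x + 2 * pi * of_int k) = h x"
proof -
  have n: "h (y + 2 * pi * of_nat n) = h y" for y and n :: nat
  proof (induction n)
    case (Suc n)
    have "y + 2 * pi * of_nat (Suc n) = y + 2 * pi * of_nat n + 2 * pi" by (simp add: algebra_simps)
    then show ?case using assms Suc by metis
  qed simp
  show ?thesis
  proof (cases k rule: int_cases3)
    case (pos m)
    then show ?thesis using n[of x m] by simp
  next
    case (neg m)
    then have "x = x + 2 * pi * of_int k + 2 * pi * of_nat m" by simp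
    then show ?thesis using n[of "x + 2 * pi * of_int k" m] by metis
  qed simp
qed

lemma period_reduction:
  obtains k :: int where "x + 2 * pi * of_int k \<in> {-pi..<pi}"
proof -
  define k where "k = - \<lfloor>(x + pi) / (2 * pi)\<rfloor>"
  have "of_int (- k) \<le> (x + pi) / (2 * pi)" "(x + pi) / (2 * pi) < of_int (- k) + 1"
    unfolding k_def by (simp, linarith)
  then have "of_int (- k) * (2 * pi) \<le> x + pi" "x + pi < (of_int (- k) + 1) * (2 * pi)"
    by (simp_all only: pos_le_divide_eq pos_divide_less_eq mult_pos_pos zero_less_numeral pi_gt_zero)
  then have "x + 2 * pi * of_int k \<in> {-pi..<pi}"
    by (simp add: algebra_simps)
  then show ?thesis using that by blast
qed

lemma trig_poly_real_polynomial_cis: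
  assumes "real_polynomial_function (h :: complex \<Rightarrow> real)"
  shows "trig_poly (\<lambda>x. of_real (h (cis x)))"
  using assms
proof (induction rule: real_polynomial_function.induct)
  case (linear h)
  then interpret bounded_linear h .
  have "h (cis x) = cos x * h 1 + sin x * h \<i>" for x
  proof -
    have "cis x = cos x *\<^sub>R 1 + sin x *\<^sub>R \<i>" by (simp add: complex_eq_iff)
    then show ?thesis by (simp add: add scale)
  qed
  moreover have "trig_poly (\<lambda>x. of_real (h 1) * of_real (cos x) + of_real (h \<i>) * of_real (sin x))"
    by (intro trig_poly.add trig_poly_cmult trig_poly_cos trig_poly_sin)
  ultimately show ?case by (simp add: mult.commute)
qed (auto intro: trig_poly_const trig_poly.add trig_poly_mult)

lemma periodic_factors_through_circle:
  fixes h :: "real \<Rightarrow> complex"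
  assumes "h \<in> space_C"
  obtains F where "continuous_on (sphere 0 1) F" "\<And>x. F (cis x) = h x"
proof -
  have h: "continuous_on UNIV h" "\<And>x. h (x + 2 * pi) = h x"
    using assms by (auto simp: space_C_def)
  define F where "F = (\<lambda>z. h (Arg z))"
  have F: "F (cis x) = h x" for x
  proof -
    obtain k :: int where k: "x + 2 * pi * of_int k \<in> {-pi..<pi}" by (rule period_reduction)
    define y where "y = x + 2 * pi * of_int k"
    have "cis y = cis x" unfolding y_def
      by (rule periodic_int_shift) (simp add: complex_eq_iff)
    moreover have "h y = h x" unfolding y_def by (rule periodic_int_shift[where h=h, OF h(2)])
    moreover have "h (Arg (cis y)) = h y"
    proof (cases "y = -pi")
      case True
      have "cis y = of_real (-1)" unfolding True by (simp add: complex_eq_iff)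
      then have "Arg (cis y) = pi" by (simp only: Arg_of_real) simp
      then show ?thesis using h(2)[of "-pi"] True by simp
    next
      case False
      then have "Arg (cis y) = y" using k by (intro Arg_cis) (auto simp: y_def)
      then show ?thesis by simp
    qed
    ultimately show ?thesis by (simp add: F_def)
  qed
  have A: "continuous_on (- \<real>\<^sub>\<le>\<^sub>0) F"
    unfolding F_def by (rule continuous_on_compose2[OF h(1) continuous_on_Arg]) auto
  let ?P = "{z::complex. - z \<in> \<real>\<^sub>\<le>\<^sub>0}"
  \<comment> \<open>Across the cut of the argument, the angle is measured from the opposite point instead.\<close>
  have G: "F z = h (Arg (- z) + pi)" if "z \<noteq> 0" for z
  proof -
    have "cis (Arg (- z) + pi) = - cis (Arg (- z))" by (simp add: complex_eq_iff)
    also have "\<dots> = cis (Arg z)" using that by (simp add: cis_Arg sgn_minus)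
    finally show ?thesis using F by (metis F_def)
  qed
  have "continuous_on (- ?P) (\<lambda>z. h (Arg (- z) + pi))"
    by (rule continuous_on_compose2[OF h(1)]) (auto intro!: continuous_intros)
  then have B: "continuous_on (- ?P) F"
  proof (rule continuous_on_eq)
    fix z assume "z \<in> - ?P"
    then have "z \<noteq> 0" by auto
    then show "h (Arg (- z) + pi) = F z" by (rule G[symmetric])
  qed
  have "closed ?P"
    by (intro continuous_closed_vimage[OF closed_nonpos_Reals_complex, of uminus, unfolded vimage_def] continuous_intros)
  then have "continuous_on (- \<real>\<^sub>\<le>\<^sub>0 \<union> - ?P) F"
    by (intro continuous_on_open_Un A B) auto
  then have "continuous_on (sphere 0 1) F"
    by (rule continuous_on_subset) (auto simp: complex_nonpos_Reals_iff cmod_def)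
  then show ?thesis using F that by blast
qed

text \<open>
  On the unit circle, polynomials in the real and imaginary part are trigonometric polynomials, so
  this is the Stone-Weierstrass theorem there.
\<close>

lemma trig_poly_dense:
  assumes "h \<in> space_C" "e > 0"
  obtains p where "trig_poly p" "\<And>x. cmod (h x - p x) < e"
proof -
  obtain F where F: "continuous_on (sphere 0 1) F" "\<And>x. F (cis x) = h x"
    using periodic_factors_through_circle[OF assms(1)] by metis
  obtain G :: "complex \<Rightarrow> complex" where G: "polynomial_function G" "\<And>z. z \<in> sphere 0 1 \<Longrightarrow> cmod (F z - G z) < e"
    using Stone_Weierstrass_polynomial_function[OF compact_sphere F(1) assms(2)] by auto
  have "real_polynomial_function (Re \<circ> G)" "real_polynomial_function (Im \<circ> G)"
    using G(1) unfolding polynomial_function_def by (auto intro: bounded_linear_Re bounded_linear_Im)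
  then have "trig_poly (\<lambda>x. of_real ((Re \<circ> G) (cis x)) + \<i> * of_real ((Im \<circ> G) (cis x)))"
    by (intro trig_poly.add trig_poly_cmult trig_poly_real_polynomial_cis)
  moreover have "(\<lambda>x. of_real ((Re \<circ> G) (cis x)) + \<i> * of_real ((Im \<circ> G) (cis x))) = (\<lambda>x. G (cis x))"
    by (auto simp: complex_eq_iff)
  ultimately have "trig_poly (\<lambda>x. G (cis x))" by simp
  moreover have "cmod (h x - G (cis x)) < e" for x
    using G(2)[of "cis x"] F(2)[of x] by simp
  ultimately show ?thesis using that by blast
qed

lemma tau_shift_bounded_below:
  assumes "\<delta> > 0"
  obtains \<sigma> where "\<sigma> > 0" "\<And>x. x \<in> {-pi..<pi} \<Longrightarrow> tau n (x + pi) < \<sigma> \<Longrightarrow> \<bar>x\<bar> < \<delta>"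
proof -
  define X where "X = {-pi..pi} - {-\<delta><..<\<delta>}"
  have pos: "tau n (x + pi) > 0" if "x \<in> X" for x
  proof -
    have "sin (x/2) \<noteq> 0"
    proof
      assume "sin (x/2) = 0"
      moreover have "-pi < x/2" "x/2 < pi" using that pi_gt_zero unfolding X_def by (simp_all, linarith+)
      ultimately have "x = 0" using sin_eq_0_pi[of "x/2"] by simp
      then show False using that assms by (simp add: X_def)
    qed
    then have "tau n (x + pi) \<noteq> 0" using tau_eq_0_iff[of n "x + pi"] cos_sin_half_shift(1)[of x] by auto
    then show ?thesis using tau_nonneg[of n "x + pi"] by linarith
  qed
  have "compact X" unfolding X_def by (intro compact_diff compact_Icc) auto
  have "\<exists>\<sigma>>0. \<forall>x\<in>X. \<sigma> \<le> tau n (x + pi)"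
  proof (cases "X = {}")
    case False
    have "continuous_on X (\<lambda>x. tau n (x + pi))"
      by (intro continuous_on_compose2[OF tau_continuous[of UNIV]] continuous_intros) auto
    from continuous_attains_inf[OF \<open>compact X\<close> False this] pos show ?thesis by metis
  qed (auto intro: exI[of _ 1])
  then obtain \<sigma> where \<sigma>: "\<sigma> > 0" "\<And>x. x \<in> X \<Longrightarrow> \<sigma> \<le> tau n (x + pi)" by blast
  then have "\<bar>x\<bar> < \<delta>" if "x \<in> {-pi..<pi}" "tau n (x + pi) < \<sigma>" for x
    using that \<sigma>(2)[of x] by (force simp: X_def)
  then show ?thesis using that \<sigma>(1) by blast
qed

lemma tau_shift_trig_poly: "trig_poly (\<lambda>x. of_real (tau n (x + pi)))"
  by (intro sos_trig_poly sos_shift sos_tau)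

text \<open>
  A function with value 1 at 0 is approximated by trigonometric polynomials that agree with 1 at 0
  to the order to which \<open>\<tau>\<close> does: divide by \<open>1 - \<tau> + \<eta>\<close> instead of \<open>1 - \<tau>\<close>.
\<close>

lemma flat_approximation:
  assumes "f \<in> space_C" "f 0 = 1" "e > 0"
  obtains g where "trig_poly g" "\<And>x. cmod (f x - (1 + of_real (tau n (x + pi)) * g x)) \<le> e"
proof -
  let ?s = "\<lambda>x. tau n (x + pi)"
  have f: "continuous_on UNIV f" "\<And>x. f (x + 2 * pi) = f x"
    using assms by (auto simp: space_C_def)
  obtain \<delta> where \<delta>: "\<delta> > 0" "\<And>x. \<bar>x\<bar> < \<delta> \<Longrightarrow> cmod (f x - 1) < e / 2"
    using f(1) assms(2,3) unfolding continuous_on_iff dist_norm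
    by (metis UNIV_I diff_zero half_gt_zero real_norm_def)
  obtain \<sigma> where \<sigma>: "\<sigma> > 0" "\<And>x. x \<in> {-pi..<pi} \<Longrightarrow> ?s x < \<sigma> \<Longrightarrow> \<bar>x\<bar> < \<delta>"
    using tau_shift_bounded_below[OF \<delta>(1)] by metis
  have "compact (f ` {-pi..pi})"
    by (intro compact_continuous_image continuous_on_subset[OF f(1)]) auto
  then obtain B where "\<And>x. x \<in> {-pi..pi} \<Longrightarrow> cmod (f x) \<le> B"
    using compact_imp_bounded bounded_iff by (metis imageI)
  moreover define D where "D = max B 0 + 1"
  ultimately have D: "D > 0" "\<And>x. x \<in> {-pi..<pi} \<Longrightarrow> cmod (f x - 1) \<le> D"
  proof -
    fix x assume B: "\<And>x. x \<in> {-pi..pi} \<Longrightarrow> cmod (f x) \<le> B" and x: "x \<in> {-pi..<pi}"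
    have "cmod (f x - 1) \<le> cmod (f x) + 1" using norm_triangle_ineq4[of "f x" 1] by simp
    also have "cmod (f x) \<le> B" using B x by simp
    finally show "cmod (f x - 1) \<le> D" by (simp add: D_def)
  qed (simp add: D_def)
  \<comment> \<open>Dividing by \<open>s + \<eta>\<close> leaves the error \<open>|f - 1| \<eta> / (s + \<eta>)\<close>. Where \<open>s < \<sigma>\<close> it is small because
    \<open>f\<close> is close to 1, elsewhere it is at most \<open>D \<eta> / \<sigma>\<close>.\<close>
  define \<eta> where "\<eta> = \<sigma> * e / (2 * D)"
  have \<eta>: "\<eta> > 0" using \<sigma> D assms by (simp add: \<eta>_def)
  define h where "h = (\<lambda>x. (f x - 1) / of_real (?s x + \<eta>))"
  have pos: "?s x + \<eta> > 0" for x using tau_nonneg[of n "x + pi"] \<eta> by simp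
  have "continuous_on UNIV ?s"
    by (intro continuous_on_compose2[OF tau_continuous[of UNIV]] continuous_intros) auto
  then have "continuous_on UNIV h" unfolding h_def
    using pos by (intro continuous_intros f(1)) (auto simp: less_le simp flip: of_real_add)
  moreover have "h (x + 2 * pi) = h x" for x
    using f(2)[of x] tau_periodic[of n "x + pi"] by (simp add: h_def algebra_simps)
  ultimately have "h \<in> space_C" by (simp add: space_C_def)
  then obtain g where g: "trig_poly g" "\<And>x. cmod (h x - g x) < e / 2"
    using trig_poly_dense[of h "e/2"] assms(3) by auto
  have *: "cmod (f x - (1 + of_real (?s x) * g x)) \<le> e" if x: "x \<in> {-pi..<pi}" for x
  proof -
    have "f x - (1 + of_real (?s x) * g x) = (f x - 1) * of_real (\<eta> / (?s x + \<eta>)) + of_real (?s x) * (h x - g x)"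
    proof -
      have "(f x - 1) = h x * of_real (?s x + \<eta>)" using pos[of x] by (simp add: h_def flip: of_real_add)
      moreover have "(f x - 1) * of_real (\<eta> / (?s x + \<eta>)) = h x * of_real \<eta>" by (simp add: h_def)
      ultimately show ?thesis by (simp add: algebra_simps)
    qed
    also have "cmod \<dots> \<le> cmod ((f x - 1) * of_real (\<eta> / (?s x + \<eta>))) + cmod (of_real (?s x) * (h x - g x))"
      by (rule norm_triangle_ineq)
    also have "cmod (of_real (?s x) * (h x - g x)) \<le> 1 * (e / 2)"
      unfolding norm_mult using tau_nonneg[of n "x + pi"] tau_le_1[of n "x + pi"] g(2)[of x]
      by (intro mult_mono) auto
    also have "cmod ((f x - 1) * of_real (\<eta> / (?s x + \<eta>))) \<le> e / 2"
    proof (cases "?s x < \<sigma>")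
      case True
      then have "cmod (f x - 1) \<le> e / 2" using \<sigma> \<delta> x by (meson less_imp_le)
      moreover have "\<bar>\<eta> / (?s x + \<eta>)\<bar> \<le> 1" using pos[of x] \<eta> tau_nonneg[of n "x + pi"] by simp
      ultimately have "cmod (f x - 1) * \<bar>\<eta> / (?s x + \<eta>)\<bar> \<le> e / 2 * 1"
        using assms(3) by (intro mult_mono) auto
      then show ?thesis by (simp only: norm_mult norm_of_real mult.right_neutral)
    next
      case False
      have "\<eta> / (?s x + \<eta>) \<le> \<eta> / \<sigma>" using False \<eta> \<sigma> by (intro divide_left_mono) auto
      moreover have "0 \<le> \<eta> / (?s x + \<eta>)" using pos[of x] \<eta> by simp
      ultimately have "cmod (f x - 1) * \<bar>\<eta> / (?s x + \<eta>)\<bar> \<le> D * (\<eta> / \<sigma>)"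
        using D(2)[OF x] D(1) by (intro mult_mono) (simp_all only: abs_of_nonneg abs_ge_zero norm_ge_zero less_imp_le)
      also have "D * (\<eta> / \<sigma>) = e / 2" using D \<sigma> by (simp add: \<eta>_def)
      finally show ?thesis by (simp only: norm_mult norm_of_real)
    qed
    finally show ?thesis by simp
  qed
  have "cmod (f x - (1 + of_real (?s x) * g x)) \<le> e" for x
  proof -
    obtain k :: int where k: "x + 2 * pi * of_int k \<in> {-pi..<pi}" by (rule period_reduction)
    define y where "y = x + 2 * pi * of_int k"
    have "f y = f x" "g y = g x" "tau n (y + pi) = tau n (x + pi)" unfolding y_def
      using periodic_int_shift[where h=f, OF f(2)] periodic_int_shift[where h=g, OF trig_poly_periodic[OF g(1)]]
        periodic_int_shift[where h="tau n", OF tau_periodic, of "x + pi" k] by (simp_all add: algebra_simps)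
    then show ?thesis using * k y_def by metis
  qed
  then show ?thesis using that g(1) by blast
qed

text \<open>
  The values \<open>c\<close> for which \<open>1 + (1 - \<tau>) (g + c)\<close> has a zero form a smooth curve, a null set of the
  plane, so that arbitrarily small \<open>c\<close> avoid them.
\<close>

lemma zero_free_perturbation:
  assumes "trig_poly g" "e > 0"
  obtains c where "cmod c < e" "\<And>x. 1 + of_real (tau n (x + pi)) * (g x + c) \<noteq> 0"
proof -
  let ?s = "\<lambda>x. complex_of_real (tau n (x + pi))"
  define X where "X = {x. ?s x \<noteq> 0}"
  define \<gamma> where "\<gamma> = (\<lambda>x. - 1 / ?s x - g x)"
  have "\<gamma> differentiable_on X"
    unfolding differentiable_on_def \<gamma>_def X_def
    by (intro ballI differentiable_diff differentiable_divide differentiable_const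
        trig_poly_differentiable assms tau_shift_trig_poly) auto
  then have "negligible (\<gamma> ` X)"
    by (intro negligible_differentiable_image_lowdim) auto
  moreover have "\<not> negligible (ball (0::complex) e)"
    using assms(2) by (intro open_not_negligible) auto
  ultimately obtain c where c: "c \<in> ball 0 e" "c \<notin> \<gamma> ` X"
    by (meson negligible_subset subsetI)
  have "1 + ?s x * (g x + c) \<noteq> 0" for x
  proof
    assume *: "1 + ?s x * (g x + c) = 0"
    then have "?s x \<noteq> 0" by auto
    with * have "c = \<gamma> x" by (simp add: \<gamma>_def field_simps eq_neg_iff_add_eq_0)
    then show False using c(2) \<open>?s x \<noteq> 0\<close> by (auto simp: X_def)
  qed
  then show ?thesis using that c(1) by auto
qed

section \<open>The refinement mask\<close>

text \<open>
  With \<open>s = 1 - \<tau>\<close> one has \<open>1 - \<tau>\<^sup>n |1 + s g|\<^sup>2 = s (\<Sum>j<n. (\<tau>\<^sup>j - \<tau>\<^sup>n)) + s \<tau>\<^sup>n (n - 2 Re g - |g|\<^sup>2 + \<tau> |g|\<^sup>2)\<close>,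
  where each summand is a sum of squares as soon as \<open>n\<close> exceeds a constant depending on \<open>g\<close>.
\<close>

lemma sos_mask_defect:
  assumes "trig_poly g"
  obtains K0 where "\<And>K. K \<ge> K0 \<Longrightarrow> K \<ge> 1 \<Longrightarrow>
    sos (\<lambda>x. tau n x - (cmod (of_real (tau n x) ^ K * (1 + of_real (tau n (x + pi)) * g x)))\<^sup>2)"
proof -
  let ?t = "tau n" and ?s = "\<lambda>x. tau n (x + pi)"
  have s: "?s x = 1 - ?t x" for x using tau_add_shift[of n x] by simp
  have sos_s: "sos ?s" by (intro sos_shift sos_tau)
  have "trig_poly (\<lambda>x. 2 * g x + g x * cnj (g x))"
    by (intro trig_poly.add trig_poly_cmult trig_poly_mult trig_poly_cnj assms)
  then obtain A where A: "A \<ge> 0" "sos (\<lambda>x. A - Re (2 * g x + g x * cnj (g x)))"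
    by (rule sos_const_minus_Re)
  have pow_diff: "?t x ^ a - ?t x ^ b = ?t x ^ a * (?s x * (\<Sum>i<b-a. ?t x ^ i))" if "a \<le> b" for a b x
  proof -
    have "?s x * (\<Sum>i<b-a. ?t x ^ i) = 1 - ?t x ^ (b - a)"
      unfolding s by (rule one_diff_power_eq[symmetric])
    then show ?thesis using that by (simp add: right_diff_distrib flip: power_add)
  qed
  have "sos (\<lambda>x. ?t x - (cmod (of_real (?t x) ^ K * (1 + of_real (?s x) * g x)))\<^sup>2)"
    if "K \<ge> nat \<lceil>A\<rceil>" "K \<ge> 1" for K
  proof -
    \<comment> \<open>One factor \<open>\<tau>\<close> is common to both terms, which leaves the exponent \<open>2K - 1\<close> for the identity.\<close>
    define m where "m = 2 * K - 1"
    have "real K \<ge> A" using that(1) by linarith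
    then have m: "real m \<ge> A" "2 * K = Suc m" using that(2) by (auto simp: m_def of_nat_diff)
    have eq: "?t x - (cmod (of_real (?t x) ^ K * (1 + of_real (?s x) * g x)))\<^sup>2
      = ?t x * (?s x * ((\<Sum>j<m. ?t x ^ j * (?s x * (\<Sum>i<m-j. ?t x ^ i)))
          + ?t x ^ m * ((real m - A) + (A - Re (2 * g x + g x * cnj (g x))) + ?t x * (cmod (g x))\<^sup>2)))" for x
    proof -
      have "(cmod (of_real (?t x) ^ K * (1 + of_real (?s x) * g x)))\<^sup>2
        = ?t x ^ (2 * K) * (cmod (1 + of_real (?s x) * g x))\<^sup>2"
        using tau_nonneg[of n x] by (simp add: norm_mult norm_power power_mult_distrib mult.commute flip: power_mult)
      also have "(cmod (1 + of_real (?s x) * g x))\<^sup>2 = 1 + ?s x * (2 * Re (g x) + ?s x * (cmod (g x))\<^sup>2)"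
        unfolding cmod_power2 by (simp add: power2_eq_square algebra_simps)
      finally have 1: "?t x - (cmod (of_real (?t x) ^ K * (1 + of_real (?s x) * g x)))\<^sup>2
        = ?t x * ((1 - ?t x ^ m) - ?s x * (?t x ^ m * (2 * Re (g x) + ?s x * (cmod (g x))\<^sup>2)))"
        unfolding m(2) by (simp add: algebra_simps)
      have 2: "1 - ?t x ^ m = ?s x * (\<Sum>j<m. ?t x ^ j)"
        unfolding s by (rule one_diff_power_eq)
      have "(\<Sum>j<m. ?t x ^ j * (?s x * (\<Sum>i<m-j. ?t x ^ i))) = (\<Sum>j<m. ?t x ^ j - ?t x ^ m)"
        by (intro sum.cong refl pow_diff[symmetric]) auto
      then have 3: "(\<Sum>j<m. ?t x ^ j) = (\<Sum>j<m. ?t x ^ j * (?s x * (\<Sum>i<m-j. ?t x ^ i))) + real m * ?t x ^ m"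
        by (simp add: sum_subtractf)
      have 4: "Re (2 * g x + g x * cnj (g x)) = 2 * Re (g x) + (cmod (g x))\<^sup>2"
        unfolding cmod_power2 by (simp add: power2_eq_square)
      show ?thesis unfolding 1 2 3 4 unfolding s by (simp add: algebra_simps)
    qed
    have "sos (\<lambda>x. (real m - A) + (A - Re (2 * g x + g x * cnj (g x))) + ?t x * (cmod (g x))\<^sup>2)"
      using m(1) by (intro sos.add A sos_const sos_mult sos_tau sos.square assms) auto
    note sos_mult[OF sos_power[OF sos_tau, of n m] this]
    moreover have "sos (\<lambda>x. \<Sum>j<m. ?t x ^ j * (?s x * (\<Sum>i<m-j. ?t x ^ i)))"
      by (intro sos_sum sos_mult sos_power sos_tau sos_s)
    ultimately show ?thesis unfolding eq
      by (intro sos_mult[OF sos_tau] sos_mult[OF sos_s] sos.add)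
  qed
  then show ?thesis using that by blast
qed

text \<open>
  One power of \<open>\<tau>\<close> more than \<open>sos_mask_defect\<close> needs is taken: the other powers already give
  \<open>|\<tau>\<^sup>K\<^sup>-\<^sup>1 p|\<^sup>2 \<le> \<tau> \<le> 1\<close>, hence \<open>|\<tau>\<^sup>K p| \<le> \<tau>\<close>. The flatness at 0 is Bernoulli's inequality for
  \<open>\<tau>\<^sup>K = (1 - s)\<^sup>K\<close> with \<open>s = O(x\<^sup>2\<^sup>n\<^sup>+\<^sup>2)\<close>.
\<close>

lemma refinement_mask:
  assumes "f \<in> space_C" "f 0 = 1" "e > 0"
  obtains K m C where "K \<ge> 1" "trig_poly m" "\<And>x. m x \<noteq> 0" "\<And>x. cmod (f x - m x) \<le> e" "m 0 = 1"
    "\<And>x. cmod (of_real (tau n x) ^ K * m x) \<le> tau n x"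
    "sos (\<lambda>x. 1 - (cmod (of_real (tau n x) ^ K * m x))\<^sup>2 - (cmod (of_real (tau n (x + pi)) ^ K * m (x + pi)))\<^sup>2)"
    "\<And>x. 1 - (cmod (of_real (tau n x) ^ K * m x))\<^sup>2 \<le> C * (x\<^sup>2) ^ Suc n"
proof -
  let ?t = "tau n" and ?s = "\<lambda>x. tau n (x + pi)"
  obtain g0 where g0: "trig_poly g0" "\<And>x. cmod (f x - (1 + of_real (?s x) * g0 x)) \<le> e / 2"
    using flat_approximation[of f "e/2" n] assms by auto
  obtain c where c: "cmod c < e / 2" "\<And>x. 1 + of_real (?s x) * (g0 x + c) \<noteq> 0"
    using zero_free_perturbation[of g0 "e/2" n] g0 assms(3) by auto
  define g where "g = (\<lambda>x. g0 x + c)"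
  define m where "m = (\<lambda>x. 1 + of_real (?s x) * g x)"
  have g: "trig_poly g" unfolding g_def by (intro trig_poly.add g0 trig_poly_const)
  have m: "trig_poly m" unfolding m_def
    by (intro trig_poly.add trig_poly_const trig_poly_mult tau_shift_trig_poly g)
  have approx: "cmod (f x - m x) \<le> e" for x
  proof -
    have "f x - m x = (f x - (1 + of_real (?s x) * g0 x)) - of_real (?s x) * c"
      by (simp add: m_def g_def algebra_simps)
    then have "cmod (f x - m x) \<le> cmod (f x - (1 + of_real (?s x) * g0 x)) + cmod (of_real (?s x) * c)"
      by (metis norm_triangle_ineq4)
    moreover have "cmod (of_real (?s x) * c) \<le> 1 * (e/2)"
      unfolding norm_mult using tau_nonneg[of n "x + pi"] tau_le_1[of n "x + pi"] c(1)
      by (intro mult_mono) auto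
    ultimately show ?thesis using g0(2)[of x] by simp
  qed
  have m0: "m 0 = 1" unfolding m_def using tau_add_shift[of n 0] tau_0[of n] by simp
  obtain K0 where K0: "\<And>K. K \<ge> K0 \<Longrightarrow> K \<ge> 1 \<Longrightarrow> sos (\<lambda>x. ?t x - (cmod (of_real (?t x) ^ K * m x))\<^sup>2)"
    unfolding m_def by (rule sos_mask_defect[OF g, of n]) (rule that, simp only: m_def)
  define K where "K = Suc (Suc K0)"
  define M where "M = (\<lambda>x. of_real (?t x) ^ K * m x)"
  have sosM: "sos (\<lambda>x. ?t x - (cmod (M x))\<^sup>2)" unfolding M_def by (rule K0) (auto simp: K_def)
  have M_le: "cmod (M x) \<le> ?t x" for x
  proof -
    have "(cmod (of_real (?t x) ^ Suc K0 * m x))\<^sup>2 \<le> ?t x"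
      using sos_nonneg[OF K0[of "Suc K0"], of x] by simp
    also have "\<dots> \<le> 1\<^sup>2" using tau_le_1 by simp
    finally have "cmod (of_real (?t x) ^ Suc K0 * m x) \<le> 1" by (rule power2_le_imp_le) simp
    moreover have "cmod (M x) = ?t x * cmod (of_real (?t x) ^ Suc K0 * m x)"
      using tau_nonneg[of n x] by (simp add: M_def K_def norm_mult)
    ultimately show ?thesis using mult_left_mono[OF _ tau_nonneg[of n x]] by (metis mult.right_neutral)
  qed
  have "sos (\<lambda>x. (?t x - (cmod (M x))\<^sup>2) + (?t (x + pi) - (cmod (M (x + pi)))\<^sup>2))"
    by (intro sos.add sosM sos_shift[OF sosM])
  also have "(\<lambda>x. (?t x - (cmod (M x))\<^sup>2) + (?t (x + pi) - (cmod (M (x + pi)))\<^sup>2))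
      = (\<lambda>x. 1 - (cmod (M x))\<^sup>2 - (cmod (M (x + pi)))\<^sup>2)"
    using tau_add_shift[of n] by (intro ext) (simp add: algebra_simps)
  finally have sos1: "sos (\<lambda>x. 1 - (cmod (M x))\<^sup>2 - (cmod (M (x + pi)))\<^sup>2)" .
  obtain B where B: "\<And>x. cmod (g x) \<le> B" "B > 0" using trig_poly_bounded[OF g] by metis
  have flat: "1 - (cmod (M x))\<^sup>2 \<le> (2 * (real K + B)) * (x\<^sup>2) ^ Suc n" for x
  proof -
    have s: "0 \<le> ?s x" "?s x \<le> 1" using tau_nonneg tau_le_1 by auto
    have t: "?t x = 1 - ?s x" using tau_add_shift[of n x] by simp
    have "1 - real K * ?s x \<le> ?t x ^ K"
      using Bernoulli_inequality[of "- ?s x" K] s by (simp add: t)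
    moreover have "?t x ^ K * (?s x * B) \<le> 1 * (?s x * B)"
      using s B by (intro mult_right_mono power_le_one) (auto simp: t)
    moreover have "?t x ^ K * (1 - ?s x * B) \<le> cmod (M x)"
    proof -
      have "1 - ?s x * B \<le> cmod 1 - cmod (of_real (?s x) * g x)"
        using s B(1)[of x] by (simp add: norm_mult mult_left_mono)
      also have "\<dots> \<le> cmod (m x)" unfolding m_def by (rule norm_diff_ineq)
      finally show ?thesis using tau_nonneg[of n x] by (simp add: M_def norm_mult norm_power mult_left_mono)
    qed
    ultimately have "1 - cmod (M x) \<le> (real K + B) * ?s x" by (simp add: algebra_simps)
    moreover have "1 - (cmod (M x))\<^sup>2 \<le> 2 * (1 - cmod (M x))"
    proof -
      have "0 \<le> (1 - cmod (M x))\<^sup>2" by simp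
      then show ?thesis by (simp add: power2_eq_square algebra_simps)
    qed
    ultimately have "1 - (cmod (M x))\<^sup>2 \<le> 2 * (real K + B) * ?s x"
      unfolding mult.assoc using mult_left_mono[of "1 - cmod (M x)" "(real K + B) * ?s x" 2] order_trans by fastforce
    also have "\<dots> \<le> 2 * (real K + B) * (x\<^sup>2) ^ Suc n"
      using B(2) by (intro mult_left_mono tau_shift_le_power) auto
    finally show ?thesis .
  qed
  show ?thesis
    by (rule that[of K m "2 * (real K + B)"])
       (use approx m m0 c(2) M_le[unfolded M_def] sos1[unfolded M_def] flat[unfolded M_def] in
          \<open>simp_all add: m_def g_def K_def\<close>)
qed

section \<open>Completing a mask to a Parseval filter bank\<close>

lemma sum_lessThan_add:
  fixes f :: "nat \<Rightarrow> 'a :: comm_monoid_add"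
  shows "(\<Sum>i<a+l. f i) = (\<Sum>i<a. f i) + (\<Sum>i<l. f (a + i))"
  by (induction l) (auto simp: algebra_simps)

text \<open>
  Each square is replaced by the squares of the two \<open>\<pi>\<close>-periodic components \<open>(p(x) + p(x + \<pi>)) / 2\<close> and
  \<open>e\<^sup>-\<^sup>i\<^sup>x (p(x) - p(x + \<pi>)) / 2\<close>; by the parallelogram law their sum is the mean of \<open>|p(x)|\<^sup>2\<close> and
  \<open>|p(x + \<pi>)|\<^sup>2\<close>.
\<close>

lemma sos_shift_invariant_split:
  assumes "sos E" "\<And>x. E (x + pi) = E x"
  obtains n :: nat and s where "\<And>i. i < n \<Longrightarrow> trig_poly (s i)" "\<And>i x. i < n \<Longrightarrow> s i (x + pi) = s i x"
    "\<And>x. of_real (E x) = (\<Sum>i<n. s i x * cnj (s i x))"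
proof -
  obtain n :: nat and p where p: "\<And>i. i < n \<Longrightarrow> trig_poly (p i)" "\<And>x. E x = (\<Sum>i<n. (cmod (p i x))\<^sup>2)"
    by (rule sos_expansion[OF assms(1)]) (rule that)
  define u where "u = (\<lambda>i x. (1/2) * (p i x + p i (x + pi)))"
  define v where "v = (\<lambda>i x. (1/2) * (cis (of_int (-1) * x) * (p i x - p i (x + pi))))"
  define s where "s = (\<lambda>i. if i < n then u i else v (i - n))"
  have per: "p i (x + pi + pi) = p i x" if "i < n" for i x
    using trig_poly_periodic[OF p(1)[OF that], of x] by (simp add: algebra_simps)
  have u: "trig_poly (u i)" if "i < n" for i
    using p(1)[OF that] unfolding u_def by (intro trig_poly_cmult trig_poly.add trig_poly_shift)
  have u2: "u i (x + pi) = u i x" if "i < n" for i x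
    unfolding u_def per[OF that] by (simp add: add.commute)
  have v: "trig_poly (v i)" if "i < n" for i
    using p(1)[OF that] unfolding v_def
    by (intro trig_poly_cmult trig_poly_mult trig_poly_diff trig_poly_shift trig_poly_cis)
  have v2: "v i (x + pi) = v i x" if "i < n" for i x
  proof -
    have "cis (of_int (-1) * (x + pi)) = - cis (of_int (-1) * x)" by (simp add: complex_eq_iff)
    then show ?thesis unfolding v_def per[OF that] by (simp add: algebra_simps)
  qed
  have uv: "u i x * cnj (u i x) + v i x * cnj (v i x) = (1/2) * (p i x * cnj (p i x) + p i (x + pi) * cnj (p i (x + pi)))" for i x
  proof -
    define a where "a = p i x"
    define b where "b = p i (x + pi)"
    define e where "e = cis (of_int (-1) * x)"
    have e: "e * cnj e = 1" by (simp add: e_def cis_cnj cis_mult)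
    have "v i x * cnj (v i x) = (1/4) * ((e * cnj e) * ((a - b) * cnj (a - b)))"
      unfolding v_def a_def b_def e_def by simp
    then have "v i x * cnj (v i x) = (1/4) * ((a - b) * cnj (a - b))" unfolding e by simp
    moreover have "u i x * cnj (u i x) = (1/4) * ((a + b) * cnj (a + b))"
      unfolding u_def a_def b_def by simp
    moreover have "(1/4) * ((a + b) * cnj (a + b)) + (1/4) * ((a - b) * cnj (a - b)) = (1/2) * (a * cnj a + b * cnj b)"
      by (simp add: field_simps)
    ultimately show ?thesis by (simp only: a_def b_def)
  qed
  have "(\<Sum>i<n+n. s i x * cnj (s i x)) = of_real (E x)" for x
  proof -
    have "(\<Sum>i<n+n. s i x * cnj (s i x)) = (\<Sum>i<n. u i x * cnj (u i x) + v i x * cnj (v i x))"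
      unfolding sum_lessThan_add by (simp add: s_def sum.distrib)
    also have "\<dots> = (1/2) * ((\<Sum>i<n. p i x * cnj (p i x)) + (\<Sum>i<n. p i (x + pi) * cnj (p i (x + pi))))"
      by (simp only: uv sum_distrib_left[symmetric] sum.distrib)
    also have "\<dots> = (1/2) * (of_real (E x) + of_real (E (x + pi)))"
      unfolding p(2) of_real_sum complex_norm_square by simp
    finally show ?thesis by (simp add: assms(2))
  qed
  moreover have "trig_poly (s i)" "s i (x + pi) = s i x" if "i < n + n" for i x
    using that u u2 v v2 by (auto simp: s_def)
  ultimately show ?thesis by (intro that[of "n + n" s]) (simp_all only:)
qed

text \<open>
  With \<open>a = m\<^sub>0(x)\<close>, \<open>b = m\<^sub>0(x + \<pi>)\<close> and \<open>|a|\<^sup>2 + |b|\<^sup>2 + \<Sum>|s\<^sub>i|\<^sup>2 = 1\<close> for \<open>\<pi>\<close>-periodic \<open>s\<^sub>i\<close>, the vector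
  formed by the two polyphase components of \<open>m\<^sub>0\<close> and the \<open>s\<^sub>i\<close> is a unit vector \<open>P\<close>. The matrix
  \<open>I - P P\<^sup>*\<close> is then a projection, so it is its own square, and the rows belonging to the polyphase
  components are the polyphase components of the remaining masks. For those two rows and columns
  this gives the masks \<open>m1\<close> and \<open>m2\<close> below, for the other columns \<open>m\<^sub>0 cnj s\<^sub>i\<close> up to the sign.
\<close>

lemma filter_bank_completion:
  assumes "trig_poly m0" "sos (\<lambda>x. 1 - (cmod (m0 x))\<^sup>2 - (cmod (m0 (x + pi)))\<^sup>2)"
  obtains q :: nat and m where "m 0 = m0" "\<And>r. r \<le> q \<Longrightarrow> trig_poly (m r)"
    "\<And>x. (\<Sum>r=0..q. (cmod (m r x))\<^sup>2) = 1" "\<And>x. (\<Sum>r=0..q. m r x * cnj (m r (x + pi))) = 0"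
proof -
  let ?E = "\<lambda>x. 1 - (cmod (m0 x))\<^sup>2 - (cmod (m0 (x + pi)))\<^sup>2"
  have per0: "m0 (x + pi + pi) = m0 x" for x
    using trig_poly_periodic[OF assms(1), of x] by (simp add: algebra_simps)
  then have "?E (x + pi) = ?E x" for x by simp
  note shift_E = this
  obtain n :: nat and s where
    s: "\<And>i. i < n \<Longrightarrow> trig_poly (s i)" "\<And>i x. i < n \<Longrightarrow> s i (x + pi) = s i x"
       "\<And>x. of_real (?E x) = (\<Sum>i<n. s i x * cnj (s i x))"
    by (rule sos_shift_invariant_split[OF assms(2) shift_E]) (rule that)
  define c where "c = complex_of_real (1 / sqrt 2)"
  have c: "c * c = 1/2" "cnj c = c" by (simp_all add: c_def flip: of_real_mult)
  define m1 where "m1 = (\<lambda>x. c * (1 - m0 x * cnj (m0 x + m0 (x + pi))))"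
  define m2 where "m2 = (\<lambda>x. c * (cis (of_int (-1) * x) * (1 - m0 x * cnj (m0 x - m0 (x + pi)))))"
  define m where "m = (\<lambda>r. if r = 0 then m0 else if r = 1 then m1 else if r = 2 then m2 else (\<lambda>x. m0 x * cnj (s (r - 3) x)))"
  have tp: "trig_poly (m r)" if "r \<le> n + 2" for r
  proof -
    have "trig_poly m1" "trig_poly m2" unfolding m1_def m2_def
      by (intro trig_poly_cmult trig_poly_mult trig_poly_diff trig_poly_const trig_poly_cnj
          trig_poly.add trig_poly_shift trig_poly_cis assms)+
    moreover have "trig_poly (\<lambda>x. m0 x * cnj (s (r - 3) x))" if "r \<ge> 3"
      using that \<open>r \<le> n + 2\<close> by (intro trig_poly_mult trig_poly_cnj assms s(1)) auto
    ultimately show ?thesis using assms(1) by (auto simp: m_def)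
  qed
  have split: "(\<Sum>r=0..n+2. F r) = F 0 + F 1 + F 2 + (\<Sum>i<n. F (3 + i))" for F :: "nat \<Rightarrow> complex"
  proof -
    have "{0..n+2} = {..<3 + n}" by auto
    then have "(\<Sum>r=0..n+2. F r) = (\<Sum>r<3. F r) + (\<Sum>i<n. F (3 + i))" by (simp only: sum_lessThan_add)
    then show ?thesis by (simp add: eval_nat_numeral)
  qed
  have tail: "(\<Sum>i<n. m (3 + i) x * cnj (m (3 + i) y)) = m0 x * cnj (m0 y) * (1 - m0 x * cnj (m0 x) - m0 (x + pi) * cnj (m0 (x + pi)))"
    if "\<And>i. i < n \<Longrightarrow> s i y = s i x" for x y
  proof -
    have "(\<Sum>i<n. m (3 + i) x * cnj (m (3 + i) y)) = (\<Sum>i<n. m0 x * cnj (m0 y) * (s i x * cnj (s i x)))"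
      using that by (intro sum.cong refl) (simp add: m_def)
    also have "\<dots> = m0 x * cnj (m0 y) * of_real (?E x)"
      by (simp only: s(3) sum_distrib_left)
    also have "of_real (?E x) = 1 - m0 x * cnj (m0 x) - m0 (x + pi) * cnj (m0 (x + pi))"
      by (simp only: of_real_diff of_real_1 complex_norm_square)
    finally show ?thesis .
  qed
  have m123: "m 0 = m0" "m 1 = m1" "m 2 = m2" by (simp_all add: m_def)
  have "(\<Sum>r=0..n+2. m r x * cnj (m r x)) = 1" for x
  proof -
    define a where "a = m0 x"
    define b where "b = m0 (x + pi)"
    define e where "e = cis (of_int (-1) * x)"
    have e: "e * cnj e = 1" by (simp add: e_def cis_cnj cis_mult)
    have h1: "m1 x * cnj (m1 x) = (c * c) * ((1 - a * cnj (a + b)) * cnj (1 - a * cnj (a + b)))"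
      by (simp only: m1_def complex_cnj_mult c(2) a_def b_def ac_simps)
    have h2: "m2 x * cnj (m2 x) = (c * c) * (e * cnj e) * ((1 - a * cnj (a - b)) * cnj (1 - a * cnj (a - b)))"
      by (simp only: m2_def complex_cnj_mult c(2) a_def b_def e_def ac_simps)
    show ?thesis
      unfolding split m123 h1 h2 tail[OF refl] c e a_def[symmetric] b_def[symmetric]
      by (simp add: field_simps)
  qed
  then have one: "complex_of_real (\<Sum>r=0..n+2. (cmod (m r x))\<^sup>2) = 1" for x
    by (simp only: of_real_sum complex_norm_square)
  have two: "(\<Sum>r=0..n+2. m r x * cnj (m r (x + pi))) = 0" for x
  proof -
    define a where "a = m0 x"
    define b where "b = m0 (x + pi)"
    define e where "e = cis (of_int (-1) * x)"
    have e: "e * cnj e = 1" by (simp add: e_def cis_cnj cis_mult)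
    have e': "cis (of_int (-1) * (x + pi)) = - e" by (simp add: e_def complex_eq_iff)
    have h1: "m1 x * cnj (m1 (x + pi)) = (c * c) * ((1 - a * cnj (a + b)) * cnj (1 - b * cnj (b + a)))"
      unfolding m1_def per0 complex_cnj_mult c(2) a_def b_def by (simp only: ac_simps)
    have h2: "m2 x * cnj (m2 (x + pi)) = - ((c * c) * (e * cnj e) * ((1 - a * cnj (a - b)) * cnj (1 - b * cnj (b - a))))"
      unfolding m2_def per0 e' complex_cnj_mult complex_cnj_minus c(2) a_def[symmetric] b_def[symmetric] e_def[symmetric]
      by (simp only: mult_minus_left mult_minus_right ac_simps)
    have tail_shift: "(\<Sum>i<n. m (3 + i) x * cnj (m (3 + i) (x + pi)))
        = m0 x * cnj (m0 (x + pi)) * (1 - m0 x * cnj (m0 x) - m0 (x + pi) * cnj (m0 (x + pi)))"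
      by (rule tail) (rule s(2))
    show ?thesis
      unfolding split m123 h1 h2 tail_shift c e a_def[symmetric] b_def[symmetric]
      by (simp add: field_simps)
  qed
  have "(\<Sum>r=0..n+2. (cmod (m r x))\<^sup>2) = 1" for x using one[of x] by (simp only: of_real_eq_1_iff)
  then show ?thesis by (intro that[of m "n + 2"] m123(1) tp two)
qed

section \<open>The refinable function\<close>

text \<open>
  Degrees bound the supports of the iterated masks: after \<open>j\<close> steps the degree is at most \<open>2\<^sup>j d\<close>,
  while the grid has been refined by the factor \<open>2\<^sup>j\<close>.
\<close>

inductive trig_poly_deg :: "nat \<Rightarrow> (real \<Rightarrow> complex) \<Rightarrow> bool" for d where
  monomial: "\<bar>k\<bar> \<le> int d \<Longrightarrow> trig_poly_deg d (\<lambda>x. c * cis (of_int k * x))"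
| add: "trig_poly_deg d p \<Longrightarrow> trig_poly_deg d q \<Longrightarrow> trig_poly_deg d (\<lambda>x. p x + q x)"

lemma trig_poly_deg_mono: "trig_poly_deg d p \<Longrightarrow> d \<le> e \<Longrightarrow> trig_poly_deg e p"
  by (induction rule: trig_poly_deg.induct) (auto intro: trig_poly_deg.intros)

lemma trig_poly_deg_imp_trig_poly: "trig_poly_deg d p \<Longrightarrow> trig_poly p"
  by (induction rule: trig_poly_deg.induct) (auto intro: trig_poly.intros)

lemma trig_poly_imp_deg: "trig_poly p \<Longrightarrow> \<exists>d. trig_poly_deg d p"
proof (induction rule: trig_poly.induct)
  case (monomial c k)
  show ?case by (intro exI[of _ "nat \<bar>k\<bar>"] trig_poly_deg.intros) auto
next
  case (add p q)
  then obtain d e where "trig_poly_deg d p" "trig_poly_deg e q" by blast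
  then show ?case by (intro exI[of _ "max d e"] trig_poly_deg.intros) (auto elim: trig_poly_deg_mono)
qed

lemma trig_poly_deg_mult:
  assumes "trig_poly_deg d p" "trig_poly_deg e q"
  shows "trig_poly_deg (d + e) (\<lambda>x. p x * q x)"
  using assms(1)
proof (induction rule: trig_poly_deg.induct)
  case (monomial k c)
  then have k: "\<bar>k\<bar> \<le> int d" .
  show ?case using assms(2)
  proof (induction rule: trig_poly_deg.induct)
    case (monomial l b)
    have "(\<lambda>x. c * cis (of_int k * x) * (b * cis (of_int l * x)))
        = (\<lambda>x. (c * b) * cis (of_int (k + l) * x))"
      by (auto simp: cis_mult[symmetric] algebra_simps)
    then show ?case using trig_poly_deg.monomial[of "k + l" "d + e" "c * b"] k monomial by simp
  next
    case (add p q)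
    then show ?case using trig_poly_deg.add by (simp add: distrib_left)
  qed
next
  case (add p' q')
  then show ?case using trig_poly_deg.add by (simp add: distrib_right)
qed

lemma trig_poly_deg_dilate: "trig_poly_deg d p \<Longrightarrow> trig_poly_deg (a * d) (\<lambda>x. p (of_nat a * x))"
proof (induction rule: trig_poly_deg.induct)
  case (monomial k c)
  have "\<bar>k * int a\<bar> \<le> int (a * d)" using mult_right_mono[OF monomial, of "int a"] by (simp add: abs_mult mult.commute)
  from trig_poly_deg.monomial[OF this, of c] show ?case by (simp add: mult.assoc)
next
  case (add p q)
  then show ?case by (intro trig_poly_deg.add)
qed

lemma fcoef_deg: "trig_poly_deg d p \<Longrightarrow> \<bar>k\<bar> > int d \<Longrightarrow> fcoef p k = 0"
proof (induction rule: trig_poly_deg.induct)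
  case (monomial l c)
  have "fcoef (\<lambda>x. c * cis (of_int l * x)) k = (if k \<in> {l} then c else 0)"
    by (rule fcoef_expansion) auto
  with monomial show ?case by auto
next
  case (add p q)
  have "fcoef (\<lambda>x. p x + q x) k = mean (\<lambda>x. p x * cis (of_int (-k) * x) + q x * cis (of_int (-k) * x))"
    unfolding fcoef_def by (simp add: distrib_right)
  also have "\<dots> = mean (\<lambda>x. p x * cis (of_int (-k) * x)) + mean (\<lambda>x. q x * cis (of_int (-k) * x))"
    by (intro mean_add trig_poly_mult trig_poly_cis add.hyps[THEN trig_poly_deg_imp_trig_poly])
  finally have "fcoef (\<lambda>x. p x + q x) k = fcoef p k + fcoef q k" by (simp add: fcoef_def)
  with add show ?case by simp
qed

lemma integral_dyadic_step:
  fixes F :: "int \<Rightarrow> 'a :: {banach, second_countable_topology}" and c :: real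
  assumes "finite S" "\<And>k. k \<notin> S \<Longrightarrow> F k = 0" "c > 0"
  shows "(LINT x|lborel. F \<lfloor>c * x\<rfloor>) = (1 / c) *\<^sub>R (\<Sum>k\<in>S. F k)"
proof -
  have floor: "\<lfloor>c * x\<rfloor> = k \<longleftrightarrow> x \<in> {of_int k / c..<(of_int k + 1) / c}" for x k
    using assms(3) by (auto simp: floor_eq_iff field_simps)
  have F: "F \<lfloor>c * x\<rfloor> = (\<Sum>k\<in>S. indicator {of_int k / c..<(of_int k + 1) / c} x *\<^sub>R F k)" for x
  proof -
    have "(\<Sum>k\<in>S. indicator {of_int k / c..<(of_int k + 1) / c} x *\<^sub>R F k) = (\<Sum>k\<in>S. if k = \<lfloor>c * x\<rfloor> then F k else 0)"
      by (intro sum.cong refl) (simp only: indicator_def floor[symmetric], auto)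
    then show ?thesis using assms by auto
  qed
  have len: "measure lborel {of_int k / c..<(of_int k + 1) / c} = 1 / c" for k :: int
    using assms(3) by (simp add: divide_right_mono diff_divide_distrib[symmetric])
  have ind: "integrable lborel (indicat_real {of_int k / c..<(of_int k + 1) / c})" for k :: int
    using assms(3) by (intro integrable_real_indicator) (simp_all add: divide_right_mono)
  have int: "integrable lborel (\<lambda>x. indicator {of_int k / c..<(of_int k + 1) / c} x *\<^sub>R F k)" for k :: int
    by (intro integrable_scaleR_left ind)
  have "(LINT x|lborel. indicator {of_int k / c..<(of_int k + 1) / c} x *\<^sub>R F k) = (1 / c) *\<^sub>R F k" for k :: int
    unfolding integral_scaleR_left[OF ind] using len[of k] by simp
  then show "(LINT x|lborel. F \<lfloor>c * x\<rfloor>) = (1 / c) *\<^sub>R (\<Sum>k\<in>S. F k)"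
    unfolding F by (simp only: Bochner_Integration.integral_sum[OF int] scaleR_sum_right)
qed

locale refinement_mask_bound =
  fixes n :: nat and m0 :: "real \<Rightarrow> complex"
  assumes tp: "trig_poly m0" and at_0: "m0 0 = 1" and le_tau: "\<And>x. cmod (m0 x) \<le> tau n x"
begin

definition partial_product :: "nat \<Rightarrow> real \<Rightarrow> complex" where
  "partial_product j w = (\<Prod>i<j. m0 (w / 2 ^ Suc i))"

lemma m0_le_1: "cmod (m0 x) \<le> 1"
  using le_tau[of x] tau_le_1[of n x] by linarith

lemma partial_product_le_tau_prod: "cmod (partial_product j w) \<le> (\<Prod>i<j. tau n (w / 2 ^ Suc i))"
  unfolding partial_product_def prod_norm[symmetric] by (intro prod_mono conjI norm_ge_zero le_tau)

text \<open>
  Multiplied by \<open>sin\<^sup>2\<^sup>n\<^sup>+\<^sup>2\<close> of half its argument \<open>y\<close>, the function \<open>\<tau>\<close> is at most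
  \<open>4\<^sup>n (cos(y/2) sin(y/2))\<^sup>2\<^sup>n\<^sup>+\<^sup>2 = sin\<^sup>2\<^sup>n\<^sup>+\<^sup>2(y) / 4\<close>, so the product telescopes and gains a factor 1/4
  at each step.
\<close>

lemma tau_prod_decay:
  "(\<Prod>i<j. tau n (w / 2 ^ Suc i)) * ((sin (w / 2 ^ Suc j))\<^sup>2) ^ Suc n \<le> (1/4) ^ j"
proof (induction j)
  case 0
  show ?case by (simp add: power_le_one abs_square_le_1 del: power_Suc)
next
  case (Suc j)
  let ?y = "w / 2 ^ Suc j"
  have "tau n ?y * ((sin (?y/2))\<^sup>2) ^ Suc n \<le> (4 ^ n * ((cos (?y/2))\<^sup>2) ^ Suc n) * ((sin (?y/2))\<^sup>2) ^ Suc n"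
    by (intro mult_right_mono tau_le_cos zero_le_power zero_le_power2)
  also have "\<dots> = 4 ^ n * ((sin ?y)\<^sup>2 / 4) ^ Suc n"
  proof -
    have "(cos (?y/2))\<^sup>2 * (sin (?y/2))\<^sup>2 = (sin ?y)\<^sup>2 / 4"
      using sin_double[of "?y/2"] by (simp add: power_mult_distrib)
    then show ?thesis by (simp only: mult.assoc flip: power_mult_distrib)
  qed
  also have "\<dots> = (1/4) * ((sin ?y)\<^sup>2) ^ Suc n"
    by (simp add: power_divide)
  finally have step: "tau n ?y * ((sin (?y/2))\<^sup>2) ^ Suc n \<le> (1/4) * ((sin ?y)\<^sup>2) ^ Suc n" .
  have "(\<Prod>i<Suc j. tau n (w / 2 ^ Suc i)) * ((sin (w / 2 ^ Suc (Suc j)))\<^sup>2) ^ Suc n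
      = (\<Prod>i<j. tau n (w / 2 ^ Suc i)) * (tau n ?y * ((sin (?y/2))\<^sup>2) ^ Suc n)"
  proof -
    have "w / 2 ^ Suc (Suc j) = ?y / 2" by simp
    then show ?thesis by (simp only: prod.lessThan_Suc mult.assoc)
  qed
  also have "\<dots> \<le> (\<Prod>i<j. tau n (w / 2 ^ Suc i)) * ((1/4) * ((sin ?y)\<^sup>2) ^ Suc n)"
    by (intro mult_left_mono step prod_nonneg) (simp add: tau_nonneg)
  also have "\<dots> = (1/4) * ((\<Prod>i<j. tau n (w / 2 ^ Suc i)) * ((sin ?y)\<^sup>2) ^ Suc n)"
    by (simp only: ac_simps)
  also have "\<dots> \<le> (1/4) * (1/4) ^ j" using Suc by (intro mult_left_mono) auto
  finally show ?case by (simp only: power_Suc)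
qed

definition decay_const :: real where "decay_const = 2 ^ (n + 2) * pi\<^sup>2 + pi\<^sup>2 + 1"

lemma decay_const_pos: "decay_const > 0"
  unfolding decay_const_def by (intro add_nonneg_pos add_nonneg_nonneg) auto

text \<open>
  Let \<open>l\<close> be minimal with \<open>|w| \<le> 2\<^sup>l \<pi>\<close>. The product of the first \<open>l\<close> factors is at most
  \<open>4\<^sup>-\<^sup>l / sin\<^sup>2\<^sup>n\<^sup>+\<^sup>2(w / 2\<^sup>l\<^sup>+\<^sup>1)\<close>, where the absolute value of the angle lies in \<open>[\<pi>/4, \<pi>/2]\<close>; the other
  factors are at most 1.
\<close>

lemma partial_product_decay:
  assumes "\<bar>w\<bar> \<le> 2 ^ j * pi"
  shows "cmod (partial_product j w) \<le> decay_const * inverse (1 + w\<^sup>2)"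
proof (cases "\<bar>w\<bar> \<le> pi")
  case True
  have "cmod (partial_product j w) \<le> 1"
    unfolding partial_product_def prod_norm[symmetric] by (intro prod_le_1 conjI norm_ge_zero m0_le_1)
  moreover have "w\<^sup>2 \<le> pi\<^sup>2" using power_mono[OF True, of 2] by simp
  then have "1 + w\<^sup>2 \<le> decay_const" unfolding decay_const_def by (simp add: add_increasing)
  then have "1 \<le> decay_const * inverse (1 + w\<^sup>2)"
    by (simp add: divide_inverse[symmetric] add_pos_nonneg)
  ultimately show ?thesis by linarith
next
  case False
  define l where "l = (LEAST l. \<bar>w\<bar> \<le> 2 ^ l * pi)"
  have l: "\<bar>w\<bar> \<le> 2 ^ l * pi" "l \<le> j" unfolding l_def
    using assms by (auto intro: LeastI Least_le)
  have "l \<noteq> 0" using l(1) False by (metis mult_1 power_0)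
  then obtain k where k: "l = Suc k" by (cases l) auto
  have k2: "2 ^ k * pi < \<bar>w\<bar>"
    using not_less_Least[of k "\<lambda>l. \<bar>w\<bar> \<le> 2 ^ l * pi"] k unfolding l_def by simp
  define y where "y = \<bar>w\<bar> / 2 ^ Suc l"
  have y: "pi / 4 \<le> y" "y \<le> pi / 2" using l(1) k2 by (simp_all add: y_def k field_simps)
  have "sin (pi / 4) \<le> sin y" using y by (intro sin_monotone_2pi_le) auto
  then have "(sin (pi / 4))\<^sup>2 \<le> (sin y)\<^sup>2" by (intro power_mono) (auto simp: sin_45)
  then have half: "1 / 2 \<le> (sin y)\<^sup>2" by (simp add: sin_45 power_divide)
  have siny: "(sin y)\<^sup>2 = (sin (w / 2 ^ Suc l))\<^sup>2"
    by (cases "w \<ge> 0") (auto simp: y_def)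
  have "cmod (partial_product j w) \<le> (\<Prod>i<j. tau n (w / 2 ^ Suc i))" by (rule partial_product_le_tau_prod)
  also have "\<dots> \<le> (\<Prod>i<l. tau n (w / 2 ^ Suc i))"
  proof -
    have eq: "{..<j} = {..<l} \<union> {l..<j}" using l(2) by auto
    have "(\<Prod>i<j. tau n (w / 2 ^ Suc i)) = (\<Prod>i<l. tau n (w / 2 ^ Suc i)) * (\<Prod>i=l..<j. tau n (w / 2 ^ Suc i))"
      unfolding eq by (rule prod.union_disjoint) auto
    also have "\<dots> \<le> (\<Prod>i<l. tau n (w / 2 ^ Suc i)) * 1"
      by (intro mult_left_mono prod_le_1 prod_nonneg) (auto simp: tau_nonneg tau_le_1)
    finally show ?thesis by simp
  qed
  also have "\<dots> \<le> 2 ^ Suc n * (1/4) ^ l"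
  proof -
    have "(\<Prod>i<l. tau n (w / 2 ^ Suc i)) * (1/2) ^ Suc n \<le> (\<Prod>i<l. tau n (w / 2 ^ Suc i)) * ((sin y)\<^sup>2) ^ Suc n"
      using half by (intro mult_left_mono power_mono prod_nonneg) (auto simp: tau_nonneg)
    also have "\<dots> \<le> (1/4) ^ l" unfolding siny by (rule tau_prod_decay)
    finally show ?thesis by (simp add: power_divide field_simps)
  qed
  also have "(1/4) ^ l \<le> pi\<^sup>2 / w\<^sup>2"
  proof -
    have "w\<^sup>2 \<le> (2 ^ l * pi)\<^sup>2" using power_mono[OF l(1), of 2] by simp
    also have "\<dots> = 4 ^ l * pi\<^sup>2"
    proof -
      have "(2 ^ l)\<^sup>2 = (4::real) ^ l" by (simp add: power2_eq_square flip: power_mult_distrib)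
      then show ?thesis by (simp only: power_mult_distrib)
    qed
    finally have "w\<^sup>2 \<le> 4 ^ l * pi\<^sup>2" .
    moreover have "w\<^sup>2 > 0" using False pi_ge_zero by auto
    ultimately show ?thesis by (simp add: power_divide pos_le_divide_eq pos_divide_le_eq mult.commute)
  qed
  also have "pi\<^sup>2 / w\<^sup>2 \<le> 2 * pi\<^sup>2 * inverse (1 + w\<^sup>2)"
  proof -
    have "1 \<le> \<bar>w\<bar>" using False pi_gt3 by linarith
    then have "1 \<le> w\<^sup>2" using power_mono[of 1 "\<bar>w\<bar>" 2] by simp
    moreover have "inverse v \<le> 2 * inverse (1 + v)" if "1 \<le> v" for v :: real
      using that by (simp add: field_simps)
    ultimately have "inverse (w\<^sup>2) \<le> 2 * inverse (1 + w\<^sup>2)" by blast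
    then have "pi\<^sup>2 * inverse (w\<^sup>2) \<le> pi\<^sup>2 * (2 * inverse (1 + w\<^sup>2))" by (intro mult_left_mono) auto
    then show ?thesis by (simp add: divide_inverse mult.left_commute)
  qed
  finally have "cmod (partial_product j w) \<le> 2 ^ Suc n * (2 * pi\<^sup>2 * inverse (1 + w\<^sup>2))" by simp
  also have "\<dots> = (2 ^ (n + 2) * pi\<^sup>2) * inverse (1 + w\<^sup>2)" by simp
  also have "\<dots> \<le> decay_const * inverse (1 + w\<^sup>2)"
    unfolding decay_const_def by (intro mult_right_mono) (auto simp: add_nonneg_nonneg)
  finally show ?thesis .
qed

definition \<Phi> :: "real \<Rightarrow> complex" where "\<Phi> w = lim (\<lambda>j. partial_product j w)"

lemma partial_product_tendsto: "(\<lambda>j. partial_product j w) \<longlonglongrightarrow> \<Phi> w"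
proof -
  obtain L where L: "\<And>x y. cmod (m0 x - m0 y) \<le> L * \<bar>x - y\<bar>" "L > 0"
    by (rule trig_poly_lipschitz[OF tp]) (rule that)
  have P1: "cmod (partial_product j w) \<le> 1" for j
    unfolding partial_product_def prod_norm[symmetric] by (intro prod_le_1 conjI norm_ge_zero m0_le_1)
  have "norm (partial_product (Suc j) w - partial_product j w) \<le> (L * \<bar>w\<bar>) * (1/2) ^ j" for j
  proof -
    have "partial_product (Suc j) w - partial_product j w = partial_product j w * (m0 (w / 2 ^ Suc j) - m0 0)"
      by (simp add: partial_product_def at_0 algebra_simps)
    also have "cmod \<dots> \<le> 1 * (L * \<bar>w / 2 ^ Suc j - 0\<bar>)"
      unfolding norm_mult by (intro mult_mono P1 L) auto
    also have "\<dots> \<le> (L * \<bar>w\<bar>) * (1/2) ^ j" using L(2) by (simp add: field_simps)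
    finally show ?thesis .
  qed
  then have "summable (\<lambda>j. partial_product (Suc j) w - partial_product j w)"
    by (rule summable_comparison_test'[of "\<lambda>j. (L * \<bar>w\<bar>) * (1/2) ^ j" 0, rotated])
       (intro summable_mult summable_geometric, simp)
  then have "convergent (\<lambda>j. \<Sum>i<j. partial_product (Suc i) w - partial_product i w)"
    by (simp add: summable_iff_convergent)
  then have "convergent (\<lambda>j. partial_product j w - partial_product 0 w)" by (simp only: sum_lessThan_telescope[of "\<lambda>j. partial_product j w"])
  then have "convergent (\<lambda>j. partial_product j w)" by (simp add: convergent_diff_const_right_iff)
  then show ?thesis unfolding \<Phi>_def by (simp add: convergent_LIMSEQ_iff)
qed

lemma \<Phi>_refinement: "\<Phi> (2 * w) = m0 w * \<Phi> w"
proof -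
  have "partial_product (Suc j) (2 * w) = m0 w * partial_product j w" for j
    unfolding partial_product_def prod.lessThan_Suc_shift by simp
  then have "(\<lambda>j. m0 w * partial_product j w) \<longlonglongrightarrow> \<Phi> (2 * w)"
    using LIMSEQ_Suc[OF partial_product_tendsto[of "2 * w"]] by simp
  moreover have "(\<lambda>j. m0 w * partial_product j w) \<longlonglongrightarrow> m0 w * \<Phi> w"
    by (intro tendsto_mult_left partial_product_tendsto)
  ultimately show ?thesis by (rule LIMSEQ_unique)
qed

lemma partial_product_continuous: "continuous_on X (partial_product j)"
  unfolding partial_product_def
  by (intro continuous_on_prod continuous_on_compose2[OF trig_poly_continuous[OF tp, of UNIV]] continuous_intros) auto

lemma measurable_partial_product [measurable]: "partial_product j \<in> borel_measurable borel"
  by (intro borel_measurable_continuous_onI partial_product_continuous)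

lemma measurable_\<Phi> [measurable]: "\<Phi> \<in> borel_measurable borel"
  by (rule borel_measurable_LIMSEQ_metric[OF measurable_partial_product partial_product_tendsto])

definition truncated_product :: "nat \<Rightarrow> real \<Rightarrow> complex" where
  "truncated_product j w = indicator {- (2 ^ j * pi)..2 ^ j * pi} w *\<^sub>R partial_product j w"

lemma measurable_truncated_product [measurable]: "truncated_product j \<in> borel_measurable borel"
  unfolding truncated_product_def by measurable

lemma truncated_product_le: "cmod (truncated_product j w) \<le> decay_const * inverse (1 + w\<^sup>2)"
proof (cases "\<bar>w\<bar> \<le> 2 ^ j * pi")
  case True
  then show ?thesis using partial_product_decay[OF True] by (auto simp: truncated_product_def indicator_def)
next
  case False
  then have "truncated_product j w = 0" by (auto simp: truncated_product_def indicator_def)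
  then show ?thesis using decay_const_pos by (simp add: add_nonneg_nonneg)
qed

lemma truncated_product_tendsto: "(\<lambda>j. truncated_product j w) \<longlonglongrightarrow> \<Phi> w"
proof (rule Lim_transform_eventually[OF partial_product_tendsto])
  obtain N :: nat where "\<bar>w\<bar> / pi < 2 ^ N" using real_arch_pow[of 2] by auto
  then have N: "\<bar>w\<bar> < 2 ^ N * pi" by (simp add: field_simps)
  have "partial_product j w = truncated_product j w" if "j \<ge> N" for j
  proof -
    have "(2::real) ^ N * pi \<le> 2 ^ j * pi" using that by (intro mult_right_mono power_increasing) auto
    then have "\<bar>w\<bar> \<le> 2 ^ j * pi" using N by linarith
    then show ?thesis by (auto simp: truncated_product_def indicator_def)
  qed
  then show "\<forall>\<^sub>F j in sequentially. partial_product j w = truncated_product j w" by (auto simp: eventually_sequentially)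
qed

lemma integrable_dominating: "integrable lborel (\<lambda>w::real. decay_const * inverse (1 + w\<^sup>2))"
proof -
  have "integrable lborel (\<lambda>w::real. inverse (1 + w\<^sup>2))"
    using integrable_inverse_1_plus_square by (simp add: set_integrable_def)
  then show ?thesis by (rule integrable_mult_right)
qed

lemma \<Phi>_le: "cmod (\<Phi> w) \<le> decay_const * inverse (1 + w\<^sup>2)"
  by (rule LIMSEQ_le_const2[OF tendsto_norm[OF truncated_product_tendsto]]) (auto intro: truncated_product_le)

lemma integrable_\<Phi>_cis: "integrable lborel (\<lambda>w. \<Phi> w * cis (w * x))"
  by (rule Bochner_Integration.integrable_bound[OF integrable_dominating])
     (use \<Phi>_le decay_const_pos in \<open>auto simp: norm_mult cis_conv_exp add_nonneg_nonneg\<close>)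

definition \<phi> :: "real \<Rightarrow> complex" where
  "\<phi> x = (LINT w|lborel. \<Phi> w * cis (w * x)) / of_real (2 * pi)"

lemma \<phi>_continuous: "continuous_on UNIV \<phi>"
proof -
  have "(\<lambda>i. LINT w|lborel. \<Phi> w * cis (w * X i)) \<longlonglongrightarrow> (LINT w|lborel. \<Phi> w * cis (w * x))"
    if X: "X \<longlonglongrightarrow> x" for X x
  proof (rule integral_dominated_convergence[OF _ _ integrable_dominating])
    show "AE w in lborel. (\<lambda>i. \<Phi> w * cis (w * X i)) \<longlonglongrightarrow> \<Phi> w * cis (w * x)"
      using X by (auto simp: cis_conv_exp intro!: tendsto_intros)
  qed (auto simp: norm_mult \<Phi>_le cis_conv_exp)
  then have "(\<lambda>i. \<phi> (X i)) \<longlonglongrightarrow> \<phi> x" if "X \<longlonglongrightarrow> x" for X x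
    unfolding \<phi>_def using that by (intro tendsto_divide tendsto_const) auto
  then show ?thesis by (auto simp: continuous_on_sequentially o_def)
qed

text \<open>
  The refinement equation in the time domain is \<open>\<Phi>(2w) = m\<^sub>0(w) \<Phi>(w)\<close> after the substitution
  \<open>w \<mapsto> 2w\<close>.
\<close>

lemma \<phi>_refinement:
  assumes "finite S" "{k. fcoef m0 k \<noteq> 0} \<subseteq> S"
  shows "\<phi> y = 2 * (\<Sum>k\<in>S. fcoef m0 k * \<phi> (2 * y + of_int k))"
proof -
  have "(LINT w|lborel. \<Phi> w * cis (w * y)) = 2 *\<^sub>R (LINT w|lborel. \<Phi> (0 + 2 * w) * cis ((0 + 2 * w) * y))"
    using lborel_integral_real_affine[of 2 "\<lambda>w. \<Phi> w * cis (w * y)" 0] by simp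
  also have "(\<lambda>w. \<Phi> (0 + 2 * w) * cis ((0 + 2 * w) * y))
     = (\<lambda>w. \<Sum>k\<in>S. fcoef m0 k * (\<Phi> w * cis (w * (2 * y + of_int k))))"
  proof
    fix w
    have "cis (of_int k * w) * cis (w * (2 * y)) = cis (w * (2 * y + of_int k))" for k
      by (simp add: cis_mult algebra_simps)
    then have "fcoef m0 k * cis (of_int k * w) * (\<Phi> w * cis (w * (2 * y)))
      = fcoef m0 k * (\<Phi> w * cis (w * (2 * y + of_int k)))" for k
      by (metis (no_types, opaque_lifting) mult.assoc mult.left_commute)
    moreover have "\<Phi> (0 + 2 * w) * cis ((0 + 2 * w) * y)
      = (\<Sum>k\<in>S. fcoef m0 k * cis (of_int k * w)) * (\<Phi> w * cis (w * (2 * y)))"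
      using \<Phi>_refinement[of w] fcoef_sum[OF tp assms, of w] by (simp add: mult.assoc mult.left_commute)
    ultimately show "\<Phi> (0 + 2 * w) * cis ((0 + 2 * w) * y)
      = (\<Sum>k\<in>S. fcoef m0 k * (\<Phi> w * cis (w * (2 * y + of_int k))))"
      by (simp only: sum_distrib_right)
  qed
  also have "(LINT w|lborel. (\<Sum>k\<in>S. fcoef m0 k * (\<Phi> w * cis (w * (2 * y + of_int k)))))
      = (\<Sum>k\<in>S. fcoef m0 k * (LINT w|lborel. \<Phi> w * cis (w * (2 * y + of_int k))))"
    by (subst Bochner_Integration.integral_sum) (auto intro!: integrable_mult_right integrable_\<Phi>_cis)
  finally show ?thesis
    unfolding \<phi>_def by (simp add: scaleR_conv_of_real flip: sum_divide_distrib)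
qed

text \<open>
  Dilated by \<open>2\<^sup>-\<^sup>j\<close>, the \<open>j\<close>-fold iterated mask is the partial product, so its coefficients are,
  after scaling, inverse Fourier integrals that approximate \<open>\<phi>\<close>. They live on a bounded set and
  have sum 1, and both properties pass to \<open>\<phi>\<close>.
\<close>

definition iterated_mask :: "nat \<Rightarrow> real \<Rightarrow> complex" where
  "iterated_mask j x = (\<Prod>i<j. m0 (of_nat (2 ^ i) * x))"

lemma iterated_mask_dilate: "iterated_mask j (w / 2 ^ j) = partial_product j w"
proof -
  have "(\<Prod>i<j. m0 (w / 2 ^ Suc i)) = (\<Prod>i<j. m0 (w / 2 ^ Suc (j - Suc i)))"
    by (rule prod.nat_diff_reindex[symmetric])
  also have "\<dots> = (\<Prod>i<j. m0 (of_nat (2 ^ i) * (w / 2 ^ j)))"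
  proof (intro prod.cong refl arg_cong[of _ _ m0])
    fix i assume "i \<in> {..<j}"
    then have "j = Suc (j - Suc i) + i" by simp
    then have "(2::real) ^ j = 2 ^ Suc (j - Suc i) * 2 ^ i" by (metis power_add)
    then show "w / 2 ^ Suc (j - Suc i) = of_nat (2 ^ i) * (w / 2 ^ j)" by (simp add: field_simps)
  qed
  finally show ?thesis by (simp add: iterated_mask_def partial_product_def)
qed

lemma iterated_mask_deg:
  assumes "trig_poly_deg d m0"
  shows "trig_poly_deg (2 ^ j * d) (iterated_mask j)"
proof -
  have "trig_poly_deg ((2 ^ j - 1) * d) (iterated_mask j)"
  proof (induction j)
    case 0
    show ?case using trig_poly_deg.monomial[of 0 0 1] by (simp add: iterated_mask_def[abs_def])
  next
    case (Suc j)
    have "iterated_mask (Suc j) = (\<lambda>x. iterated_mask j x * m0 (of_nat (2 ^ j) * x))" by (auto simp: iterated_mask_def)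
    moreover have "trig_poly_deg ((2 ^ j - 1) * d + 2 ^ j * d) (\<lambda>x. iterated_mask j x * m0 (of_nat (2 ^ j) * x))"
      by (intro trig_poly_deg_mult Suc trig_poly_deg_dilate assms)
    moreover have "(2 ^ j - 1) * d + 2 ^ j * d = (2 ^ Suc j - 1) * d"
    proof -
      have "(2::nat) ^ Suc j - 1 = (2 ^ j - 1) + 2 ^ j" by simp
      then show ?thesis by (simp only: distrib_right)
    qed
    ultimately show ?case by simp
  qed
  then show ?thesis by (rule trig_poly_deg_mono) simp
qed

text \<open>
  The cascade algorithm started from the indicator of \<open>{0..<1}\<close>. The sign of the index comes from the
  convention \<open>m\<^sub>0 = \<Sum>k. c\<^sub>k e\<^sup>i\<^sup>k\<^sup>x\<close>, which turns the refinement equation into one for \<open>\<phi>(2y + k)\<close>.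
\<close>

definition cascade :: "nat \<Rightarrow> real \<Rightarrow> complex" where
  "cascade j x = 2 ^ j * fcoef (iterated_mask j) (- \<lfloor>2 ^ j * x\<rfloor>)"

lemma cascade_eq: "cascade j x = (LINT w|lborel. truncated_product j w * cis (w * (of_int \<lfloor>2 ^ j * x\<rfloor> / 2 ^ j))) / of_real (2 * pi)"
proof -
  let ?k = "\<lfloor>2 ^ j * x\<rfloor>"
  have "(LINT x:{-pi..pi}|lborel. iterated_mask j x * cis (of_int ?k * x))
      = (1 / 2 ^ j) *\<^sub>R (LINT w|lborel. indicator {-pi..pi} (w / 2 ^ j) *\<^sub>R (iterated_mask j (w / 2 ^ j) * cis (of_int ?k * (w / 2 ^ j))))"
    using lborel_integral_real_affine[of "1 / 2 ^ j" "\<lambda>x. indicator {-pi..pi} x *\<^sub>R (iterated_mask j x * cis (of_int ?k * x))" 0]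
    by (simp add: set_lebesgue_integral_def)
  also have "(\<lambda>w. indicator {-pi..pi} (w / 2 ^ j) *\<^sub>R (iterated_mask j (w / 2 ^ j) * cis (of_int ?k * (w / 2 ^ j))))
      = (\<lambda>w. truncated_product j w * cis (w * (of_int ?k / 2 ^ j)))"
  proof
    fix w :: real
    have "(indicator {-pi..pi} (w / 2 ^ j) :: real) = indicator {- (2 ^ j * pi)..2 ^ j * pi} w"
      by (auto simp: indicator_def field_simps)
    then show "indicator {-pi..pi} (w / 2 ^ j) *\<^sub>R (iterated_mask j (w / 2 ^ j) * cis (of_int ?k * (w / 2 ^ j)))
      = truncated_product j w * cis (w * (of_int ?k / 2 ^ j))"
      by (simp add: truncated_product_def iterated_mask_dilate mult.commute)
  qed
  finally show ?thesis
    unfolding cascade_def fcoef_def mean_def by (simp add: scaleR_conv_of_real)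
qed

lemma cascade_tendsto: "(\<lambda>j. cascade j x) \<longlonglongrightarrow> \<phi> x"
proof -
  have "(\<lambda>j. of_int \<lfloor>2 ^ j * x\<rfloor> / 2 ^ j) \<longlonglongrightarrow> x"
  proof (rule tendsto_sandwich)
    show "\<forall>\<^sub>F j in sequentially. x - (1/2) ^ j \<le> of_int \<lfloor>2 ^ j * x\<rfloor> / 2 ^ j"
    proof (intro always_eventually allI)
      fix j
      have "2 ^ j * x - 1 \<le> of_int \<lfloor>2 ^ j * x\<rfloor>" by linarith
      then have "(2 ^ j * x - 1) / 2 ^ j \<le> of_int \<lfloor>2 ^ j * x\<rfloor> / 2 ^ j" by (intro divide_right_mono) auto
      then show "x - (1/2) ^ j \<le> of_int \<lfloor>2 ^ j * x\<rfloor> / 2 ^ j" by (simp add: diff_divide_distrib power_divide)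
    qed
    show "\<forall>\<^sub>F j in sequentially. of_int \<lfloor>2 ^ j * x\<rfloor> / 2 ^ j \<le> x"
      by (intro always_eventually allI) (simp add: divide_le_eq mult.commute)
    have "(\<lambda>j. x - (1/2) ^ j) \<longlonglongrightarrow> x - 0" by (intro tendsto_diff tendsto_const LIMSEQ_realpow_zero) auto
    then show "(\<lambda>j. x - (1/2) ^ j) \<longlonglongrightarrow> x" by simp
  qed auto
  then have "(\<lambda>j. truncated_product j w * cis (w * (of_int \<lfloor>2 ^ j * x\<rfloor> / 2 ^ j))) \<longlonglongrightarrow> \<Phi> w * cis (w * x)" for w
    unfolding cis_conv_exp by (intro tendsto_intros truncated_product_tendsto)
  then have "(\<lambda>j. LINT w|lborel. truncated_product j w * cis (w * (of_int \<lfloor>2 ^ j * x\<rfloor> / 2 ^ j))) \<longlonglongrightarrow> (LINT w|lborel. \<Phi> w * cis (w * x))"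
    by (intro integral_dominated_convergence[OF _ _ integrable_dominating])
       (auto simp: norm_mult truncated_product_le cis_conv_exp)
  then show ?thesis unfolding cascade_eq \<phi>_def by (intro tendsto_divide tendsto_const) auto
qed

lemma cascade_le: "cmod (cascade j x) \<le> (LINT w|lborel. decay_const * inverse (1 + w\<^sup>2))"
proof -
  have "cmod (cascade j x) = cmod (LINT w|lborel. truncated_product j w * cis (w * (of_int \<lfloor>2 ^ j * x\<rfloor> / 2 ^ j))) / (2 * pi)"
    unfolding cascade_eq by (simp add: norm_divide norm_mult)
  also have "\<dots> \<le> cmod (LINT w|lborel. truncated_product j w * cis (w * (of_int \<lfloor>2 ^ j * x\<rfloor> / 2 ^ j))) / 1"
    using pi_gt3 by (intro divide_left_mono) auto
  also have "\<dots> \<le> (LINT w|lborel. decay_const * inverse (1 + w\<^sup>2))"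
    unfolding div_by_1
    by (intro Bochner_Integration.integral_norm_bound_integral[OF _ integrable_dominating]
          Bochner_Integration.integrable_bound[OF integrable_dominating])
       (use truncated_product_le decay_const_pos in \<open>auto simp: norm_mult cis_conv_exp add_nonneg_nonneg\<close>)
  finally show ?thesis .
qed

lemma cascade_support:
  assumes "trig_poly_deg d m0" "\<bar>x\<bar> > of_nat d + 1"
  shows "cascade j x = 0"
proof -
  have "(2::real) ^ j \<ge> 1" by simp
  then have "2 ^ j * (of_nat d + 1) \<ge> 2 ^ j * real d + 1" by (simp add: algebra_simps)
  moreover have "2 ^ j * (of_nat d + 1) < 2 ^ j * \<bar>x\<bar>"
    using assms(2) by (intro mult_strict_left_mono) auto
  moreover have "\<bar>2 ^ j * x\<bar> = 2 ^ j * \<bar>x\<bar>" by (simp add: abs_mult)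
  ultimately have "2 ^ j * real d + 1 < \<bar>2 ^ j * x\<bar>" by linarith
  moreover have "\<bar>2 ^ j * x\<bar> \<le> \<bar>of_int \<lfloor>2 ^ j * x\<rfloor>\<bar> + 1" by linarith
  ultimately have "2 ^ j * real d < of_int \<bar>\<lfloor>2 ^ j * x\<rfloor>\<bar>" by simp
  also have "2 ^ j * real d = of_int (int (2 ^ j * d))" by simp
  finally have "int (2 ^ j * d) < \<bar>- \<lfloor>2 ^ j * x\<rfloor>\<bar>" by (simp only: of_int_less_iff abs_minus_cancel)
  then show ?thesis unfolding cascade_def using fcoef_deg[OF iterated_mask_deg[OF assms(1)]] by simp
qed

lemma integral_cascade: "(LINT x|lborel. cascade j x) = 1"
proof -
  obtain d where d: "trig_poly_deg d m0" using trig_poly_imp_deg[OF tp] by blast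
  have tp_iterated: "trig_poly (iterated_mask j)" using iterated_mask_deg[OF d] by (rule trig_poly_deg_imp_trig_poly)
  define S where "S = uminus ` {k. fcoef (iterated_mask j) k \<noteq> 0}"
  have S: "finite S" unfolding S_def using fcoef_finite_support[OF tp_iterated] by simp
  have "(LINT x|lborel. cascade j x) = (1 / 2 ^ j) *\<^sub>R (\<Sum>k\<in>S. 2 ^ j * fcoef (iterated_mask j) (- k))"
    unfolding cascade_def by (rule integral_dyadic_step[OF S]) (force simp: S_def image_iff)+
  also have "\<dots> = (\<Sum>k\<in>S. fcoef (iterated_mask j) (- k))"
    by (simp add: scaleR_conv_of_real flip: sum_distrib_left)
  also have "\<dots> = (\<Sum>k | fcoef (iterated_mask j) k \<noteq> 0. fcoef (iterated_mask j) k)"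
    unfolding S_def by (subst sum.reindex) auto
  also have "\<dots> = iterated_mask j 0"
    using fcoef_sum[OF tp_iterated fcoef_finite_support[OF tp_iterated] order_refl, of 0] by simp
  also have "\<dots> = 1" by (simp add: iterated_mask_def at_0)
  finally show ?thesis .
qed

lemma \<phi>_support:
  assumes "trig_poly_deg d m0" "\<bar>x\<bar> > of_nat d + 1"
  shows "\<phi> x = 0"
  using cascade_tendsto[of x] unfolding cascade_support[OF assms] by (simp add: LIMSEQ_const_iff)

lemma integral_\<phi>: "(LINT x|lborel. \<phi> x) = 1"
proof -
  obtain d where d: "trig_poly_deg d m0" using trig_poly_imp_deg[OF tp] by blast
  let ?M = "LINT w|lborel. decay_const * inverse (1 + w\<^sup>2)"
  have "(\<lambda>j. LINT x|lborel. cascade j x) \<longlonglongrightarrow> (LINT x|lborel. \<phi> x)"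
  proof (rule integral_dominated_convergence)
    show "integrable lborel (\<lambda>x. indicator {- (real d + 1)..real d + 1} x *\<^sub>R ?M)"
      by (intro integrable_scaleR_left integrable_real_indicator) auto
    show "AE x in lborel. norm (cascade j x) \<le> indicator {- (real d + 1)..real d + 1} x *\<^sub>R ?M" for j
    proof (intro always_eventually allI)
      fix x
      show "norm (cascade j x) \<le> indicator {- (real d + 1)..real d + 1} x *\<^sub>R ?M"
        using cascade_le[of j x] cascade_support[OF d, of x j] by (cases "\<bar>x\<bar> > real d + 1") (auto simp: indicator_def)
    qed
    show "\<phi> \<in> borel_measurable lborel"
      using borel_measurable_continuous_onI[OF \<phi>_continuous] by simp
    show "cascade j \<in> borel_measurable lborel" for j
    proof -
      have "cascade j = (\<lambda>k. 2 ^ j * fcoef (iterated_mask j) (- k)) \<circ> (\<lambda>x. \<lfloor>2 ^ j * x\<rfloor>)" by (auto simp: cascade_def)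
      then show ?thesis by simp
    qed
  qed (auto intro: cascade_tendsto)
  then show ?thesis unfolding integral_cascade by (simp add: LIMSEQ_const_iff)
qed

end

section \<open>Continuous functions with compact support\<close>

definition Cc :: "(real \<Rightarrow> complex) set" where
  "Cc = {g. continuous_on UNIV g \<and> (\<exists>R. \<forall>x. R < \<bar>x\<bar> \<longrightarrow> g x = 0)}"

lemma Cc_support:
  assumes "g \<in> Cc"
  obtains R where "R > 0" "\<And>x. R < \<bar>x\<bar> \<Longrightarrow> g x = 0"
proof -
  from assms obtain R where R: "\<And>x. R < \<bar>x\<bar> \<Longrightarrow> g x = 0" by (auto simp: Cc_def)
  show ?thesis by (rule that[of "max R 1"]) (auto intro: R)
qed

lemma Cc_continuous: "g \<in> Cc \<Longrightarrow> continuous_on A g"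
  unfolding Cc_def by (auto intro: continuous_on_subset)

lemma Cc_bounded:
  assumes "g \<in> Cc"
  obtains B where "B > 0" "\<And>x. cmod (g x) \<le> B"
proof -
  obtain R where R: "R > 0" "\<And>x. R < \<bar>x\<bar> \<Longrightarrow> g x = 0" by (rule Cc_support[OF assms]) (rule that)
  have "compact (g ` {-R..R})" by (intro compact_continuous_image Cc_continuous assms) auto
  then obtain B where B: "\<And>y. y \<in> g ` {-R..R} \<Longrightarrow> cmod y \<le> B"
    using compact_imp_bounded bounded_iff by metis
  have "cmod (g x) \<le> max B 1" for x
  proof (cases "\<bar>x\<bar> \<le> R")
    case True
    then have "cmod (g x) \<le> B" by (intro B imageI) auto
    then show ?thesis by simp
  qed (use R in auto)
  then show ?thesis by (intro that[of "max B 1"]) auto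
qed

lemma Cc_integrable:
  assumes "g \<in> Cc"
  shows "integrable lborel g"
proof -
  obtain R where R: "R > 0" "\<And>x. R < \<bar>x\<bar> \<Longrightarrow> g x = 0" by (rule Cc_support[OF assms]) (rule that)
  have "set_integrable lborel {-R..R} g" by (intro continuous_set_integrable Cc_continuous assms)
  moreover have "(\<lambda>x. indicator {-R..R} x *\<^sub>R g x) = g"
    using R(2) by (force simp: indicator_def)
  ultimately show ?thesis by (simp add: set_integrable_def)
qed

lemma Cc_measurable: "g \<in> Cc \<Longrightarrow> g \<in> borel_measurable borel"
  by (intro borel_measurable_continuous_onI Cc_continuous)

lemma Cc_mult_left: "g \<in> Cc \<Longrightarrow> continuous_on UNIV h \<Longrightarrow> (\<lambda>x. g x * h x) \<in> Cc"
  unfolding Cc_def by (auto intro!: continuous_intros)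

lemma Cc_cmult: "g \<in> Cc \<Longrightarrow> (\<lambda>x. c * g x) \<in> Cc"
  unfolding Cc_def by (auto intro!: continuous_intros)

lemma Cc_cnj: "g \<in> Cc \<Longrightarrow> (\<lambda>x. cnj (g x)) \<in> Cc"
  unfolding Cc_def by (auto intro!: continuous_intros)

lemma Cc_norm_sq: "g \<in> Cc \<Longrightarrow> (\<lambda>x. of_real ((cmod (g x))\<^sup>2)) \<in> Cc"
  unfolding Cc_def by (auto intro!: continuous_intros)

lemma Cc_zero: "(\<lambda>x. 0) \<in> Cc"
  unfolding Cc_def by auto

lemma Cc_add: assumes "g \<in> Cc" "h \<in> Cc" shows "(\<lambda>x. g x + h x) \<in> Cc"
proof -
  obtain R where R: "R > 0" "\<And>x. R < \<bar>x\<bar> \<Longrightarrow> g x = 0" by (rule Cc_support[OF assms(1)]) (rule that)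
  obtain T where T: "T > 0" "\<And>x. T < \<bar>x\<bar> \<Longrightarrow> h x = 0" by (rule Cc_support[OF assms(2)]) (rule that)
  show ?thesis unfolding Cc_def
  proof (intro CollectI conjI exI allI impI)
    show "continuous_on UNIV (\<lambda>x. g x + h x)" by (intro continuous_intros Cc_continuous assms)
    show "g x + h x = 0" if "R + T < \<bar>x\<bar>" for x using that R(1) T(1) R(2)[of x] T(2)[of x] by simp
  qed
qed

lemma Cc_sum: "(\<And>i. i \<in> I \<Longrightarrow> g i \<in> Cc) \<Longrightarrow> (\<lambda>x. \<Sum>i\<in>I. g i x) \<in> Cc"
  by (induction I rule: infinite_finite_induct) (auto intro: Cc_zero Cc_add)

lemma Cc_affine:
  assumes "g \<in> Cc" "a \<noteq> 0"
  shows "(\<lambda>x. g (a * x + b)) \<in> Cc"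
proof -
  obtain R where R: "R > 0" "\<And>x. R < \<bar>x\<bar> \<Longrightarrow> g x = 0" by (rule Cc_support[OF assms(1)]) (rule that)
  show ?thesis unfolding Cc_def
  proof (intro CollectI conjI exI allI impI)
    show "continuous_on UNIV (\<lambda>x. g (a * x + b))"
      by (rule continuous_on_compose2[OF Cc_continuous[OF assms(1), of UNIV]]) (auto intro!: continuous_intros)
    fix x assume "(R + \<bar>b\<bar>) / \<bar>a\<bar> < \<bar>x\<bar>"
    then have "R + \<bar>b\<bar> < \<bar>a * x\<bar>" using assms(2) by (simp add: abs_mult pos_divide_less_eq mult.commute)
    then have "R < \<bar>a * x + b\<bar>" by linarith
    then show "g (a * x + b) = 0" by (rule R(2))
  qed
qed

lemma Cc_lebesgue_integrable: "g \<in> Cc \<Longrightarrow> integrable lebesgue g"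
  using integrable_completion[of g lborel] Cc_integrable Cc_measurable by auto

lemma Cc_lebesgue_integral: "g \<in> Cc \<Longrightarrow> (LINT x|lebesgue. g x) = (LINT x|lborel. g x)"
  using integral_completion[of g lborel] Cc_measurable by auto

lemma Cc_norm_sq_integrable: "g \<in> Cc \<Longrightarrow> integrable lborel (\<lambda>x. (cmod (g x))\<^sup>2)"
  using Cc_integrable[OF Cc_norm_sq] by (simp only: complex_of_real_integrable_eq)

lemma Cc_norm_integrable: "g \<in> Cc \<Longrightarrow> integrable lborel (\<lambda>x. cmod (g x))"
  by (intro integrable_norm Cc_integrable)

lemma Cc_L2_R: "g \<in> Cc \<Longrightarrow> g \<in> L2_R"
  unfolding L2_R_def using Cc_measurable[of g] Cc_norm_sq_integrable[of g]
  by (auto intro!: measurable_completion integrable_completion[THEN iffD2] simp: measurable_completion)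

lemma Cc_L2_norm: "g \<in> Cc \<Longrightarrow> (L2_norm g)\<^sup>2 = (LINT x|lborel. (cmod (g x))\<^sup>2)"
proof -
  assume g: "g \<in> Cc"
  have [measurable]: "g \<in> borel_measurable borel" by (rule Cc_measurable[OF g])
  have "(LINT x|lebesgue. (cmod (g x))\<^sup>2) = (LINT x|lborel. (cmod (g x))\<^sup>2)"
    by (rule integral_completion) simp
  moreover have "0 \<le> (LINT x|lborel. (cmod (g x))\<^sup>2)" by (rule integral_nonneg_AE) simp
  ultimately show ?thesis by (simp add: L2_norm_def)
qed

lemma Cc_compactly_supported:
  assumes "g \<in> Cc"
  shows "compactly_supported g"
proof -
  obtain R where R: "R > 0" "\<And>x. R < \<bar>x\<bar> \<Longrightarrow> g x = 0" by (rule Cc_support[OF assms]) (rule that)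
  have "{x. g x \<noteq> 0} \<subseteq> {-R..R}" using R(2) by force
  then have "bounded {x. g x \<noteq> 0}" using bounded_closed_interval bounded_subset by blast
  then show ?thesis unfolding compactly_supported_def by (simp add: compact_closure)
qed

lemma Cc_wavelet: "\<psi> \<in> Cc \<Longrightarrow> wavelet \<psi> j k \<in> Cc"
  unfolding wavelet_def[abs_def] by (intro Cc_cmult Cc_affine) auto

lemma L2_inner_Cc: "g \<in> Cc \<Longrightarrow> h \<in> Cc \<Longrightarrow> L2_inner g h = (LINT x|lborel. g x * cnj (h x))"
  unfolding L2_inner_def by (intro Cc_lebesgue_integral Cc_mult_left Cc_continuous Cc_cnj)

lemma L2_inner_sum_right:
  assumes "g \<in> Cc" "\<And>i. i \<in> I \<Longrightarrow> h i \<in> Cc"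
  shows "L2_inner g (\<lambda>x. \<Sum>i\<in>I. c i * h i x) = (\<Sum>i\<in>I. cnj (c i) * L2_inner g (h i))"
proof -
  have "(\<lambda>x. \<Sum>i\<in>I. c i * h i x) \<in> Cc" by (intro Cc_sum Cc_cmult assms)
  then have "L2_inner g (\<lambda>x. \<Sum>i\<in>I. c i * h i x) = (LINT x|lborel. (\<Sum>i\<in>I. cnj (c i) * (g x * cnj (h i x))))"
    by (subst L2_inner_Cc[OF assms(1)]) (auto simp: sum_distrib_left mult.left_commute)
  also have "\<dots> = (\<Sum>i\<in>I. (LINT x|lborel. cnj (c i) * (g x * cnj (h i x))))"
    by (intro Bochner_Integration.integral_sum Cc_integrable Cc_cmult Cc_mult_left Cc_continuous Cc_cnj assms)
  also have "\<dots> = (\<Sum>i\<in>I. cnj (c i) * L2_inner g (h i))"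
    using assms by (intro sum.cong refl) (simp add: L2_inner_Cc)
  finally show ?thesis .
qed

section \<open>Energy conservation in the filter bank\<close>

lemma fcoef_shift:
  assumes "trig_poly p"
  shows "fcoef (\<lambda>x. p (x + pi)) l = (if even l then fcoef p l else - fcoef p l)"
proof -
  have e: "cis (- (of_int l * x)) = (if even l then 1 else -1) * cis (of_int (- l) * (x + pi))" for x
  proof -
    have "cis (of_int (- l) * (x + pi)) = cis (- (of_int l * x)) * cis (of_int (- l) * pi)"
      by (simp add: cis_mult algebra_simps)
    moreover have "cis (of_int (- l) * pi) = (if even l then 1 else -1)"
      by (simp add: complex_eq_iff sin_npi_int cos_npi_int mult.commute)
    ultimately show ?thesis by simp
  qed
  have "fcoef (\<lambda>x. p (x + pi)) l = mean (\<lambda>x. (if even l then 1 else -1) * (p (x + pi) * cis (of_int (- l) * (x + pi))))"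
    unfolding fcoef_def e by (simp only: mult.left_commute)
  also have "\<dots> = (if even l then 1 else -1) * mean (\<lambda>x. p x * cis (of_int (- l) * x))"
    by (simp only: mean_cmult mean_shift[OF trig_poly_mult[OF assms trig_poly_cis]])
  finally show ?thesis by (simp add: fcoef_def)
qed

text \<open>
  Keeping every second coefficient amounts to averaging a function with its shift by \<open>\<pi>\<close>.
\<close>

lemma downsampling_energy:
  assumes "trig_poly p" "finite T" "\<And>n. n \<notin> T \<Longrightarrow> fcoef p (2 * n) = 0"
  shows "of_real (\<Sum>n\<in>T. (cmod (fcoef p (2 * n)))\<^sup>2)
    = mean (\<lambda>x. of_real ((cmod ((1/2) * (p x + p (x + pi))))\<^sup>2))"
proof -
  define e where "e = (\<lambda>x. (1/2) * (p x + p (x + pi)))"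
  have e: "trig_poly e" unfolding e_def by (intro trig_poly_cmult trig_poly.add trig_poly_shift assms)
  have coef: "fcoef e l = (if even l then fcoef p l else 0)" for l
  proof -
    have "fcoef e l = mean (\<lambda>x. (1/2) * (p x * cis (of_int (- l) * x) + p (x + pi) * cis (of_int (- l) * x)))"
      unfolding fcoef_def e_def by (simp add: algebra_simps)
    also have "\<dots> = (1/2) * (fcoef p l + fcoef (\<lambda>x. p (x + pi)) l)"
      unfolding mean_cmult
      by (subst mean_add) (auto simp: fcoef_def intro!: trig_poly_mult trig_poly_cis[of "-l", simplified] trig_poly_shift assms(1))
    finally show ?thesis by (cases "even l") (simp_all add: fcoef_shift[OF assms(1)])
  qed
  have "{l. fcoef e l \<noteq> 0} \<subseteq> (\<lambda>n. 2 * n) ` T"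
  proof
    fix l assume "l \<in> {l. fcoef e l \<noteq> 0}"
    then have l: "even l" "fcoef p l \<noteq> 0" by (auto simp: coef split: if_splits)
    then obtain n where "l = 2 * n" by blast
    then show "l \<in> (\<lambda>n. 2 * n) ` T" using assms(3)[of n] l(2) by blast
  qed
  from fcoef_parseval[OF e _ this] assms(2)
  have "mean (\<lambda>x. of_real ((cmod (e x))\<^sup>2)) = of_real (\<Sum>l\<in>(\<lambda>n. 2 * n) ` T. (cmod (fcoef e l))\<^sup>2)" by blast
  also have "(\<Sum>l\<in>(\<lambda>n. 2 * n) ` T. (cmod (fcoef e l))\<^sup>2) = (\<Sum>n\<in>T. (cmod (fcoef p (2 * n)))\<^sup>2)"
    by (subst sum.reindex) (auto simp: inj_on_def coef)
  finally show ?thesis by (simp add: e_def)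
qed

text \<open>
  By the two identities the vectors \<open>(m\<^sub>r(x))\<^sub>r\<close> and \<open>(m\<^sub>r(x + \<pi>))\<^sub>r\<close> are orthonormal, so the squares of
  \<open>\<alpha>(x) cnj m\<^sub>r(x) + \<alpha>(x + \<pi>) cnj m\<^sub>r(x + \<pi>)\<close> add up to \<open>|\<alpha>(x)|\<^sup>2 + |\<alpha>(x + \<pi>)|\<^sup>2\<close>. Here \<open>\<alpha>\<close> is the
  trigonometric polynomial with coefficients \<open>a\<close>.
\<close>

lemma filter_bank_energy:
  fixes a :: "int \<Rightarrow> complex"
  assumes tp: "\<And>r. r \<le> q \<Longrightarrow> trig_poly (m r)"
    and unit: "\<And>x. (\<Sum>r=0..q. (cmod (m r x))\<^sup>2) = 1"
    and cross: "\<And>x. (\<Sum>r=0..q. m r x * cnj (m r (x + pi))) = 0"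
    and fin: "finite A" "\<And>k. k \<notin> A \<Longrightarrow> a k = 0"
    and b: "\<And>r n. b r n = of_real (sqrt 2) * (\<Sum>k | fcoef (m r) k \<noteq> 0. cnj (fcoef (m r) k) * a (2 * n + k))"
    and T: "finite T" "\<And>r n. r \<le> q \<Longrightarrow> n \<notin> T \<Longrightarrow> b r n = 0"
  shows "(\<Sum>r=0..q. \<Sum>n\<in>T. (cmod (b r n))\<^sup>2) = (\<Sum>k\<in>A. (cmod (a k))\<^sup>2)"
proof -
  define \<alpha> where "\<alpha> = (\<lambda>x. \<Sum>k\<in>A. a k * cis (of_int k * x))"
  have \<alpha>: "trig_poly \<alpha>" unfolding \<alpha>_def by (intro trig_poly_sum trig_poly.monomial)
  have \<alpha>_coef: "fcoef \<alpha> k = a k" for k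
    using fcoef_expansion[OF fin(1), of \<alpha> a k] fin(2) by (auto simp: \<alpha>_def)
  define p where "p = (\<lambda>r x. \<alpha> x * cnj (m r x))"
  have p: "trig_poly (p r)" if "r \<le> q" for r
    unfolding p_def by (intro trig_poly_mult trig_poly_cnj \<alpha> tp that)
  have p_coef: "b r n = of_real (sqrt 2) * fcoef (p r) (2 * n)" if "r \<le> q" for r n
  proof -
    let ?S = "{k. fcoef (m r) k \<noteq> 0}"
    have S: "finite ?S" by (rule fcoef_finite_support[OF tp[OF that]])
    have "fcoef (p r) (2 * n) = mean (\<lambda>x. \<Sum>k\<in>?S. cnj (fcoef (m r) k) * (\<alpha> x * cis (of_int (- (2 * n + k)) * x)))"
      unfolding fcoef_def[of "p r"]
    proof (rule arg_cong[of _ _ mean], rule ext)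
      fix x
      have "cis (- (of_int k * x)) * cis (- (of_int (2 * n) * x)) = cis (of_int (- (2 * n + k)) * x)" for k
        by (simp add: cis_mult algebra_simps)
      then have "\<alpha> x * (cnj (fcoef (m r) k) * cis (- (of_int k * x))) * cis (- (of_int (2 * n) * x))
        = cnj (fcoef (m r) k) * (\<alpha> x * cis (of_int (- (2 * n + k)) * x))" for k
        by (simp only: ac_simps)
      moreover have "p r x = (\<Sum>k\<in>?S. \<alpha> x * (cnj (fcoef (m r) k) * cis (- (of_int k * x))))"
        unfolding p_def fcoef_sum[OF tp[OF that] S order_refl, of x]
        by (simp add: cnj_sum sum_distrib_left cis_cnj)
      ultimately show "p r x * cis (- (of_int (2 * n) * x))
        = (\<Sum>k\<in>?S. cnj (fcoef (m r) k) * (\<alpha> x * cis (of_int (- (2 * n + k)) * x)))"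
        by (simp only: sum_distrib_right)
    qed
    also have "\<dots> = (\<Sum>k\<in>?S. cnj (fcoef (m r) k) * mean (\<lambda>x. \<alpha> x * cis (of_int (- (2 * n + k)) * x)))"
      by (simp only: mean_sum mean_cmult trig_poly_cmult trig_poly_mult[OF \<alpha> trig_poly_cis])
    also have "\<dots> = (\<Sum>k\<in>?S. cnj (fcoef (m r) k) * a (2 * n + k))"
      by (simp only: \<alpha>_coef[symmetric] fcoef_def of_int_minus mult_minus_left)
    finally show ?thesis by (simp add: b)
  qed
  have split: "(\<Sum>r=0..q. complex_of_real ((cmod ((1/2) * (p r x + p r (x + pi))))\<^sup>2))
      = (1/4) * (of_real ((cmod (\<alpha> x))\<^sup>2) + of_real ((cmod (\<alpha> (x + pi)))\<^sup>2))" for x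
  proof -
    let ?\<beta> = "\<alpha> (x + pi)" and ?n = "\<lambda>r. m r (x + pi)"
    have "complex_of_real ((cmod ((1/2) * (p r x + p r (x + pi))))\<^sup>2)
      = (1/4) * (\<alpha> x * cnj (\<alpha> x) * (m r x * cnj (m r x)) + ?\<beta> * cnj ?\<beta> * (?n r * cnj (?n r))
        + ?\<beta> * cnj (\<alpha> x) * (m r x * cnj (?n r)) + cnj (?\<beta> * cnj (\<alpha> x) * (m r x * cnj (?n r))))" for r
      unfolding complex_norm_square p_def by (simp add: algebra_simps)
    then have "(\<Sum>r=0..q. complex_of_real ((cmod ((1/2) * (p r x + p r (x + pi))))\<^sup>2))
      = (1/4) * (\<alpha> x * cnj (\<alpha> x) * (\<Sum>r=0..q. m r x * cnj (m r x)) + ?\<beta> * cnj ?\<beta> * (\<Sum>r=0..q. ?n r * cnj (?n r))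
        + ?\<beta> * cnj (\<alpha> x) * (\<Sum>r=0..q. m r x * cnj (?n r)) + cnj (?\<beta> * cnj (\<alpha> x) * (\<Sum>r=0..q. m r x * cnj (?n r))))"
      by (simp only: sum.distrib sum_distrib_left[symmetric] cnj_sum[symmetric])
    moreover have "(\<Sum>r=0..q. m r y * cnj (m r y)) = 1" for y
      using arg_cong[OF unit[of y], of complex_of_real] by (simp only: of_real_sum complex_norm_square of_real_1)
    ultimately show ?thesis by (simp only: cross complex_norm_square) simp
  qed
  have "complex_of_real (\<Sum>r=0..q. \<Sum>n\<in>T. (cmod (b r n))\<^sup>2)
      = 2 * (\<Sum>r=0..q. of_real (\<Sum>n\<in>T. (cmod (fcoef (p r) (2 * n)))\<^sup>2))"
  proof -
    have "(\<Sum>n\<in>T. (cmod (b r n))\<^sup>2) = 2 * (\<Sum>n\<in>T. (cmod (fcoef (p r) (2 * n)))\<^sup>2)" if "r \<le> q" for r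
      using p_coef[OF that] by (simp add: norm_mult power_mult_distrib sum_distrib_left)
    then show ?thesis by (simp add: sum_distrib_left)
  qed
  also have "\<dots> = 2 * (\<Sum>r=0..q. mean (\<lambda>x. of_real ((cmod ((1/2) * (p r x + p r (x + pi))))\<^sup>2)))"
  proof (rule arg_cong[of _ _ "\<lambda>z. 2 * z"], rule sum.cong[OF refl])
    fix r assume "r \<in> {0..q}"
    then have r: "r \<le> q" by simp
    show "complex_of_real (\<Sum>n\<in>T. (cmod (fcoef (p r) (2 * n)))\<^sup>2) = mean (\<lambda>x. of_real ((cmod ((1/2) * (p r x + p r (x + pi))))\<^sup>2))"
      by (rule downsampling_energy[OF p[OF r] T(1)]) (use T(2)[OF r] p_coef[OF r] in simp)
  qed
  also have "(\<Sum>r=0..q. mean (\<lambda>x. of_real ((cmod ((1/2) * (p r x + p r (x + pi))))\<^sup>2)))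
      = mean (\<lambda>x. \<Sum>r=0..q. of_real ((cmod ((1/2) * (p r x + p r (x + pi))))\<^sup>2))"
    by (rule mean_sum[symmetric], rule trig_poly_cmod_sq, intro trig_poly_cmult trig_poly.add trig_poly_shift p) auto
  also have "\<dots> = (1/4) * (mean (\<lambda>x. of_real ((cmod (\<alpha> x))\<^sup>2)) + mean (\<lambda>x. of_real ((cmod (\<alpha> (x + pi)))\<^sup>2)))"
    unfolding split mean_cmult
    by (subst mean_add) (rule trig_poly_cmod_sq[OF \<alpha>] trig_poly_cmod_sq[OF trig_poly_shift[OF \<alpha>]] refl)+
  also have "mean (\<lambda>x. of_real ((cmod (\<alpha> (x + pi)))\<^sup>2)) = mean (\<lambda>x. of_real ((cmod (\<alpha> x))\<^sup>2))"
    by (rule mean_shift[OF trig_poly_cmod_sq[OF \<alpha>]])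
  also have "mean (\<lambda>x. of_real ((cmod (\<alpha> x))\<^sup>2)) = of_real (\<Sum>k\<in>A. (cmod (a k))\<^sup>2)"
    unfolding \<alpha>_def by (rule mean_cmod_sum[OF fin(1)])
  finally have "complex_of_real (\<Sum>r=0..q. \<Sum>n\<in>T. (cmod (b r n))\<^sup>2) = complex_of_real (\<Sum>k\<in>A. (cmod (a k))\<^sup>2)"
    by simp
  then show ?thesis by (simp only: of_real_eq_iff)
qed

section \<open>The unitary extension principle\<close>

lemma two_powr_half_sq: "(2 powr (of_int j / 2)) * (2 powr (of_int j / 2)) = (2::real) powr of_int j"
  by (simp flip: powr_add)

lemma L2_inner_wavelet_eq_0:
  assumes "\<And>x. R < \<bar>x\<bar> \<Longrightarrow> g x = 0" "\<And>x. L < \<bar>x\<bar> \<Longrightarrow> \<psi> x = 0"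
    "L + 2 powr of_int j * R < \<bar>of_int n\<bar>"
  shows "L2_inner g (wavelet \<psi> j n) = 0"
proof -
  have "g x * cnj (wavelet \<psi> j n x) = 0" for x
  proof (cases "R < \<bar>x\<bar>")
    case False
    then have "\<bar>2 powr of_int j * x\<bar> \<le> 2 powr of_int j * R" by (simp add: abs_mult)
    then have "L < \<bar>2 powr of_int j * x + of_int n\<bar>" using assms(3) by linarith
    then show ?thesis using assms(2) by (simp add: wavelet_def)
  qed (simp add: assms(1))
  then show ?thesis unfolding L2_inner_def by (simp only: Bochner_Integration.integral_zero)
qed

lemma L2_inner_wavelet_finite_support:
  assumes "g \<in> Cc" "\<psi> \<in> Cc"
  shows "finite {n. L2_inner g (wavelet \<psi> j n) \<noteq> 0}"
proof -
  obtain R where R: "R > 0" "\<And>x. R < \<bar>x\<bar> \<Longrightarrow> g x = 0" by (rule Cc_support[OF assms(1)]) (rule that)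
  obtain L where L: "L > 0" "\<And>x. L < \<bar>x\<bar> \<Longrightarrow> \<psi> x = 0" by (rule Cc_support[OF assms(2)]) (rule that)
  define N where "N = \<lceil>L + 2 powr of_int j * R\<rceil>"
  have "{n. L2_inner g (wavelet \<psi> j n) \<noteq> 0} \<subseteq> {-N..N}"
  proof
    fix n assume "n \<in> {n. L2_inner g (wavelet \<psi> j n) \<noteq> 0}"
    then have "\<not> L + 2 powr of_int j * R < \<bar>of_int n\<bar>"
      using L2_inner_wavelet_eq_0[of R g L \<psi> j n] R(2) L(2) by auto
    then have "of_int \<bar>n\<bar> \<le> L + 2 powr of_int j * R" by simp
    then have "\<bar>n\<bar> \<le> N" unfolding N_def by linarith
    then show "n \<in> {-N..N}" by auto
  qed
  then show ?thesis by (rule finite_subset) simp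
qed

locale uep_system =
  fixes q :: nat and m :: "nat \<Rightarrow> real \<Rightarrow> complex" and \<phi> :: "real \<Rightarrow> complex"
  assumes tp: "\<And>r. r \<le> q \<Longrightarrow> trig_poly (m r)"
    and unit: "\<And>x. (\<Sum>r=0..q. (cmod (m r x))\<^sup>2) = 1"
    and cross: "\<And>x. (\<Sum>r=0..q. m r x * cnj (m r (x + pi))) = 0"
    and \<phi>_Cc: "\<phi> \<in> Cc"
    and integral_one: "(LINT x|lborel. \<phi> x) = 1"
    and refine: "\<And>y. \<phi> y = 2 * (\<Sum>k | fcoef (m 0) k \<noteq> 0. fcoef (m 0) k * \<phi> (2 * y + of_int k))"
begin

text \<open>
  The time domain form of \<open>\<psi>\<^sub>r(2\<xi>) = m\<^sub>r(\<xi>) \<phi>(\<xi>)\<close> for the Fourier transforms; \<open>gen 0\<close> is \<open>\<phi>\<close> itself, by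
  the refinement equation.
\<close>

definition gen :: "nat \<Rightarrow> real \<Rightarrow> complex" where
  "gen r y = 2 * (\<Sum>k | fcoef (m r) k \<noteq> 0. fcoef (m r) k * \<phi> (2 * y + of_int k))"

lemma gen_0: "gen 0 = \<phi>"
  by (rule ext) (simp only: gen_def refine[symmetric])

lemma gen_Cc: "gen r \<in> Cc"
  unfolding gen_def[abs_def] by (intro Cc_cmult Cc_sum Cc_affine \<phi>_Cc) auto

lemma wavelet_gen:
  "wavelet (gen r) j n = (\<lambda>x. \<Sum>k | fcoef (m r) k \<noteq> 0.
     (of_real (sqrt 2) * fcoef (m r) k) * wavelet \<phi> (j + 1) (2 * n + k) x)"
proof
  fix x :: real
  have "(2::real) powr (of_int (j + 1) / 2) = 2 powr (of_int j / 2) * sqrt 2"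
    by (simp add: add_divide_distrib powr_add powr_half_sqrt)
  then have "2 powr (of_int j / 2) * 2 = sqrt 2 * 2 powr (of_int (j + 1) / 2)"
    by (metis mult.assoc mult.commute real_sqrt_mult_self abs_numeral)
  from arg_cong[OF this, of complex_of_real]
  have c: "of_real (2 powr (of_int j / 2)) * 2 = complex_of_real (sqrt 2) * of_real (2 powr (of_int (j + 1) / 2))"
    by (simp only: of_real_mult of_real_numeral)
  have "(2::real) powr of_int (j + 1) = 2 * 2 powr of_int j" by (simp add: powr_add)
  then have arg: "2 * (2 powr of_int j * x + of_int n) + of_int k = 2 powr of_int (j + 1) * x + of_int (2 * n + k)" for k
    by simp
  have "wavelet (gen r) j n x = (of_real (2 powr (of_int j / 2)) * 2) *
    (\<Sum>k | fcoef (m r) k \<noteq> 0. fcoef (m r) k * \<phi> (2 powr of_int (j + 1) * x + of_int (2 * n + k)))"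
    unfolding wavelet_def gen_def arg by (simp only: mult.assoc)
  also have "\<dots> = (\<Sum>k | fcoef (m r) k \<noteq> 0.
     (of_real (sqrt 2) * fcoef (m r) k) * wavelet \<phi> (j + 1) (2 * n + k) x)"
    unfolding c wavelet_def sum_distrib_left by (simp only: ac_simps)
  finally show "wavelet (gen r) j n x = (\<Sum>k | fcoef (m r) k \<noteq> 0.
     (of_real (sqrt 2) * fcoef (m r) k) * wavelet \<phi> (j + 1) (2 * n + k) x)" .
qed

lemma L2_inner_wavelet_gen:
  assumes "g \<in> Cc"
  shows "L2_inner g (wavelet (gen r) j n) = of_real (sqrt 2) *
    (\<Sum>k | fcoef (m r) k \<noteq> 0. cnj (fcoef (m r) k) * L2_inner g (wavelet \<phi> (j + 1) (2 * n + k)))"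
  unfolding wavelet_gen by (subst L2_inner_sum_right) (auto simp: assms Cc_wavelet \<phi>_Cc sum_distrib_left mult.assoc)

definition energy :: "(real \<Rightarrow> complex) \<Rightarrow> nat \<Rightarrow> int \<Rightarrow> real" where
  "energy g r j = (\<Sum>n | L2_inner g (wavelet (gen r) j n) \<noteq> 0. (cmod (L2_inner g (wavelet (gen r) j n)))\<^sup>2)"

lemma energy_superset:
  assumes "finite T" "\<And>n. n \<notin> T \<Longrightarrow> L2_inner g (wavelet (gen r) j n) = 0"
  shows "energy g r j = (\<Sum>n\<in>T. (cmod (L2_inner g (wavelet (gen r) j n)))\<^sup>2)"
  unfolding energy_def by (rule sum.mono_neutral_left) (use assms in auto)

lemma energy_nonneg: "energy g r j \<ge> 0"
  unfolding energy_def by (intro sum_nonneg) simp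

lemma energy_step:
  assumes "g \<in> Cc"
  shows "energy g 0 (j + 1) = energy g 0 j + (\<Sum>r=1..q. energy g r j)"
proof -
  let ?a = "\<lambda>n. L2_inner g (wavelet \<phi> (j + 1) n)" and ?b = "\<lambda>r n. L2_inner g (wavelet (gen r) j n)"
  define T where "T = (\<Union>r\<in>{0..q}. {n. ?b r n \<noteq> 0})"
  have T: "finite T" unfolding T_def by (intro finite_UN_I L2_inner_wavelet_finite_support assms gen_Cc) auto
  have "(\<Sum>r=0..q. \<Sum>n\<in>T. (cmod (?b r n))\<^sup>2) = (\<Sum>n | ?a n \<noteq> 0. (cmod (?a n))\<^sup>2)"
    by (rule filter_bank_energy[OF tp unit cross _ _ L2_inner_wavelet_gen[OF assms] T])
       (auto simp: T_def L2_inner_wavelet_finite_support assms \<phi>_Cc)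
  moreover have "energy g r j = (\<Sum>n\<in>T. (cmod (?b r n))\<^sup>2)" if "r \<le> q" for r
    by (rule energy_superset[OF T]) (use that in \<open>auto simp: T_def\<close>)
  moreover have "energy g 0 (j + 1) = (\<Sum>n | ?a n \<noteq> 0. (cmod (?a n))\<^sup>2)"
    unfolding energy_def gen_0 ..
  ultimately have "energy g 0 (j + 1) = (\<Sum>r=0..q. energy g r j)" by simp
  then show ?thesis by (simp add: sum.atLeast_Suc_atMost)
qed

lemma energy_telescope:
  assumes "g \<in> Cc" "a \<le> b"
  shows "energy g 0 b - energy g 0 a = (\<Sum>j\<in>{a..<b}. \<Sum>r=1..q. energy g r j)"
  using assms(2)
proof (induction b rule: int_ge_induct)
  case base
  show ?case by simp
next
  case (step b)
  have "{a..<b+1} = insert b {a..<b}" using step by auto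
  then show ?case using step energy_step[OF assms(1), of b] by simp
qed

text \<open>
  At level \<open>J\<close> the coefficients are \<open>2\<^sup>-\<^sup>J\<^sup>/\<^sup>2\<close> times the averages of \<open>g\<close> against \<open>\<phi>\<close> around the dyadic
  points, so that the energy is a Riemann sum for \<open>\<integral>|g|\<^sup>2\<close>.
\<close>

definition average :: "(real \<Rightarrow> complex) \<Rightarrow> nat \<Rightarrow> int \<Rightarrow> complex" where
  "average g J k = (LINT y|lborel. g ((y + of_int k) / 2 ^ J) * cnj (\<phi> y))"

lemma cmod_inner_average:
  assumes "g \<in> Cc"
  shows "(cmod (L2_inner g (wavelet \<phi> (int J) n)))\<^sup>2 = (1 / 2 ^ J) * (cmod (average g J (- n)))\<^sup>2"
proof -
  let ?c = "2 powr (of_int (int J) / 2) :: real"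
  have pow: "2 powr of_int (int J) = (2::real) ^ J" by (simp add: powr_realpow)
  have "L2_inner g (wavelet \<phi> (int J) n) = (LINT x|lborel. of_real ?c * (g x * cnj (\<phi> (2 ^ J * x + of_int n))))"
    unfolding L2_inner_Cc[OF assms Cc_wavelet[OF \<phi>_Cc]] wavelet_def pow by (simp add: mult.left_commute)
  also have "\<dots> = of_real ?c * (LINT x|lborel. g x * cnj (\<phi> (2 ^ J * x + of_int n)))" by simp
  also have "(LINT x|lborel. g x * cnj (\<phi> (2 ^ J * x + of_int n)))
     = (1 / 2 ^ J) *\<^sub>R (LINT y|lborel. g (- of_int n / 2 ^ J + 1 / 2 ^ J * y) * cnj (\<phi> (2 ^ J * (- of_int n / 2 ^ J + 1 / 2 ^ J * y) + of_int n)))"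
    using lborel_integral_real_affine[of "1 / 2 ^ J" "\<lambda>x. g x * cnj (\<phi> (2 ^ J * x + of_int n))" "- of_int n / 2 ^ J"] by simp
  also have "(\<lambda>y. g (- of_int n / 2 ^ J + 1 / 2 ^ J * y) * cnj (\<phi> (2 ^ J * (- of_int n / 2 ^ J + 1 / 2 ^ J * y) + of_int n)))
     = (\<lambda>y. g ((y + of_int (- n)) / 2 ^ J) * cnj (\<phi> y))"
  proof
    fix y :: real
    have 1: "- of_int n / 2 ^ J + 1 / 2 ^ J * y = (y + of_int (- n)) / 2 ^ J" by (simp add: add_divide_distrib diff_divide_distrib)
    have 2: "2 ^ J * ((y + of_int (- n)) / 2 ^ J) + of_int n = y" by simp
    show "g (- of_int n / 2 ^ J + 1 / 2 ^ J * y) * cnj (\<phi> (2 ^ J * (- of_int n / 2 ^ J + 1 / 2 ^ J * y) + of_int n))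
      = g ((y + of_int (- n)) / 2 ^ J) * cnj (\<phi> y)" unfolding 1 2 ..
  qed
  finally have "L2_inner g (wavelet \<phi> (int J) n) = of_real ?c * ((1 / 2 ^ J) *\<^sub>R average g J (- n))"
    unfolding average_def .
  then have "(cmod (L2_inner g (wavelet \<phi> (int J) n)))\<^sup>2 = (?c * ?c) * (1 / 2 ^ J)\<^sup>2 * (cmod (average g J (- n)))\<^sup>2"
    by (simp add: norm_mult power2_eq_square)
  also have "?c * ?c = 2 ^ J" unfolding two_powr_half_sq pow ..
  finally show ?thesis by (simp add: power2_eq_square)
qed

lemma energy_integral:
  assumes "g \<in> Cc"
  shows "energy g 0 (int J) = (LINT x::real|lborel. (cmod (average g J \<lfloor>2 ^ J * x\<rfloor>))\<^sup>2)"
proof -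
  let ?a = "\<lambda>n. L2_inner g (wavelet \<phi> (int J) n)"
  define S where "S = uminus ` {n. ?a n \<noteq> 0}"
  have S: "finite S" unfolding S_def by (intro finite_imageI L2_inner_wavelet_finite_support assms \<phi>_Cc)
  have "(cmod (average g J k))\<^sup>2 = 0" if "k \<notin> S" for k
  proof -
    have "?a (- k) = 0" using that by (force simp: S_def image_iff)
    then show ?thesis using cmod_inner_average[OF assms, of J "- k"] by simp
  qed
  then have "(LINT x::real|lborel. (cmod (average g J \<lfloor>2 ^ J * x\<rfloor>))\<^sup>2) = (1 / 2 ^ J) *\<^sub>R (\<Sum>k\<in>S. (cmod (average g J k))\<^sup>2)"
    by (intro integral_dyadic_step[OF S, of "\<lambda>k. (cmod (average g J k))\<^sup>2"]) auto
  also have "\<dots> = (\<Sum>n | ?a n \<noteq> 0. (1 / 2 ^ J) * (cmod (average g J (- n)))\<^sup>2)"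
    unfolding S_def by (subst sum.reindex) (auto simp: sum_distrib_left)
  also have "\<dots> = energy g 0 (int J)"
    unfolding energy_def gen_0 cmod_inner_average[OF assms] ..
  finally show ?thesis ..
qed

lemma floor_dyadic_tendsto: "(\<lambda>J. (y + of_int \<lfloor>2 ^ J * x\<rfloor>) / 2 ^ J) \<longlonglongrightarrow> x" for x y :: real
proof -
  have 0: "(\<lambda>J. c * (1/2) ^ J) \<longlonglongrightarrow> 0" for c :: real
    by (intro tendsto_mult_right_zero LIMSEQ_realpow_zero) auto
  have lim: "(\<lambda>J. x + c * (1/2) ^ J) \<longlonglongrightarrow> x" for c :: real
    using tendsto_add[OF tendsto_const[of x] 0[of c]] by simp
  have lo: "x + (y - 1) * (1/2) ^ J \<le> (y + of_int \<lfloor>2 ^ J * x\<rfloor>) / 2 ^ J" for J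
  proof -
    have "2 ^ J * x - 1 \<le> of_int \<lfloor>2 ^ J * x\<rfloor>" by linarith
    then have "(y + (2 ^ J * x - 1)) / 2 ^ J \<le> (y + of_int \<lfloor>2 ^ J * x\<rfloor>) / 2 ^ J" by (intro divide_right_mono) auto
    then show ?thesis by (simp add: add_divide_distrib diff_divide_distrib power_divide)
  qed
  have up: "(y + of_int \<lfloor>2 ^ J * x\<rfloor>) / 2 ^ J \<le> x + y * (1/2) ^ J" for J
  proof -
    have "(y + of_int \<lfloor>2 ^ J * x\<rfloor>) / 2 ^ J \<le> (y + 2 ^ J * x) / 2 ^ J" by (intro divide_right_mono) auto
    then show ?thesis by (simp add: add_divide_distrib power_divide)
  qed
  show ?thesis
  proof (rule tendsto_sandwich)
    show "(\<lambda>J. x + (y - 1) * (1/2) ^ J) \<longlonglongrightarrow> x" by (rule lim)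
    show "(\<lambda>J. x + y * (1/2) ^ J) \<longlonglongrightarrow> x" by (rule lim)
  qed (intro always_eventually allI lo up)+
qed

lemma average_tendsto:
  assumes "g \<in> Cc"
  shows "(\<lambda>J. average g J \<lfloor>2 ^ J * x\<rfloor>) \<longlonglongrightarrow> g x"
proof -
  obtain B where B: "B > 0" "\<And>x. cmod (g x) \<le> B" by (rule Cc_bounded[OF assms]) (rule that)
  have [measurable]: "g \<in> borel_measurable borel" "\<phi> \<in> borel_measurable borel" "(\<lambda>y. cnj (\<phi> y)) \<in> borel_measurable borel"
    by (intro Cc_measurable assms \<phi>_Cc Cc_cnj)+
  have "isCont g x" for x using Cc_continuous[OF assms, of UNIV] by (simp add: continuous_on_eq_continuous_at)
  then have "(\<lambda>J. g ((y + of_int \<lfloor>2 ^ J * x\<rfloor>) / 2 ^ J)) \<longlonglongrightarrow> g x" for y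
    using floor_dyadic_tendsto by (rule isCont_tendsto_compose)
  then have "(\<lambda>J. LINT y|lborel. g ((y + of_int \<lfloor>2 ^ J * x\<rfloor>) / 2 ^ J) * cnj (\<phi> y))
     \<longlonglongrightarrow> (LINT y|lborel. g x * cnj (\<phi> y))"
    using B by (intro integral_dominated_convergence[where w = "\<lambda>y. B * cmod (\<phi> y)"])
       (auto simp: norm_mult intro!: tendsto_intros mult_right_mono integrable_mult_right Cc_norm_integrable \<phi>_Cc)
  moreover have "(LINT y|lborel. g x * cnj (\<phi> y)) = g x"
    using integral_one by simp
  ultimately show ?thesis unfolding average_def by (simp only:)
qed

lemma energy_tendsto:
  assumes "g \<in> Cc"
  shows "(\<lambda>J. energy g 0 (int J)) \<longlonglongrightarrow> (LINT x|lborel. (cmod (g x))\<^sup>2)"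
proof -
  obtain R where R: "R > 0" "\<And>x. R < \<bar>x\<bar> \<Longrightarrow> g x = 0" by (rule Cc_support[OF assms]) (rule that)
  obtain L where L: "L > 0" "\<And>x. L < \<bar>x\<bar> \<Longrightarrow> \<phi> x = 0" by (rule Cc_support[OF \<phi>_Cc]) (rule that)
  obtain B where B: "B > 0" "\<And>x. cmod (g x) \<le> B" by (rule Cc_bounded[OF assms]) (rule that)
  have [measurable]: "g \<in> borel_measurable borel" "\<phi> \<in> borel_measurable borel" "(\<lambda>y. cnj (\<phi> y)) \<in> borel_measurable borel"
    by (intro Cc_measurable assms \<phi>_Cc Cc_cnj)+
  define M where "M = (LINT y|lborel. B * cmod (\<phi> y))"
  have M: "cmod (average g J k) \<le> M" for J k
    unfolding average_def M_def
  proof (rule Bochner_Integration.integral_norm_bound_integral)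
    show dom: "integrable lborel (\<lambda>y. B * cmod (\<phi> y))"
      by (intro integrable_mult_right Cc_norm_integrable \<phi>_Cc)
    show bd: "norm (g ((y + of_int k) / 2 ^ J) * cnj (\<phi> y)) \<le> B * cmod (\<phi> y)" for y
      using B by (simp add: norm_mult mult_right_mono)
    show "integrable lborel (\<lambda>y. g ((y + of_int k) / 2 ^ J) * cnj (\<phi> y))"
      by (rule Bochner_Integration.integrable_bound[OF dom]) (use bd B in auto)
  qed
  have zero: "average g J \<lfloor>2 ^ J * x\<rfloor> = 0" if x: "\<bar>x\<bar> > R + L + 1" for J and x :: real
  proof -
    have "g ((y + of_int \<lfloor>2 ^ J * x\<rfloor>) / 2 ^ J) * cnj (\<phi> y) = 0" for y
    proof (cases "L < \<bar>y\<bar>")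
      case False
      have "2 ^ J * (R + L + 1) < 2 ^ J * \<bar>x\<bar>" using x by (intro mult_strict_left_mono) auto
      moreover have "2 ^ J * \<bar>x\<bar> = \<bar>2 ^ J * x\<bar>" by (simp add: abs_mult)
      moreover have "1 * (L + 1) \<le> 2 ^ J * (L + 1)" using L(1) by (intro mult_right_mono) auto
      moreover have "\<bar>2 ^ J * x\<bar> \<le> \<bar>of_int \<lfloor>2 ^ J * x\<rfloor>\<bar> + 1" by linarith
      ultimately have "2 ^ J * R < \<bar>y + of_int \<lfloor>2 ^ J * x\<rfloor>\<bar>" using False by (simp add: algebra_simps)
      then have "R < \<bar>(y + of_int \<lfloor>2 ^ J * x\<rfloor>) / 2 ^ J\<bar>" by (simp add: pos_less_divide_eq mult.commute)
      then show ?thesis using R(2) by simp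
    qed (simp add: L(2))
    then show ?thesis unfolding average_def by (simp only: Bochner_Integration.integral_zero)
  qed
  have "(\<lambda>J. LINT x::real|lborel. (cmod (average g J \<lfloor>2 ^ J * x\<rfloor>))\<^sup>2) \<longlonglongrightarrow> (LINT x|lborel. (cmod (g x))\<^sup>2)"
  proof (rule integral_dominated_convergence)
    show "integrable lborel (\<lambda>x. indicator {- (R + L + 1)..R + L + 1} x *\<^sub>R M\<^sup>2)"
      by (intro integrable_scaleR_left integrable_real_indicator) (auto simp: emeasure_lborel_Icc_eq)
    show "AE x in lborel. norm ((cmod (average g J \<lfloor>2 ^ J * x\<rfloor>))\<^sup>2) \<le> indicator {- (R + L + 1)..R + L + 1} x *\<^sub>R M\<^sup>2" for J
    proof (intro always_eventually allI)
      fix x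
      show "norm ((cmod (average g J \<lfloor>2 ^ J * x\<rfloor>))\<^sup>2) \<le> indicator {- (R + L + 1)..R + L + 1} x *\<^sub>R M\<^sup>2"
      proof (cases "\<bar>x\<bar> > R + L + 1")
        case True
        then show ?thesis using zero[of x J] by simp
      next
        case False
        then have "x \<in> {- (R + L + 1)..R + L + 1}" by (simp add: abs_le_iff not_less)
        then show ?thesis using power_mono[OF M[of J "\<lfloor>2 ^ J * x\<rfloor>"] norm_ge_zero, of 2] by simp
      qed
    qed
    show "(\<lambda>x::real. (cmod (average g J \<lfloor>2 ^ J * x\<rfloor>))\<^sup>2) \<in> borel_measurable lborel" for J
    proof -
      have "(\<lambda>x::real. (cmod (average g J \<lfloor>2 ^ J * x\<rfloor>))\<^sup>2) = (\<lambda>k. (cmod (average g J k))\<^sup>2) \<circ> (\<lambda>x. \<lfloor>2 ^ J * x\<rfloor>)"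
        by auto
      then show ?thesis by simp
    qed
    show "AE x in lborel. (\<lambda>J. (cmod (average g J \<lfloor>2 ^ J * x\<rfloor>))\<^sup>2) \<longlonglongrightarrow> (cmod (g x))\<^sup>2"
      by (intro always_eventually allI tendsto_intros average_tendsto assms)
  qed simp
  then show ?thesis by (simp only: energy_integral[OF assms])
qed

text \<open>
  At level \<open>-J\<close> a bounded number of coefficients is nonzero, each of size \<open>O(2\<^sup>-\<^sup>J\<^sup>/\<^sup>2)\<close>.
\<close>

lemma energy_tendsto_0:
  assumes "g \<in> Cc"
  shows "(\<lambda>J. energy g 0 (- int J)) \<longlonglongrightarrow> 0"
proof -
  obtain R where R: "R > 0" "\<And>x. R < \<bar>x\<bar> \<Longrightarrow> g x = 0" by (rule Cc_support[OF assms]) (rule that)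
  obtain L where L: "L > 0" "\<And>x. L < \<bar>x\<bar> \<Longrightarrow> \<phi> x = 0" by (rule Cc_support[OF \<phi>_Cc]) (rule that)
  obtain B where B: "B > 0" "\<And>x. cmod (\<phi> x) \<le> B" by (rule Cc_bounded[OF \<phi>_Cc]) (rule that)
  define N where "N = \<lceil>L + R\<rceil>"
  define G where "G = (LINT x|lborel. B * cmod (g x))"
  have bound: "energy g 0 (- int J) \<le> (real (card {-N..N}) * G\<^sup>2) * (1/2) ^ J" for J
  proof -
    let ?a = "\<lambda>n. L2_inner g (wavelet \<phi> (- int J) n)"
    let ?c = "2 powr (of_int (- int J) / 2) :: real"
    have pow: "2 powr of_int (- int J) = ((1/2)::real) ^ J"
      by (simp add: powr_minus powr_realpow power_one_over inverse_eq_divide)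
    have "?a n = 0" if "n \<notin> {-N..N}" for n
    proof (rule L2_inner_wavelet_eq_0[where R = R and L = L])
      have "(1/2) ^ J * R \<le> 1 * R" using R(1) by (intro mult_right_mono power_le_one) auto
      moreover have "L + R < \<bar>of_int n\<bar>"
      proof -
        have "N < \<bar>n\<bar>" using that by auto
        then have "of_int N < \<bar>real_of_int n\<bar>" by linarith
        moreover have "L + R \<le> of_int N" unfolding N_def by (rule le_of_int_ceiling)
        ultimately show ?thesis by linarith
      qed
      ultimately show "L + 2 powr of_int (- int J) * R < \<bar>of_int n\<bar>" unfolding pow by linarith
    qed (use R(2) L(2) in auto)
    then have "energy g 0 (- int J) = (\<Sum>n\<in>{-N..N}. (cmod (?a n))\<^sup>2)"
      using energy_superset[of "{-N..N}" g 0 "- int J"] by (simp add: gen_0)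
    also have "\<dots> \<le> (\<Sum>n\<in>{-N..N}. G\<^sup>2 * (1/2) ^ J)"
    proof (rule sum_mono)
      fix n
      have bd: "norm (g x * cnj (wavelet \<phi> (- int J) n x)) \<le> ?c * (B * cmod (g x))" for x
      proof -
        have "norm (g x * cnj (wavelet \<phi> (- int J) n x))
          = cmod (g x) * (?c * cmod (\<phi> (2 powr of_int (- int J) * x + of_int n)))"
          by (simp add: wavelet_def norm_mult)
        also have "\<dots> \<le> cmod (g x) * (?c * B)" by (intro mult_left_mono B) auto
        finally show ?thesis by (simp add: ac_simps)
      qed
      have "cmod (?a n) \<le> (LINT x|lborel. ?c * (B * cmod (g x)))"
        unfolding L2_inner_Cc[OF assms Cc_wavelet[OF \<phi>_Cc]]
        by (intro Bochner_Integration.integral_norm_bound_integral bd integrable_mult_right Cc_norm_integrable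
            Cc_integrable Cc_mult_left Cc_continuous Cc_cnj Cc_wavelet \<phi>_Cc assms)
      also have "\<dots> = ?c * G" unfolding G_def by simp
      finally have "(cmod (?a n))\<^sup>2 \<le> (?c * G)\<^sup>2" by (intro power_mono) auto
      also have "\<dots> = G\<^sup>2 * (?c * ?c)" by (simp only: power2_eq_square ac_simps)
      also have "?c * ?c = (1/2) ^ J" unfolding two_powr_half_sq pow ..
      finally show "(cmod (?a n))\<^sup>2 \<le> G\<^sup>2 * (1/2) ^ J" .
    qed
    also have "\<dots> = (real (card {-N..N}) * G\<^sup>2) * (1/2) ^ J" by (simp only: sum_constant mult.assoc)
    finally show ?thesis .
  qed
  have "(\<lambda>J. (real (card {-N..N}) * G\<^sup>2) * (1/2) ^ J) \<longlonglongrightarrow> 0"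
    by (intro tendsto_mult_right_zero LIMSEQ_realpow_zero) auto
  then show ?thesis
    by (rule tendsto_sandwich[OF _ _ tendsto_const, rotated 2])
       (use bound energy_nonneg in \<open>auto intro: always_eventually\<close>)
qed

definition index_block :: "(real \<Rightarrow> complex) \<Rightarrow> nat \<Rightarrow> (nat \<times> int \<times> int) set" where
  "index_block g J = (SIGMA r:{1..q}. SIGMA j:{- int J..<int J}. {k. L2_inner g (wavelet (gen r) j k) \<noteq> 0})"

lemma finite_index_block: "g \<in> Cc \<Longrightarrow> finite (index_block g J)"
  unfolding index_block_def by (intro finite_SigmaI L2_inner_wavelet_finite_support gen_Cc) auto

lemma index_block_energy:
  assumes "g \<in> Cc"
  shows "(\<Sum>(r, j, k)\<in>index_block g J. (cmod (L2_inner g (wavelet (gen r) j k)))\<^sup>2)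
    = energy g 0 (int J) - energy g 0 (- int J)"
proof -
  have fin: "finite {k. L2_inner g (wavelet (gen r) j k) \<noteq> 0}" for r j
    by (intro L2_inner_wavelet_finite_support gen_Cc assms)
  have "(\<Sum>(r, j, k)\<in>index_block g J. (cmod (L2_inner g (wavelet (gen r) j k)))\<^sup>2)
     = (\<Sum>r=1..q. \<Sum>(j, k)\<in>(SIGMA j:{- int J..<int J}. {k. L2_inner g (wavelet (gen r) j k) \<noteq> 0}).
          (cmod (L2_inner g (wavelet (gen r) j k)))\<^sup>2)"
    unfolding index_block_def by (subst sum.Sigma) (auto intro!: finite_SigmaI fin)
  also have "\<dots> = (\<Sum>r=1..q. \<Sum>j\<in>{- int J..<int J}. energy g r j)"
    unfolding energy_def by (intro sum.cong refl) (subst sum.Sigma, auto intro!: fin)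
  also have "\<dots> = (\<Sum>j\<in>{- int J..<int J}. \<Sum>r=1..q. energy g r j)" by (rule sum.swap)
  also have "\<dots> = energy g 0 (int J) - energy g 0 (- int J)"
    by (rule energy_telescope[OF assms, symmetric]) simp
  finally show ?thesis .
qed

text \<open>
  A finite set of indices lies in a block of levels, apart from vanishing terms, and the sum over a
  block is the difference of the energies at its two ends.
\<close>

lemma Cc_bessel:
  assumes "g \<in> Cc" "finite F" "F \<subseteq> {1..q} \<times> UNIV \<times> UNIV"
  shows "(\<Sum>(r, j, k)\<in>F. (cmod (L2_inner g (wavelet (gen r) j k)))\<^sup>2) \<le> (LINT x|lborel. (cmod (g x))\<^sup>2)"
proof -
  have "finite ((\<lambda>(r, j, k). nat \<bar>j\<bar>) ` F)" using assms(2) by simp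
  then obtain N where N: "\<And>r j k. (r, j, k) \<in> F \<Longrightarrow> nat \<bar>j\<bar> \<le> N"
    unfolding finite_nat_set_iff_bounded_le by fastforce
  define J where "J = Suc N"
  have mono: "energy g 0 (int a) \<le> energy g 0 (int b)" if "a \<le> b" for a b
  proof -
    have "0 \<le> energy g 0 (int b) - energy g 0 (int a)"
      unfolding energy_telescope[OF assms(1), of "int a" "int b", OF zle_int[THEN iffD2, OF that]]
      by (intro sum_nonneg energy_nonneg)
    then show ?thesis by simp
  qed
  let ?e = "\<lambda>(r, j, k). (cmod (L2_inner g (wavelet (gen r) j k)))\<^sup>2"
  have "sum ?e F = sum ?e (F \<inter> index_block g J)"
  proof (rule sum.mono_neutral_right[OF assms(2)])
    show "\<forall>i\<in>F - F \<inter> index_block g J. ?e i = 0"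
    proof
      fix i assume i: "i \<in> F - F \<inter> index_block g J"
      obtain r j k where rjk: "i = (r, j, k)" by (cases i) auto
      have "\<bar>j\<bar> \<le> int N" using N[of r j k] i rjk by auto
      then have "j \<in> {- int J..<int J}" unfolding J_def by auto
      then show "?e i = 0" using i assms(3) rjk by (auto simp: index_block_def)
    qed
  qed auto
  also have "\<dots> \<le> sum ?e (index_block g J)"
    by (rule sum_mono2[OF finite_index_block[OF assms(1)]]) auto
  also have "\<dots> = energy g 0 (int J) - energy g 0 (- int J)" by (rule index_block_energy[OF assms(1)])
  also have "\<dots> \<le> energy g 0 (int J)" using energy_nonneg by simp
  also have "\<dots> \<le> (LINT x|lborel. (cmod (g x))\<^sup>2)"
    by (rule LIMSEQ_le_const[OF energy_tendsto[OF assms(1)]]) (use mono in blast)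
  finally show ?thesis .
qed

lemma Cc_parseval:
  assumes "g \<in> Cc" "e > 0"
  obtains F where "finite F" "F \<subseteq> {1..q} \<times> UNIV \<times> UNIV"
    "(LINT x|lborel. (cmod (g x))\<^sup>2) - e < (\<Sum>(r, j, k)\<in>F. (cmod (L2_inner g (wavelet (gen r) j k)))\<^sup>2)"
proof -
  have "(\<lambda>J. energy g 0 (int J) - energy g 0 (- int J)) \<longlonglongrightarrow> (LINT x|lborel. (cmod (g x))\<^sup>2) - 0"
    by (intro tendsto_diff energy_tendsto energy_tendsto_0 assms)
  then have "\<forall>\<^sub>F J in sequentially. (LINT x|lborel. (cmod (g x))\<^sup>2) - e < energy g 0 (int J) - energy g 0 (- int J)"
    by (rule order_tendstoD) (use assms(2) in simp)
  then obtain J where "(LINT x|lborel. (cmod (g x))\<^sup>2) - e < energy g 0 (int J) - energy g 0 (- int J)"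
    by (auto simp: eventually_sequentially)
  then show ?thesis
    using finite_index_block[OF assms(1), of J] index_block_energy[OF assms(1), of J]
    by (intro that[of "index_block g J"]) (auto simp: index_block_def)
qed

end

section \<open>Density of continuous functions and the Parseval frame\<close>

lemma L2_R_diff:
  assumes "g \<in> L2_R" "h \<in> L2_R"
  shows "(\<lambda>x. g x - h x) \<in> L2_R"
proof -
  have [measurable]: "g \<in> borel_measurable lebesgue" "h \<in> borel_measurable lebesgue"
    using assms by (auto simp: L2_R_def)
  have "integrable lebesgue (\<lambda>x. 2 * (cmod (g x))\<^sup>2 + 2 * (cmod (h x))\<^sup>2)"
    using assms by (auto simp: L2_R_def)
  then have "integrable lebesgue (\<lambda>x. (cmod (g x - h x))\<^sup>2)"
  proof (rule Bochner_Integration.integrable_bound)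
    show "AE x in lebesgue. norm ((cmod (g x - h x))\<^sup>2) \<le> norm (2 * (cmod (g x))\<^sup>2 + 2 * (cmod (h x))\<^sup>2)"
    proof (intro always_eventually allI)
      fix x
      have "(cmod (g x - h x))\<^sup>2 \<le> (cmod (g x) + cmod (h x))\<^sup>2"
        by (intro power_mono norm_triangle_ineq4) auto
      also have "\<dots> \<le> 2 * (cmod (g x))\<^sup>2 + 2 * (cmod (h x))\<^sup>2"
        using zero_le_power2[of "cmod (g x) - cmod (h x)"] by (simp add: power2_eq_square algebra_simps)
      finally show "norm ((cmod (g x - h x))\<^sup>2) \<le> norm (2 * (cmod (g x))\<^sup>2 + 2 * (cmod (h x))\<^sup>2)" by simp
    qed
  qed measurable
  then show ?thesis unfolding L2_R_def by simp
qed

lemma L2_R_inner_integrable: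
  assumes "g \<in> L2_R" "h \<in> L2_R"
  shows "integrable lebesgue (\<lambda>x. g x * cnj (h x))"
proof -
  have [measurable]: "g \<in> borel_measurable lebesgue" "h \<in> borel_measurable lebesgue"
    using assms by (auto simp: L2_R_def)
  have [measurable]: "(\<lambda>x. cnj (h x)) \<in> borel_measurable lebesgue"
    by (rule borel_measurable_continuous_on[of cnj]) (auto intro: continuous_intros)
  have "integrable lebesgue (\<lambda>x. (cmod (g x))\<^sup>2 + (cmod (h x))\<^sup>2)"
    using assms by (auto simp: L2_R_def)
  then show ?thesis
  proof (rule Bochner_Integration.integrable_bound)
    show "AE x in lebesgue. norm (g x * cnj (h x)) \<le> norm ((cmod (g x))\<^sup>2 + (cmod (h x))\<^sup>2)"
    proof (intro always_eventually allI)
      fix x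
      have "2 * (cmod (g x) * cmod (h x)) \<le> (cmod (g x))\<^sup>2 + (cmod (h x))\<^sup>2"
        using zero_le_power2[of "cmod (g x) - cmod (h x)"] by (simp add: power2_eq_square algebra_simps)
      moreover have "0 \<le> cmod (g x) * cmod (h x)" by simp
      ultimately have "cmod (g x) * cmod (h x) \<le> (cmod (g x))\<^sup>2 + (cmod (h x))\<^sup>2" by linarith
      then show "norm (g x * cnj (h x)) \<le> norm ((cmod (g x))\<^sup>2 + (cmod (h x))\<^sup>2)" by (simp add: norm_mult)
    qed
  qed measurable
qed

definition L2_sq :: "(real \<Rightarrow> complex) \<Rightarrow> real" where
  "L2_sq g = (LINT x|lebesgue. (cmod (g x))\<^sup>2)"

lemma L2_sq_nonneg: "L2_sq g \<ge> 0"
  unfolding L2_sq_def by (rule integral_nonneg_AE) simp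

lemma L2_norm_sq: "(L2_norm g)\<^sup>2 = L2_sq g"
  using L2_sq_nonneg[of g] by (simp add: L2_norm_def L2_sq_def)

lemma L2_sq_Cc: "g \<in> Cc \<Longrightarrow> L2_sq g = (LINT x|lborel. (cmod (g x))\<^sup>2)"
  using Cc_L2_norm L2_norm_sq by metis

text \<open>
  The parameter \<open>t\<close> makes the bound linear in squares, so that it can be integrated and summed; this
  does the work of the triangle inequality for the norms.
\<close>

lemma sq_diff_bound:
  fixes a b :: complex
  assumes "t > 0"
  shows "\<bar>(cmod b)\<^sup>2 - (cmod a)\<^sup>2\<bar> \<le> t * (cmod a)\<^sup>2 + (1 + 1 / t) * (cmod (a - b))\<^sup>2"
proof -
  define x where "x = cmod a"
  define d where "d = cmod (a - b)"
  have d: "0 \<le> d" "0 \<le> x" by (simp_all add: d_def x_def)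
  have 1: "\<bar>cmod b - x\<bar> \<le> d" unfolding x_def d_def
    using norm_triangle_ineq3[of b a] by (simp add: norm_minus_commute)
  have "cmod b + x \<le> 2 * x + d" using 1 by linarith
  have "\<bar>(cmod b)\<^sup>2 - x\<^sup>2\<bar> = \<bar>cmod b - x\<bar> * (cmod b + x)"
    using d by (simp add: power2_eq_square square_diff_square_factored abs_mult mult.commute)
  also have "\<dots> \<le> d * (2 * x + d)"
    using 1 \<open>cmod b + x \<le> 2 * x + d\<close> d by (intro mult_mono) (auto simp: x_def)
  also have "\<dots> \<le> t * x\<^sup>2 + (1 + 1 / t) * d\<^sup>2"
  proof -
    have "0 \<le> (t * x - d)\<^sup>2 / t" using assms by simp
    also have "(t * x - d)\<^sup>2 / t = t * x\<^sup>2 - 2 * x * d + d\<^sup>2 / t"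
      using assms by (simp add: power2_eq_square field_simps)
    finally show ?thesis by (simp add: power2_eq_square algebra_simps)
  qed
  finally show ?thesis by (simp add: x_def d_def)
qed

lemma L2_sq_diff_bound:
  assumes "g \<in> L2_R" "h \<in> L2_R" "t > 0"
  shows "\<bar>L2_sq h - L2_sq g\<bar> \<le> t * L2_sq g + (1 + 1 / t) * L2_sq (\<lambda>x. g x - h x)"
proof -
  have int: "integrable lebesgue (\<lambda>x. (cmod (u x))\<^sup>2)" if "u \<in> L2_R" for u using that by (simp add: L2_R_def)
  note i = int[OF assms(1)] int[OF assms(2)] int[OF L2_R_diff[OF assms(1,2)]]
  have "\<bar>L2_sq h - L2_sq g\<bar> = \<bar>LINT x|lebesgue. (cmod (h x))\<^sup>2 - (cmod (g x))\<^sup>2\<bar>"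
    unfolding L2_sq_def by (subst Bochner_Integration.integral_diff[OF i(2,1)]) simp
  also have "\<dots> \<le> (LINT x|lebesgue. \<bar>(cmod (h x))\<^sup>2 - (cmod (g x))\<^sup>2\<bar>)"
    by (rule integral_abs_bound)
  also have "\<dots> \<le> (LINT x|lebesgue. t * (cmod (g x))\<^sup>2 + (1 + 1 / t) * (cmod (g x - h x))\<^sup>2)"
    using i by (intro integral_mono sq_diff_bound assms(3)) auto
  also have "\<dots> = t * L2_sq g + (1 + 1 / t) * L2_sq (\<lambda>x. g x - h x)"
    unfolding L2_sq_def using i by simp
  finally show ?thesis .
qed

lemma sum_sq_diff_bound:
  assumes "t > 0"
  shows "(\<Sum>i\<in>F. (cmod (b i))\<^sup>2) \<le> (\<Sum>i\<in>F. (cmod (a i))\<^sup>2) + t * (\<Sum>i\<in>F. (cmod (a i))\<^sup>2)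
     + (1 + 1 / t) * (\<Sum>i\<in>F. (cmod (a i - b i :: complex))\<^sup>2)"
proof -
  have "(cmod (b i))\<^sup>2 \<le> (cmod (a i))\<^sup>2 + t * (cmod (a i))\<^sup>2 + (1 + 1 / t) * (cmod (a i - b i))\<^sup>2" for i
    using sq_diff_bound[OF assms, of "b i" "a i"] by linarith
  then have "(\<Sum>i\<in>F. (cmod (b i))\<^sup>2) \<le> (\<Sum>i\<in>F. (cmod (a i))\<^sup>2 + t * (cmod (a i))\<^sup>2 + (1 + 1 / t) * (cmod (a i - b i))\<^sup>2)"
    by (intro sum_mono)
  then show ?thesis by (simp only: sum.distrib sum_distrib_left)
qed

lemma L2_inner_diff_left:
  assumes "g \<in> L2_R" "h \<in> L2_R" "w \<in> L2_R"
  shows "L2_inner (\<lambda>x. g x - h x) w = L2_inner g w - L2_inner h w"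
  unfolding L2_inner_def left_diff_distrib
  by (intro Bochner_Integration.integral_diff L2_R_inner_integrable assms)

lemma L2_inner_small:
  assumes "u \<in> L2_R" "w \<in> L2_R" "L2_sq u < \<delta>"
  shows "cmod (L2_inner u w) \<le> sqrt \<delta> * (1 + L2_sq w)"
proof -
  have \<delta>: "\<delta> > 0" using assms(3) L2_sq_nonneg[of u] by linarith
  define t where "t = 1 / sqrt \<delta>"
  have t: "t > 0" "1 / t = sqrt \<delta>" using \<delta> by (simp_all add: t_def)
  have i: "integrable lebesgue (\<lambda>x. (cmod (u x))\<^sup>2)" "integrable lebesgue (\<lambda>x. (cmod (w x))\<^sup>2)"
    using assms by (auto simp: L2_R_def)
  have "cmod (L2_inner u w) \<le> (LINT x|lebesgue. t * (cmod (u x))\<^sup>2 + (1 / t) * (cmod (w x))\<^sup>2)"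
    unfolding L2_inner_def
  proof (rule Bochner_Integration.integral_norm_bound_integral)
    fix x
    have "0 \<le> (t * cmod (u x) - cmod (w x))\<^sup>2 / t" using t by simp
    also have "\<dots> = t * (cmod (u x))\<^sup>2 - 2 * (cmod (u x) * cmod (w x)) + (1 / t) * (cmod (w x))\<^sup>2"
      using t(1) by (simp add: power2_eq_square field_simps)
    finally have "2 * (cmod (u x) * cmod (w x)) \<le> t * (cmod (u x))\<^sup>2 + (1 / t) * (cmod (w x))\<^sup>2" by linarith
    moreover have "0 \<le> cmod (u x) * cmod (w x)" by simp
    ultimately show "norm (u x * cnj (w x)) \<le> t * (cmod (u x))\<^sup>2 + (1 / t) * (cmod (w x))\<^sup>2"
      unfolding norm_mult complex_mod_cnj by linarith
  qed (use i assms in \<open>auto intro: L2_R_inner_integrable\<close>)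
  also have "\<dots> = t * L2_sq u + sqrt \<delta> * L2_sq w"
    unfolding L2_sq_def t(2) using i by simp
  also have "t * L2_sq u \<le> t * \<delta>" using assms(3) t by (intro mult_left_mono) auto
  also have "t * \<delta> = sqrt \<delta>" using \<delta> by (simp add: t_def real_div_sqrt)
  finally show ?thesis by (simp add: algebra_simps)
qed

text \<open>
  Dominated convergence for \<open>g\<close> restricted to the points where both \<open>|x|\<close> and \<open>|g(x)|\<close> are at most \<open>n\<close>.
\<close>

lemma truncation_L2_approx:
  assumes "g \<in> L2_R" "e > 0"
  obtains u B where "u \<in> L2_R" "B > 0" "\<And>x. cmod (u x) \<le> B" "\<And>x. B < \<bar>x\<bar> \<Longrightarrow> u x = 0"
    "L2_sq (\<lambda>x. g x - u x) < e"
proof -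
  have [measurable]: "g \<in> borel_measurable lebesgue" and int: "integrable lebesgue (\<lambda>x. (cmod (g x))\<^sup>2)"
    using assms by (auto simp: L2_R_def)
  define X where "X = (\<lambda>n::nat. {x. \<bar>x\<bar> \<le> real n \<and> cmod (g x) \<le> real n})"
  define u where "u = (\<lambda>n x. indicator (X n) x *\<^sub>R g x)"
  have [measurable]: "X n \<in> sets lebesgue" for n
  proof -
    have "X n = {x \<in> space lebesgue. \<bar>x\<bar> \<le> real n \<and> cmod (g x) \<le> real n}" by (simp add: X_def)
    also have "\<dots> \<in> sets lebesgue"
    proof (rule sets.sets_Collect_conj)
      have "{x::real. \<bar>x\<bar> \<le> real n} = {- real n..real n}" by auto
      then show "{x \<in> space lebesgue. \<bar>x\<bar> \<le> real n} \<in> sets lebesgue" by simp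
      show "{x \<in> space lebesgue. cmod (g x) \<le> real n} \<in> sets lebesgue" by measurable
    qed
    finally show ?thesis .
  qed
  have meas: "u n \<in> borel_measurable lebesgue" for n unfolding u_def by measurable
  have "(\<lambda>n. LINT x|lebesgue. (cmod (g x - u n x))\<^sup>2) \<longlonglongrightarrow> (LINT x::real|lebesgue. 0)"
  proof (rule integral_dominated_convergence)
    show "integrable lebesgue (\<lambda>x. (cmod (g x))\<^sup>2)" by (rule int)
    show "(\<lambda>x. (cmod (g x - u n x))\<^sup>2) \<in> borel_measurable lebesgue" for n using meas[of n] by measurable
    show "AE x in lebesgue. (\<lambda>n. (cmod (g x - u n x))\<^sup>2) \<longlonglongrightarrow> 0"
    proof (intro AE_I2 tendsto_eventually)
      fix x
      obtain N :: nat where N: "max \<bar>x\<bar> (cmod (g x)) \<le> real N" using real_arch_simple by blast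
      have "(cmod (g x - u n x))\<^sup>2 = 0" if "n \<ge> N" for n
      proof -
        have "real N \<le> real n" using that by simp
        then have "\<bar>x\<bar> \<le> real n" "cmod (g x) \<le> real n" using N by linarith+
        then show ?thesis by (simp add: u_def X_def)
      qed
      then show "\<forall>\<^sub>F n in sequentially. (cmod (g x - u n x))\<^sup>2 = 0" by (auto simp: eventually_sequentially)
    qed
    show "AE x in lebesgue. norm ((cmod (g x - u n x))\<^sup>2) \<le> (cmod (g x))\<^sup>2" for n
      by (intro always_eventually allI) (simp add: u_def indicator_def)
  qed simp
  then have "(\<lambda>n. L2_sq (\<lambda>x. g x - u n x)) \<longlonglongrightarrow> 0" by (simp add: L2_sq_def)
  then have "\<forall>\<^sub>F n in sequentially. L2_sq (\<lambda>x. g x - u n x) < e"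
    by (rule order_tendstoD) (rule assms(2))
  then obtain n where n: "L2_sq (\<lambda>x. g x - u n x) < e" by (auto simp: eventually_sequentially)
  show ?thesis
  proof (rule that[of "u n" "real n + 1"])
    have "integrable lebesgue (\<lambda>x. (cmod (u n x))\<^sup>2)"
      by (rule Bochner_Integration.integrable_bound[OF int]) (use meas[of n] in \<open>auto simp: u_def indicator_def\<close>)
    then show "u n \<in> L2_R" using meas by (simp add: L2_R_def)
    show "cmod (u n x) \<le> real n + 1" for x by (auto simp: u_def X_def indicator_def)
    show "u n x = 0" if "real n + 1 < \<bar>x\<bar>" for x using that by (auto simp: u_def X_def indicator_def)
  qed (use n in auto)
qed

text \<open>
  A measurable function is almost everywhere a limit of continuous ones; radial clipping and a
  cutoff make these dominated, without changing the limit of a bounded function of bounded support.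
\<close>

lemma Cc_dense:
  assumes "g \<in> L2_R" "e > 0"
  obtains h where "h \<in> Cc" "L2_sq (\<lambda>x. g x - h x) < e"
proof -
  obtain u B where u: "u \<in> L2_R" "B > 0" "\<And>x. cmod (u x) \<le> B" "\<And>x. B < \<bar>x\<bar> \<Longrightarrow> u x = 0"
    "L2_sq (\<lambda>x. g x - u x) < e / 4"
    by (rule truncation_L2_approx[OF assms(1), of "e / 4"]) (use assms(2) in simp, rule that)
  have [measurable]: "u \<in> borel_measurable lebesgue" using u(1) by (simp add: L2_R_def)
  have "u measurable_on UNIV" 
    by (rule lebesgue_measurable_imp_measurable_on) (use sets.top[of "lebesgue :: real measure"] in simp_all)
  then obtain N f where N: "negligible N" and f: "\<And>n. continuous_on UNIV (f n)"
    "\<And>x. x \<notin> N \<Longrightarrow> (\<lambda>n. f n x) \<longlonglongrightarrow> u x"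
    unfolding measurable_on_def by auto
  define clip where "clip = (\<lambda>z::complex. z / of_real (max 1 (cmod z / B)))"
  have clip_le: "cmod (clip z) \<le> B" for z
  proof -
    have "cmod z \<le> B * max 1 (cmod z / B)"
    proof -
      have "B * (cmod z / B) \<le> B * max 1 (cmod z / B)" using u(2) by (intro mult_left_mono) auto
      then show ?thesis using u(2) by simp
    qed
    moreover have "max 1 (cmod z / B) > 0" by (simp add: less_max_iff_disj)
    ultimately show ?thesis unfolding clip_def by (simp add: norm_divide pos_divide_le_eq)
  qed
  have clip_id: "clip z = z" if "cmod z \<le> B" for z
  proof -
    have "max 1 (cmod z / B) = 1" using that u(2) by (simp add: max_def)
    then show ?thesis by (simp add: clip_def)
  qed
  have nz: "max 1 (cmod z / B) \<noteq> 0" for z by (metis max.cobounded1 not_one_le_zero)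
  have clip_cont: "continuous_on UNIV clip"
    unfolding clip_def using nz u(2) by (intro continuous_intros) auto
  define \<kappa> where "\<kappa> = (\<lambda>x::real. max 0 (min 1 (B + 1 - \<bar>x\<bar>)))"
  define h where "h = (\<lambda>n x. of_real (\<kappa> x) * clip (f n x))"
  have \<kappa>: "0 \<le> \<kappa> x" "\<kappa> x \<le> 1" "\<bar>x\<bar> \<le> B \<Longrightarrow> \<kappa> x = 1" "B + 1 < \<bar>x\<bar> \<Longrightarrow> \<kappa> x = 0" for x
    by (auto simp: \<kappa>_def)
  have h_Cc: "h n \<in> Cc" for n
    unfolding Cc_def
  proof (intro CollectI conjI exI allI impI)
    show "continuous_on UNIV (h n)" unfolding h_def \<kappa>_def
      by (intro continuous_intros continuous_on_compose2[OF clip_cont f(1)]) auto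
    show "h n x = 0" if "B + 1 < \<bar>x\<bar>" for x using \<kappa>(4)[OF that] by (simp add: h_def)
  qed
  have h_le: "cmod (h n x) \<le> B" for n x
    using mult_mono[OF \<kappa>(2)[of x] clip_le[of "f n x"]] \<kappa>(1)[of x] by (simp add: h_def norm_mult)
  have lim: "(\<lambda>n. h n x) \<longlonglongrightarrow> u x" if "x \<notin> N" for x
  proof -
    have "isCont clip (u x)" using clip_cont by (simp add: continuous_on_eq_continuous_at)
    then have "(\<lambda>n. clip (f n x)) \<longlonglongrightarrow> u x"
      using isCont_tendsto_compose[OF _ f(2)[OF that]] clip_id[OF u(3)] by metis
    then have "(\<lambda>n. of_real (\<kappa> x) * clip (f n x)) \<longlonglongrightarrow> of_real (\<kappa> x) * u x"
      by (intro tendsto_mult tendsto_const)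
    moreover have "of_real (\<kappa> x) * u x = u x"
      using \<kappa>(3)[of x] u(4)[of x] by (cases "\<bar>x\<bar> \<le> B") auto
    ultimately show ?thesis by (simp add: h_def)
  qed
  have "(\<lambda>n. LINT x|lebesgue. (cmod (u x - h n x))\<^sup>2) \<longlonglongrightarrow> (LINT x::real|lebesgue. 0)"
  proof (rule integral_dominated_convergence)
    show "integrable lebesgue (\<lambda>x. indicator {- (B + 1)..B + 1} x *\<^sub>R (2 * B)\<^sup>2)"
      by (intro integrable_scaleR_left integrable_real_indicator) (auto simp: emeasure_lborel_Icc_eq)
    have [measurable]: "h n \<in> borel_measurable lebesgue" for n
      using Cc_L2_R[OF h_Cc[of n]] by (simp add: L2_R_def)
    show "(\<lambda>x. (cmod (u x - h n x))\<^sup>2) \<in> borel_measurable lebesgue" for n by measurable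
    have "AE x in lebesgue. x \<notin> N"
      using N by (intro AE_not_in) (simp add: negligible_iff_null_sets)
    then show "AE x in lebesgue. (\<lambda>n. (cmod (u x - h n x))\<^sup>2) \<longlonglongrightarrow> 0"
    proof eventually_elim
      case (elim x)
      have "(\<lambda>n. (cmod (u x - h n x))\<^sup>2) \<longlonglongrightarrow> (cmod (u x - u x))\<^sup>2"
        by (intro tendsto_intros lim[OF elim])
      then show ?case by simp
    qed
    show "AE x in lebesgue. norm ((cmod (u x - h n x))\<^sup>2) \<le> indicator {- (B + 1)..B + 1} x *\<^sub>R (2 * B)\<^sup>2" for n
    proof (intro always_eventually allI)
      fix x
      show "norm ((cmod (u x - h n x))\<^sup>2) \<le> indicator {- (B + 1)..B + 1} x *\<^sub>R (2 * B)\<^sup>2"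
      proof (cases "B + 1 < \<bar>x\<bar>")
        case True
        then show ?thesis using \<kappa>(4)[OF True] u(4)[of x] by (simp add: h_def)
      next
        case False
        then have x: "x \<in> {- (B + 1)..B + 1}" by (simp add: abs_le_iff not_less)
        have "cmod (u x - h n x) \<le> 2 * B"
          using norm_triangle_ineq4[of "u x" "h n x"] u(3)[of x] h_le[of n x] by linarith
        then have "(cmod (u x - h n x))\<^sup>2 \<le> (2 * B)\<^sup>2" by (intro power_mono) auto
        then show ?thesis using x by simp
      qed
    qed
  qed simp
  then have "(\<lambda>n. L2_sq (\<lambda>x. u x - h n x)) \<longlonglongrightarrow> 0" by (simp add: L2_sq_def)
  then have "\<forall>\<^sub>F n in sequentially. L2_sq (\<lambda>x. u x - h n x) < e / 4"
    by (rule order_tendstoD) (use assms(2) in simp)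
  then obtain n where n: "L2_sq (\<lambda>x. u x - h n x) < e / 4" by (auto simp: eventually_sequentially)
  have hL: "h n \<in> L2_R" by (intro Cc_L2_R h_Cc)
  have "L2_sq (\<lambda>x. g x - h n x) \<le> (LINT x|lebesgue. 2 * (cmod (g x - u x))\<^sup>2 + 2 * (cmod (u x - h n x))\<^sup>2)"
    unfolding L2_sq_def
  proof (rule integral_mono)
    show "integrable lebesgue (\<lambda>x. (cmod (g x - h n x))\<^sup>2)"
      "integrable lebesgue (\<lambda>x. 2 * (cmod (g x - u x))\<^sup>2 + 2 * (cmod (u x - h n x))\<^sup>2)"
      using L2_R_diff[OF assms(1) hL] L2_R_diff[OF assms(1) u(1)] L2_R_diff[OF u(1) hL]
      by (auto simp: L2_R_def)
    fix x
    have "cmod (g x - h n x) \<le> cmod (g x - u x) + cmod (u x - h n x)"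
      using norm_triangle_ineq[of "g x - u x" "u x - h n x"] by simp
    then have "(cmod (g x - h n x))\<^sup>2 \<le> (cmod (g x - u x) + cmod (u x - h n x))\<^sup>2"
      by (intro power_mono) auto
    also have "\<dots> \<le> 2 * (cmod (g x - u x))\<^sup>2 + 2 * (cmod (u x - h n x))\<^sup>2"
      using zero_le_power2[of "cmod (g x - u x) - cmod (u x - h n x)"] by (simp add: power2_eq_square algebra_simps)
    finally show "(cmod (g x - h n x))\<^sup>2 \<le> 2 * (cmod (g x - u x))\<^sup>2 + 2 * (cmod (u x - h n x))\<^sup>2" .
  qed
  also have "\<dots> = 2 * L2_sq (\<lambda>x. g x - u x) + 2 * L2_sq (\<lambda>x. u x - h n x)"
    unfolding L2_sq_def using L2_R_diff[OF assms(1) u(1)] L2_R_diff[OF u(1) hL] by (simp add: L2_R_def)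
  also have "\<dots> < e" using u(5) n by linarith
  finally show ?thesis using that h_Cc by blast
qed

context uep_system
begin

lemma wavelet_gen_L2_R: "wavelet (gen r) j k \<in> L2_R"
  by (intro Cc_L2_R Cc_wavelet gen_Cc)

text \<open>
  The inequality for continuous functions with compact support passes to \<open>L\<^sup>2\<close> limits because the sum
  is finite.
\<close>

lemma L2_bessel:
  assumes "g \<in> L2_R" "finite F" "F \<subseteq> {1..q} \<times> UNIV \<times> UNIV"
  shows "(\<Sum>(r, j, k)\<in>F. (cmod (L2_inner g (wavelet (gen r) j k)))\<^sup>2) \<le> L2_sq g"
proof -
  let ?w = "\<lambda>(r, j, k). wavelet (gen r) j k"
  have w: "?w i \<in> L2_R" for i by (cases i) (simp add: wavelet_gen_L2_R)
  have "\<exists>h. \<forall>n::nat. h n \<in> Cc \<and> L2_sq (\<lambda>x. g x - h n x) < inverse (real (Suc n))"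
    by (intro choice allI) (metis Cc_dense[OF assms(1)] inverse_positive_iff_positive of_nat_0_less_iff zero_less_Suc)
  then obtain h where h: "\<And>n. h n \<in> Cc" "\<And>n. L2_sq (\<lambda>x. g x - h n x) < inverse (real (Suc n))" by blast
  have hL: "h n \<in> L2_R" for n by (intro Cc_L2_R h)
  have inv0: "(\<lambda>n. inverse (real (Suc n))) \<longlonglongrightarrow> 0" by (rule LIMSEQ_inverse_real_of_nat)
  have inner: "(\<lambda>n. L2_inner (h n) (?w i)) \<longlonglongrightarrow> L2_inner g (?w i)" for i
  proof -
    have "(\<lambda>n. L2_inner g (?w i) - L2_inner (h n) (?w i)) \<longlonglongrightarrow> 0"
    proof (rule Lim_null_comparison)
      show "\<forall>\<^sub>F n in sequentially. norm (L2_inner g (?w i) - L2_inner (h n) (?w i))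
          \<le> sqrt (inverse (real (Suc n))) * (1 + L2_sq (?w i))"
        using L2_inner_small[OF L2_R_diff[OF assms(1) hL] w h(2)] L2_inner_diff_left[OF assms(1) hL w]
        by (intro always_eventually allI) simp
      have "(\<lambda>n. sqrt (inverse (real (Suc n))) * (1 + L2_sq (?w i))) \<longlonglongrightarrow> sqrt 0 * (1 + L2_sq (?w i))"
        by (intro tendsto_intros inv0)
      then show "(\<lambda>n. sqrt (inverse (real (Suc n))) * (1 + L2_sq (?w i))) \<longlonglongrightarrow> 0" by simp
    qed
    from tendsto_diff[OF tendsto_const[of "L2_inner g (?w i)"] this] show ?thesis by simp
  qed
  have "(\<Sum>i\<in>F. (cmod (L2_inner g (?w i)))\<^sup>2) \<le> L2_sq g + t * L2_sq g" if t: "t > 0" for t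
  proof -
    have "(\<lambda>n. \<Sum>i\<in>F. (cmod (L2_inner (h n) (?w i)))\<^sup>2) \<longlonglongrightarrow> (\<Sum>i\<in>F. (cmod (L2_inner g (?w i)))\<^sup>2)"
      by (intro tendsto_intros inner)
    moreover have "(\<lambda>n. L2_sq g + t * L2_sq g + (1 + 1 / t) * inverse (real (Suc n)))
        \<longlonglongrightarrow> L2_sq g + t * L2_sq g + (1 + 1 / t) * 0"
      by (intro tendsto_intros inv0)
    moreover have "(\<Sum>i\<in>F. (cmod (L2_inner (h n) (?w i)))\<^sup>2) \<le> L2_sq g + t * L2_sq g + (1 + 1 / t) * inverse (real (Suc n))" for n
    proof -
      have "(\<Sum>i\<in>F. (cmod (L2_inner (h n) (?w i)))\<^sup>2) \<le> L2_sq (h n)"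
        using Cc_bessel[OF h(1) assms(2,3), of n] by (simp add: L2_sq_Cc[OF h(1)] case_prod_unfold)
      moreover have "\<bar>L2_sq (h n) - L2_sq g\<bar> \<le> t * L2_sq g + (1 + 1 / t) * L2_sq (\<lambda>x. g x - h n x)"
        by (rule L2_sq_diff_bound[OF assms(1) hL t])
      moreover have "(1 + 1 / t) * L2_sq (\<lambda>x. g x - h n x) \<le> (1 + 1 / t) * inverse (real (Suc n))"
        using t h(2)[of n] by (intro mult_left_mono) auto
      ultimately show ?thesis by linarith
    qed
    ultimately show ?thesis by (auto dest: LIMSEQ_le)
  qed
  note bound = this
  have "(\<Sum>i\<in>F. (cmod (L2_inner g (?w i)))\<^sup>2) \<le> L2_sq g"
  proof (rule field_le_epsilon)
    fix e :: real assume e: "e > 0"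
    define t where "t = e / (L2_sq g + 1)"
    have "t > 0" using e L2_sq_nonneg[of g] by (simp add: t_def)
    moreover have "t * L2_sq g \<le> e"
      using e L2_sq_nonneg[of g] by (simp add: t_def field_simps)
    ultimately show "(\<Sum>i\<in>F. (cmod (L2_inner g (?w i)))\<^sup>2) \<le> L2_sq g + e" using bound[of t] by linarith
  qed
  then show ?thesis by (simp add: case_prod_unfold)
qed

text \<open>
  Approximate \<open>g\<close> by \<open>h\<close> and take a set \<open>F\<close> that is good for \<open>h\<close>. By Bessel's inequality for \<open>g - h\<close>
  it is good for \<open>g\<close> as well; the constants make the total error less than \<open>e\<close>.
\<close>

lemma L2_parseval:
  assumes "g \<in> L2_R" "e > 0"
  obtains F where "finite F" "F \<subseteq> {1..q} \<times> UNIV \<times> UNIV"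
    "L2_sq g - e < (\<Sum>(r, j, k)\<in>F. (cmod (L2_inner g (wavelet (gen r) j k)))\<^sup>2)"
proof -
  let ?w = "\<lambda>(r, j, k). wavelet (gen r) j k"
  have w: "?w i \<in> L2_R" for i by (cases i) (simp add: wavelet_gen_L2_R)
  define G where "G = L2_sq g"
  have G: "G \<ge> 0" unfolding G_def by (rule L2_sq_nonneg)
  define t where "t = e / (8 * (G + 1))"
  have t: "t > 0" "t * G \<le> e / 8"
    using assms(2) G by (simp_all add: t_def field_simps)
  define \<delta> where "\<delta> = e / (8 * (1 + 1 / t))"
  have "1 + 1 / t > 0" using t(1) by (simp add: add_pos_pos)
  moreover have "c * (e / (8 * c)) = e / 8" if "c > 0" for c using that by simp
  ultimately have \<delta>: "(1 + 1 / t) * \<delta> = e / 8" unfolding \<delta>_def by blast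
  have \<delta>_pos: "\<delta> > 0" unfolding \<delta>_def using assms(2) \<open>1 + 1 / t > 0\<close> by (intro divide_pos_pos mult_pos_pos) auto
  obtain h where h: "h \<in> Cc" "L2_sq (\<lambda>x. g x - h x) < \<delta>" by (rule Cc_dense[OF assms(1) \<delta>_pos]) (rule that)
  have hL: "h \<in> L2_R" by (intro Cc_L2_R h)
  have small: "(1 + 1 / t) * L2_sq (\<lambda>x. g x - h x) \<le> e / 8"
    unfolding \<delta>[symmetric] using h(2) \<open>1 + 1 / t > 0\<close> by (intro mult_left_mono) auto
  obtain F where F: "finite F" "F \<subseteq> {1..q} \<times> UNIV \<times> UNIV"
    "(LINT x|lborel. (cmod (h x))\<^sup>2) - e / 4 < (\<Sum>(r, j, k)\<in>F. (cmod (L2_inner h (wavelet (gen r) j k)))\<^sup>2)"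
    by (rule Cc_parseval[OF h(1), of "e / 4"]) (use assms(2) in simp, rule that)
  define Sg where "Sg = (\<Sum>i\<in>F. (cmod (L2_inner g (?w i)))\<^sup>2)"
  define Sh where "Sh = (\<Sum>i\<in>F. (cmod (L2_inner h (?w i)))\<^sup>2)"
  define Sd where "Sd = (\<Sum>i\<in>F. (cmod (L2_inner g (?w i) - L2_inner h (?w i)))\<^sup>2)"
  have "Sd \<le> L2_sq (\<lambda>x. g x - h x)"
    using L2_bessel[OF L2_R_diff[OF assms(1) hL] F(1,2)]
    by (simp add: Sd_def L2_inner_diff_left[OF assms(1) hL wavelet_gen_L2_R] case_prod_unfold)
  then have "(1 + 1 / t) * Sd \<le> (1 + 1 / t) * L2_sq (\<lambda>x. g x - h x)"
    using \<open>1 + 1 / t > 0\<close> by (intro mult_left_mono) auto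
  moreover have "Sh \<le> Sg + t * Sg + (1 + 1 / t) * Sd"
    unfolding Sh_def Sg_def Sd_def by (rule sum_sq_diff_bound[OF t(1)])
  moreover have "Sg \<le> G"
    using L2_bessel[OF assms(1) F(1,2)] by (simp add: Sg_def G_def case_prod_unfold)
  then have "t * Sg \<le> t * G" using t(1) by (intro mult_left_mono) auto
  moreover have "\<bar>L2_sq h - G\<bar> \<le> t * G + (1 + 1 / t) * L2_sq (\<lambda>x. g x - h x)"
    unfolding G_def by (rule L2_sq_diff_bound[OF assms(1) hL t(1)])
  moreover have "L2_sq h - e / 4 < Sh" using F(3) by (simp add: L2_sq_Cc[OF h(1)] Sh_def case_prod_unfold)
  ultimately have "G - e < Sg" using small t(2) assms(2) by linarith
  then show ?thesis using F(1,2) by (intro that[of F]) (auto simp: Sg_def G_def case_prod_unfold)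
qed

lemma parseval_frame_gen: "parseval_frame q gen"
  unfolding parseval_frame_def
proof
  fix g assume g: "g \<in> L2_R"
  let ?f = "\<lambda>(r, j, k). (cmod (L2_inner g (wavelet (gen r) j k)))\<^sup>2" and ?A = "{1..q} \<times> (UNIV::int set) \<times> (UNIV::int set)"
  show "(?f has_sum (L2_norm g)\<^sup>2) ?A"
    unfolding has_sum_def L2_norm_sq
  proof (rule order_tendstoI)
    fix a assume "a < L2_sq g"
    then obtain F where F: "finite F" "F \<subseteq> ?A" "L2_sq g - (L2_sq g - a) < sum ?f F"
      using L2_parseval[OF g, of "L2_sq g - a"] by auto
    have "a < sum ?f Y" if "finite Y" "F \<subseteq> Y" for Y
    proof -
      have "sum ?f F \<le> sum ?f Y" using that by (intro sum_mono2) auto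
      then show ?thesis using F(3) by simp
    qed
    then show "\<forall>\<^sub>F F in finite_subsets_at_top ?A. a < sum ?f F"
      unfolding eventually_finite_subsets_at_top using F(1,2) by blast
  next
    fix a assume "L2_sq g < a"
    then have "sum ?f Y < a" if "finite Y" "Y \<subseteq> ?A" for Y using L2_bessel[OF g that] by linarith
    then show "\<forall>\<^sub>F F in finite_subsets_at_top ?A. sum ?f F < a"
      unfolding eventually_finite_subsets_at_top by (intro exI[of _ "{}"]) auto
  qed
qed

end

section \<open>Fourier transforms of continuous functions with compact support\<close>

definition ft :: "(real \<Rightarrow> complex) \<Rightarrow> real \<Rightarrow> complex" where
  "ft g \<xi> = (LINT x|lborel. g x * cis (- (x * \<xi>)))"

lemma continuous_on_cis:
  fixes f :: "'a :: topological_space \<Rightarrow> real"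
  shows "continuous_on A f \<Longrightarrow> continuous_on A (\<lambda>x. cis (f x))"
  unfolding cis_conv_exp by (intro continuous_intros)

lemma Cc_mult_cis: "g \<in> Cc \<Longrightarrow> (\<lambda>x. g x * cis (- (x * \<xi>))) \<in> Cc"
  by (intro Cc_mult_left) (auto simp: cis_conv_exp intro!: continuous_intros)

lemma fourier_Cc:
  assumes "g \<in> Cc"
  shows "fourier g = ft g"
proof
  fix \<xi>
  have "fourier g \<xi> = (LINT x|lebesgue. g x * cis (- (x * \<xi>)))"
    using Cc_lebesgue_integrable[OF assms]
    by (simp add: fourier_def fourier_integral_def set_lebesgue_integral_def cis_conv_exp)
  then show "fourier g \<xi> = ft g \<xi>"
    unfolding ft_def using Cc_lebesgue_integral[OF Cc_mult_cis[OF assms]] by simp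
qed

lemma ft_le: "g \<in> Cc \<Longrightarrow> cmod (ft g \<xi>) \<le> (LINT x|lborel. cmod (g x))"
  unfolding ft_def
  by (rule Bochner_Integration.integral_norm_bound_integral[OF Cc_integrable[OF Cc_mult_cis] Cc_norm_integrable])
     (auto simp: norm_mult)

lemma ft_has_vector_derivative:
  assumes "g \<in> Cc"
  shows "(ft g has_vector_derivative ft (\<lambda>x. (- (\<i> * of_real x)) * g x) \<xi>) (at \<xi>)"
proof -
  obtain R where R: "R > 0" "\<And>x. R < \<bar>x\<bar> \<Longrightarrow> g x = 0" by (rule Cc_support[OF assms]) (rule that)
  have as_integral: "(LINT x|lborel. h x) = integral (cbox (- R) R) h"
    if "continuous_on UNIV h" "\<And>x. R < \<bar>x\<bar> \<Longrightarrow> h x = 0" for h :: "real \<Rightarrow> complex"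
  proof -
    have "set_integrable lborel {-R..R} h"
      by (intro continuous_set_integrable continuous_on_subset[OF that(1)]) auto
    then have "(LINT x:{-R..R}|lborel. h x) = integral {-R..R} h" by (rule set_borel_integral_eq_integral)
    moreover have "(\<lambda>x. indicator {-R..R} x *\<^sub>R h x) = h"
      using that(2) by (force simp: indicator_def)
    ultimately show ?thesis by (simp add: set_lebesgue_integral_def)
  qed
  define f where "f = (\<lambda>\<xi> x. g x * cis (- (x * \<xi>)))"
  define f' where "f' = (\<lambda>\<xi> x. (- (\<i> * of_real x)) * g x * cis (- (x * \<xi>)))"
  have "((\<lambda>\<xi>. integral (cbox (- R) R) (f \<xi>)) has_vector_derivative integral (cbox (- R) R) (f' \<xi>)) (at \<xi> within UNIV)"
  proof (rule leibniz_rule_vector_derivative)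
    show "((\<lambda>\<xi>. f \<xi> x) has_vector_derivative f' \<xi> x) (at \<xi> within UNIV)" for \<xi> x
      unfolding f_def f'_def cis_conv_exp
      by (rule has_vector_derivative_eq_rhs, (rule derivative_intros has_vector_derivative_real_field | simp)+)
    show "f \<xi> integrable_on cbox (- R) R" for \<xi>
      unfolding f_def cis_conv_exp
      by (intro integrable_continuous continuous_intros Cc_continuous assms)
    have "continuous_on (UNIV \<times> cbox (- R) R) (\<lambda>z. g (snd z))"
      by (rule continuous_on_compose2[OF Cc_continuous[OF assms, of UNIV]]) (auto intro!: continuous_intros)
    then show "continuous_on (UNIV \<times> cbox (- R) R) (\<lambda>(\<xi>, x). f' \<xi> x)"
      unfolding f'_def cis_conv_exp split_beta by (intro continuous_intros)
  qed auto
  moreover have "integral (cbox (- R) R) (f \<xi>) = ft g \<xi>" for \<xi>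
    unfolding ft_def f_def
    by (rule as_integral[symmetric])
       (intro continuous_on_mult continuous_on_cis Cc_continuous[OF assms] continuous_intros, simp add: R(2))
  moreover have "integral (cbox (- R) R) (f' \<xi>) = ft (\<lambda>x. (- (\<i> * of_real x)) * g x) \<xi>"
    unfolding ft_def f'_def
    by (rule as_integral[symmetric])
       (intro continuous_on_mult continuous_on_cis Cc_continuous[OF assms] continuous_intros, simp add: R(2))
  ultimately show ?thesis by simp
qed

lemma ft_continuous: "g \<in> Cc \<Longrightarrow> continuous_on A (ft g)"
  by (meson ft_has_vector_derivative continuous_at_imp_continuous_on has_vector_derivative_continuous)

definition moment_fun :: "nat \<Rightarrow> (real \<Rightarrow> complex) \<Rightarrow> real \<Rightarrow> complex" where
  "moment_fun k g x = (- (\<i> * of_real x)) ^ k * g x"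

lemma moment_fun_Cc: "g \<in> Cc \<Longrightarrow> moment_fun k g \<in> Cc"
  unfolding moment_fun_def[abs_def]
  using Cc_mult_left[of g "\<lambda>x. (- (\<i> * of_real x)) ^ k"] by (simp add: mult.commute continuous_intros)

lemma nth_derivative_ft:
  assumes "g \<in> Cc"
  shows "nth_derivative k (ft g) = ft (moment_fun k g)"
proof (induction k)
  case 0
  show ?case by (simp add: nth_derivative_def moment_fun_def[abs_def])
next
  case (Suc k)
  have "nth_derivative (Suc k) (ft g) = (\<lambda>\<xi>. vector_derivative (ft (moment_fun k g)) (at \<xi>))"
    using Suc by (simp add: nth_derivative_def)
  also have "\<dots> = ft (\<lambda>x. (- (\<i> * of_real x)) * moment_fun k g x)"
    by (intro ext vector_derivative_at ft_has_vector_derivative moment_fun_Cc assms)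
  also have "(\<lambda>x. (- (\<i> * of_real x)) * moment_fun k g x) = moment_fun (Suc k) g"
    by (simp add: moment_fun_def[abs_def] mult.assoc)
  finally show ?case .
qed

text \<open>
  The constant coefficient is the limit at 0, and division by \<open>x\<close> lowers the degree and the order of
  smallness together.
\<close>

lemma polynomial_vanishes_if_small:
  fixes a :: "nat \<Rightarrow> complex"
  assumes "\<And>x::real. x \<noteq> 0 \<Longrightarrow> cmod (\<Sum>k\<le>N. a k * of_real x ^ k) \<le> C * \<bar>x\<bar> ^ Suc N"
  shows "\<forall>k\<le>N. a k = 0"
  using assms
proof (induction N arbitrary: a)
  case (0 a)
  have 0: "a 0 = 0"
  proof (rule ccontr)
    assume "a 0 \<noteq> 0"
    have "((\<lambda>x::real. C * \<bar>x\<bar>) \<longlongrightarrow> C * \<bar>0\<bar>) (at 0)" by (intro tendsto_intros)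
    then have "\<forall>\<^sub>F x in at (0::real). C * \<bar>x\<bar> < cmod (a 0)"
      by (rule order_tendstoD) (use \<open>a 0 \<noteq> 0\<close> in simp)
    moreover have "\<forall>\<^sub>F x in at (0::real). x \<noteq> 0" by (simp add: eventually_at_filter)
    ultimately have "\<forall>\<^sub>F x in at (0::real). False"
      by eventually_elim (use 0 in fastforce)
    then show False by simp
  qed
  then show ?case by simp
next
  case (Suc N a)
  have shift: "(\<Sum>k\<le>Suc N. a k * of_real x ^ k) = a 0 + of_real x * (\<Sum>k\<le>N. a (Suc k) * of_real x ^ k)" for x :: real
    unfolding sum.atMost_Suc_shift by (simp add: sum_distrib_left mult.left_commute)
  have a0: "a 0 = 0"
  proof -
    have "((\<lambda>x::real. \<Sum>k\<le>Suc N. a k * of_real x ^ k) \<longlongrightarrow> a 0 + of_real 0 * (\<Sum>k\<le>N. a (Suc k) * of_real 0 ^ k)) (at 0)"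
      unfolding shift by (intro tendsto_intros)
    moreover have "((\<lambda>x::real. \<Sum>k\<le>Suc N. a k * of_real x ^ k) \<longlongrightarrow> 0) (at 0)"
    proof (rule Lim_null_comparison)
      show "\<forall>\<^sub>F x::real in at 0. cmod (\<Sum>k\<le>Suc N. a k * of_real x ^ k) \<le> C * \<bar>x\<bar> ^ Suc (Suc N)"
        using Suc.prems by (auto simp: eventually_at_filter simp del: sum.atMost_Suc)
      have "((\<lambda>x::real. C * \<bar>x\<bar> ^ Suc (Suc N)) \<longlongrightarrow> C * \<bar>0\<bar> ^ Suc (Suc N)) (at 0)"
        by (intro tendsto_intros)
      then show "((\<lambda>x::real. C * \<bar>x\<bar> ^ Suc (Suc N)) \<longlongrightarrow> 0) (at 0)" by simp
    qed
    ultimately show ?thesis using tendsto_unique[OF trivial_limit_at] by fastforce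
  qed
  have "\<forall>k\<le>N. a (Suc k) = 0"
  proof (rule Suc.IH)
    fix x :: real assume x: "x \<noteq> 0"
    have "\<bar>x\<bar> * cmod (\<Sum>k\<le>N. a (Suc k) * of_real x ^ k) \<le> \<bar>x\<bar> * (C * \<bar>x\<bar> ^ Suc N)"
      using Suc.prems[OF x] unfolding shift a0 by (simp add: norm_mult mult.left_commute)
    then show "cmod (\<Sum>k\<le>N. a (Suc k) * of_real x ^ k) \<le> C * \<bar>x\<bar> ^ Suc N" using x by simp
  qed
  then show ?case using a0 by (metis Suc_le_mono not0_implies_Suc)
qed

text \<open>
  Taylor's formula for \<open>e\<^sup>-\<^sup>i\<^sup>x\<^sup>\<xi>\<close> under the integral; the remainder is integrable since the support of
  \<open>g\<close> is bounded.
\<close>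

lemma ft_taylor:
  assumes "g \<in> Cc"
  obtains B where "\<And>\<xi>. cmod (ft g \<xi> - (\<Sum>k\<le>N. (ft (moment_fun k g) 0 / fact k) * of_real \<xi> ^ k)) \<le> B * \<bar>\<xi>\<bar> ^ Suc N"
proof -
  have poly_Cc: "(\<lambda>x. g x * (of_real (\<bar>x\<bar> ^ Suc N))) \<in> Cc" by (intro Cc_mult_left assms continuous_intros)
  define B where "B = (LINT x|lborel. cmod (g x * (of_real (\<bar>x\<bar> ^ Suc N))))"
  have "cmod (ft g \<xi> - (\<Sum>k\<le>N. (ft (moment_fun k g) 0 / fact k) * of_real \<xi> ^ k)) \<le> B * \<bar>\<xi>\<bar> ^ Suc N" for \<xi>
  proof -
    let ?T = "\<lambda>x. \<Sum>k\<le>N. (\<i> * of_real (- (x * \<xi>))) ^ k / fact k"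
    have T_Cc: "(\<lambda>x. g x * ?T x) \<in> Cc" by (intro Cc_mult_left assms continuous_intros) auto
    have tm: "(of_real \<xi> ^ k / fact k) * moment_fun k g x = g x * ((\<i> * of_real (- (x * \<xi>))) ^ k / fact k)" for k x
    proof -
      have "(\<i> * of_real (- (x * \<xi>))) ^ k = of_real \<xi> ^ k * (- (\<i> * of_real x)) ^ k"
      proof -
        have "\<i> * of_real (- (x * \<xi>)) = of_real \<xi> * (- (\<i> * of_real x))" by simp
        then show ?thesis by (simp only: power_mult_distrib)
      qed
      then show ?thesis by (simp add: moment_fun_def)
    qed
    have "(\<Sum>k\<le>N. (ft (moment_fun k g) 0 / fact k) * of_real \<xi> ^ k)
        = (\<Sum>k\<le>N. LINT x|lborel. (of_real \<xi> ^ k / fact k) * moment_fun k g x)"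
      by (simp add: ft_def mult.commute)
    also have "\<dots> = (LINT x|lborel. (\<Sum>k\<le>N. (of_real \<xi> ^ k / fact k) * moment_fun k g x))"
      by (rule Bochner_Integration.integral_sum[symmetric]) (intro Cc_integrable Cc_cmult moment_fun_Cc assms)
    also have "\<dots> = (LINT x|lborel. g x * ?T x)" unfolding tm sum_distrib_left ..
    finally have "ft g \<xi> - (\<Sum>k\<le>N. (ft (moment_fun k g) 0 / fact k) * of_real \<xi> ^ k)
        = (LINT x|lborel. g x * cis (- (x * \<xi>)) - g x * ?T x)"
      unfolding ft_def
      by (simp only: Bochner_Integration.integral_diff[OF Cc_integrable[OF Cc_mult_cis[OF assms]] Cc_integrable[OF T_Cc]])
    also have "cmod \<dots> \<le> (LINT x|lborel. \<bar>\<xi>\<bar> ^ Suc N * cmod (g x * (of_real (\<bar>x\<bar> ^ Suc N))))"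
    proof (rule Bochner_Integration.integral_norm_bound_integral)
      show "integrable lborel (\<lambda>x. g x * cis (- (x * \<xi>)) - g x * ?T x)"
        by (intro Bochner_Integration.integrable_diff Cc_integrable Cc_mult_cis T_Cc assms)
      show "integrable lborel (\<lambda>x. \<bar>\<xi>\<bar> ^ Suc N * cmod (g x * (of_real (\<bar>x\<bar> ^ Suc N))))"
        by (intro integrable_mult_right Cc_norm_integrable poly_Cc)
      fix x
      have "cmod (cis (- (x * \<xi>)) - ?T x) \<le> \<bar>- (x * \<xi>)\<bar> ^ Suc N / fact (Suc N)"
        unfolding cis_conv_exp using iexp_approx1[of "- (x * \<xi>)" N] by simp
      also have "\<dots> \<le> \<bar>- (x * \<xi>)\<bar> ^ Suc N / 1" by (intro divide_left_mono) (auto simp: fact_ge_1 simp del: fact_Suc)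
      finally have "cmod (cis (- (x * \<xi>)) - ?T x) \<le> \<bar>x\<bar> ^ Suc N * \<bar>\<xi>\<bar> ^ Suc N"
        by (simp only: abs_minus_cancel abs_mult power_mult_distrib div_by_1)
      then have "cmod (g x) * cmod (cis (- (x * \<xi>)) - ?T x) \<le> cmod (g x) * (\<bar>x\<bar> ^ Suc N * \<bar>\<xi>\<bar> ^ Suc N)"
        by (intro mult_left_mono) auto
      moreover have "g x * cis (- (x * \<xi>)) - g x * ?T x = g x * (cis (- (x * \<xi>)) - ?T x)" by (simp only: right_diff_distrib)
      ultimately show "norm (g x * cis (- (x * \<xi>)) - g x * ?T x) \<le> \<bar>\<xi>\<bar> ^ Suc N * cmod (g x * (of_real (\<bar>x\<bar> ^ Suc N)))"
        by (simp add: norm_mult norm_power ac_simps del: power_Suc)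
    qed
    also have "\<dots> = B * \<bar>\<xi>\<bar> ^ Suc N" by (simp add: B_def mult.commute)
    finally show ?thesis .
  qed
  then show ?thesis using that by blast
qed

text \<open>
  By Taylor's formula the flatness of the transform at 0 makes its Taylor polynomial vanish.
\<close>

lemma vanishing_moments_if_flat:
  assumes "g \<in> Cc" "\<And>\<xi>. cmod (ft g \<xi>) \<le> C * \<bar>\<xi>\<bar> ^ Suc N"
  shows "vanishing_moments N g"
proof -
  obtain B where B: "\<And>\<xi>. cmod (ft g \<xi> - (\<Sum>k\<le>N. (ft (moment_fun k g) 0 / fact k) * of_real \<xi> ^ k)) \<le> B * \<bar>\<xi>\<bar> ^ Suc N"
    by (rule ft_taylor[OF assms(1)]) (rule that)
  have "cmod (\<Sum>k\<le>N. (ft (moment_fun k g) 0 / fact k) * of_real \<xi> ^ k) \<le> (B + C) * \<bar>\<xi>\<bar> ^ Suc N" for \<xi>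
  proof -
    let ?p = "\<Sum>k\<le>N. (ft (moment_fun k g) 0 / fact k) * of_real \<xi> ^ k"
    have "cmod ?p \<le> cmod (ft g \<xi>) + cmod (ft g \<xi> - ?p)"
      using norm_triangle_ineq4[of "ft g \<xi>" "ft g \<xi> - ?p"] by simp
    also have "\<dots> \<le> C * \<bar>\<xi>\<bar> ^ Suc N + B * \<bar>\<xi>\<bar> ^ Suc N" by (intro add_mono B assms(2))
    finally show ?thesis by (simp add: algebra_simps)
  qed
  then have "\<forall>k\<le>N. ft (moment_fun k g) 0 / fact k = 0" by (intro polynomial_vanishes_if_small)
  then have "\<forall>k\<le>N. ft (moment_fun k g) 0 = 0" by simp
  moreover have "ft (moment_fun k g) differentiable (at \<xi>)" for k \<xi>
    by (rule differentiableI_vector[OF ft_has_vector_derivative[OF moment_fun_Cc[OF assms(1)]]])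
  ultimately show ?thesis
    unfolding vanishing_moments_def fourier_Cc[OF assms(1)] nth_derivative_ft[OF assms(1)] by simp
qed

section \<open>The Zak transform\<close>

definition unit_integral :: "(real \<Rightarrow> complex) \<Rightarrow> complex" where
  "unit_integral f = (LINT x|lborel. indicator {0..<1} x *\<^sub>R f x)"

lemma unit_integrable:
  fixes f :: "real \<Rightarrow> 'a :: {banach, second_countable_topology}"
  assumes "continuous_on UNIV f"
  shows "integrable lborel (\<lambda>x. indicator {0..<1} x *\<^sub>R f x)"
proof -
  have "set_integrable lborel {0..1} f"
    by (intro continuous_set_integrable continuous_on_subset[OF assms]) auto
  then have "set_integrable lborel {0..<1} f" by (rule set_integrable_subset) auto
  then show ?thesis by (simp add: set_integrable_def)
qed

lemma unit_integral_sum: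
  assumes "\<And>i. i \<in> I \<Longrightarrow> continuous_on UNIV (f i)"
  shows "unit_integral (\<lambda>x. \<Sum>i\<in>I. f i x) = (\<Sum>i\<in>I. unit_integral (f i))"
  unfolding unit_integral_def scaleR_sum_right
  by (intro Bochner_Integration.integral_sum unit_integrable assms)

lemma unit_integral_cmult: "unit_integral (\<lambda>x. c * f x) = c * unit_integral f"
  unfolding unit_integral_def by (simp flip: mult_scaleR_right)

lemma integral_eq_sum_unit_integral:
  assumes "f \<in> Cc" "\<And>x. of_nat R < \<bar>x\<bar> \<Longrightarrow> f x = 0"
  shows "(LINT x|lborel. f x) = (\<Sum>n\<in>{- int R - 1..int R}. unit_integral (\<lambda>x. f (x + of_int n)))"
proof -
  have shift: "integrable lborel (\<lambda>x. indicator {of_int n..<of_int n + 1} x *\<^sub>R f x)"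
    "(LINT x|lborel. indicator {of_int n..<of_int n + 1} x *\<^sub>R f x) = unit_integral (\<lambda>x. f (x + of_int n))" for n :: int
  proof -
    have ind: "(indicator {of_int n..<of_int n + 1} (of_int n + 1 * x) :: real) = indicator {0..<1} x" for x :: real
      by (auto simp: indicator_def)
    show "(LINT x|lborel. indicator {of_int n..<of_int n + 1} x *\<^sub>R f x) = unit_integral (\<lambda>x. f (x + of_int n))"
      using lborel_integral_real_affine[of 1 "\<lambda>x. indicator {of_int n..<of_int n + 1} x *\<^sub>R f x" "of_int n"]
      unfolding ind by (simp add: unit_integral_def add.commute)
    have "set_integrable lborel UNIV f" using Cc_integrable[OF assms(1)] by (simp add: set_integrable_def)
    then have "set_integrable lborel {of_int n..<of_int n + 1} f" by (rule set_integrable_subset) auto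
    then show "integrable lborel (\<lambda>x. indicator {of_int n..<of_int n + 1} x *\<^sub>R f x)" by (simp add: set_integrable_def)
  qed
  have "f x = (\<Sum>n\<in>{- int R - 1..int R}. indicator {of_int n..<of_int n + 1} x *\<^sub>R f x)" for x
  proof (cases "of_nat R < \<bar>x\<bar>")
    case False
    then have "\<lfloor>x\<rfloor> \<in> {- int R - 1..int R}" unfolding atLeastAtMost_iff by linarith
    have "(\<Sum>n\<in>{- int R - 1..int R}. indicator {of_int n..<of_int n + 1} x *\<^sub>R f x)
       = (\<Sum>n\<in>{- int R - 1..int R}. if n = \<lfloor>x\<rfloor> then f x else 0)"
    proof (rule sum.cong[OF refl])
      fix n
      have "x \<in> {of_int n..<of_int n + 1} \<longleftrightarrow> n = \<lfloor>x\<rfloor>" by (auto simp: eq_commute[of n] floor_eq_iff)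
      then show "indicator {of_int n..<of_int n + 1} x *\<^sub>R f x = (if n = \<lfloor>x\<rfloor> then f x else 0)"
        by (simp add: indicator_def)
    qed
    then show ?thesis using \<open>\<lfloor>x\<rfloor> \<in> {- int R - 1..int R}\<close> by simp
  qed (simp add: assms(2))
  then have "(LINT x|lborel. f x) = (LINT x|lborel. (\<Sum>n\<in>{- int R - 1..int R}. indicator {of_int n..<of_int n + 1} x *\<^sub>R f x))"
    by (intro arg_cong[of _ _ "integral\<^sup>L lborel"] ext) simp
  also have "\<dots> = (\<Sum>n\<in>{- int R - 1..int R}. unit_integral (\<lambda>x. f (x + of_int n)))"
    by (simp only: Bochner_Integration.integral_sum[OF shift(1)] shift(2))
  finally show ?thesis .
qed

text \<open>
  The variance of \<open>|f|\<close> on the unit interval is nonnegative.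
\<close>

lemma unit_integral_cauchy_schwarz:
  assumes "continuous_on UNIV f"
  shows "(cmod (unit_integral f))\<^sup>2 \<le> Re (unit_integral (\<lambda>x. of_real ((cmod (f x))\<^sup>2)))"
proof -
  define a where "a = (LINT x|lborel. indicator {0..<1} x *\<^sub>R cmod (f x))"
  have c: "continuous_on UNIV (\<lambda>x. cmod (f x))" "continuous_on UNIV (\<lambda>x. (cmod (f x))\<^sup>2)"
    by (intro continuous_intros assms)+
  have "cmod (unit_integral f) \<le> a"
    unfolding unit_integral_def a_def
    by (rule Bochner_Integration.integral_norm_bound_integral[OF unit_integrable[OF assms] unit_integrable[OF c(1)]])
       (simp add: indicator_def)
  then have "(cmod (unit_integral f))\<^sup>2 \<le> a\<^sup>2" by (intro power_mono) auto
  also have "a\<^sup>2 \<le> (LINT x|lborel. indicator {0..<1} x *\<^sub>R (cmod (f x))\<^sup>2)"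
  proof -
    have ind: "integrable lborel (\<lambda>x::real. indicator {0..<1} x *\<^sub>R (1::real))" by (rule unit_integrable) simp
    have "0 \<le> (LINT x|lborel. indicator {0..<1} x *\<^sub>R (cmod (f x) - a)\<^sup>2)"
      by (rule integral_nonneg_AE) (simp add: indicator_def)
    also have "(\<lambda>x. indicator {0..<1} x *\<^sub>R (cmod (f x) - a)\<^sup>2)
       = (\<lambda>x. indicator {0..<1} x *\<^sub>R (cmod (f x))\<^sup>2 - (2 * a) * (indicator {0..<1} x *\<^sub>R cmod (f x)) + a\<^sup>2 * (indicator {0..<1} x *\<^sub>R 1))"
      by (rule ext) (simp add: power2_eq_square algebra_simps)
    also have "(LINT x|lborel. indicator {0..<1} x *\<^sub>R (cmod (f x))\<^sup>2 - (2 * a) * (indicator {0..<1} x *\<^sub>R cmod (f x)) + a\<^sup>2 * (indicator {0..<1} x *\<^sub>R 1))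
       = (LINT x|lborel. indicator {0..<1} x *\<^sub>R (cmod (f x))\<^sup>2) - (2 * a) * a + a\<^sup>2 * 1"
    proof -
      have 1: "(LINT x|lborel. indicator {0..<1::real} x *\<^sub>R (1::real)) = 1" by simp
      note i1 = unit_integrable[OF c(2)] and i2 = integrable_mult_right[OF unit_integrable[OF c(1)], of "2 * a"]
        and i3 = integrable_mult_right[OF ind, of "a\<^sup>2"]
      show ?thesis
        unfolding Bochner_Integration.integral_add[OF Bochner_Integration.integrable_diff[OF i1 i2] i3]
          Bochner_Integration.integral_diff[OF i1 i2] integral_mult_right_zero a_def[symmetric] 1 ..
    qed
    finally show ?thesis by (simp add: power2_eq_square)
  qed
  also have "\<dots> = Re (unit_integral (\<lambda>x. of_real ((cmod (f x))\<^sup>2)))"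
  proof -
    have "unit_integral (\<lambda>x. of_real ((cmod (f x))\<^sup>2)) = (LINT x|lborel. complex_of_real (indicator {0..<1} x *\<^sub>R (cmod (f x))\<^sup>2))"
      unfolding unit_integral_def by (simp add: scaleR_conv_of_real)
    also have "\<dots> = of_real (LINT x|lborel. indicator {0..<1} x *\<^sub>R (cmod (f x))\<^sup>2)" by (rule integral_complex_of_real)
    finally show ?thesis by simp
  qed
  finally show ?thesis .
qed

text \<open>
  Cut the line into unit intervals: \<open>ft h\<close> is the integral over \<open>{0..<1}\<close> of the trigonometric
  polynomials \<open>\<Sum>n. h(x + n) e\<^sup>-\<^sup>i\<^sup>n\<^sup>\<xi>\<close> (the Zak transform of \<open>h\<close>), up to unimodular factors, and
  Parseval's identity applies to each of them.
\<close>

lemma zak_bound: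
  assumes "h \<in> Cc"
  obtains W where "trig_poly W" "\<And>\<xi>. (cmod (ft h \<xi>))\<^sup>2 \<le> Re (W \<xi>)" "mean W = of_real (LINT x|lborel. (cmod (h x))\<^sup>2)"
proof -
  obtain R0 where R0: "\<And>x. R0 < \<bar>x\<bar> \<Longrightarrow> h x = 0" by (rule Cc_support[OF assms]) (rule that)
  define R where "R = nat \<lceil>R0\<rceil>"
  have "R0 \<le> of_nat R" unfolding R_def by (rule of_nat_ceiling)
  then have R: "\<And>x. of_nat R < \<bar>x\<bar> \<Longrightarrow> h x = 0" using R0 by force
  let ?I = "{- int R - 1..int R}"
  define H where "H = (\<lambda>x \<xi>. \<Sum>n\<in>?I. h (x + of_int n) * cis (of_int (- n) * \<xi>))"
  define W where "W = (\<lambda>\<xi>. unit_integral (\<lambda>x. of_real ((cmod (H x \<xi>))\<^sup>2)))"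
  have ch: "continuous_on UNIV (\<lambda>x. h (x + of_int n))" for n :: int
    by (rule continuous_on_compose2[OF Cc_continuous[OF assms, of UNIV]]) (auto intro!: continuous_intros)
  have ft_le: "(cmod (ft h \<xi>))\<^sup>2 \<le> Re (W \<xi>)" for \<xi>
  proof -
    have "ft h \<xi> = (\<Sum>n\<in>?I. unit_integral (\<lambda>x. h (x + of_int n) * cis (- ((x + of_int n) * \<xi>))))"
      unfolding ft_def by (rule integral_eq_sum_unit_integral[OF Cc_mult_cis[OF assms]]) (simp add: R)
    also have "\<dots> = unit_integral (\<lambda>x. \<Sum>n\<in>?I. h (x + of_int n) * cis (- ((x + of_int n) * \<xi>)))"
      by (rule unit_integral_sum[symmetric]) (intro continuous_on_mult ch continuous_on_cis continuous_intros)
    also have "(\<lambda>x. \<Sum>n\<in>?I. h (x + of_int n) * cis (- ((x + of_int n) * \<xi>))) = (\<lambda>x. H x \<xi> * cis (- (x * \<xi>)))"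
      unfolding H_def sum_distrib_right by (auto intro!: sum.cong simp: cis_mult mult.assoc algebra_simps)
    finally have eq: "ft h \<xi> = unit_integral (\<lambda>x. H x \<xi> * cis (- (x * \<xi>)))" .
    have "continuous_on UNIV (\<lambda>x. H x \<xi> * cis (- (x * \<xi>)))"
      unfolding H_def by (intro continuous_on_mult continuous_on_sum ch continuous_on_cis continuous_intros)
    from unit_integral_cauchy_schwarz[OF this] show ?thesis
      unfolding eq W_def by (simp add: norm_mult)
  qed
  have W: "W = (\<lambda>\<xi>. \<Sum>n\<in>?I. \<Sum>l\<in>?I. unit_integral (\<lambda>x. h (x + of_int n) * cnj (h (x + of_int l))) * cis (of_int (l - n) * \<xi>))"
  proof
    fix \<xi>
    have "of_real ((cmod (H x \<xi>))\<^sup>2) = (\<Sum>n\<in>?I. \<Sum>l\<in>?I. cis (of_int (l - n) * \<xi>) * (h (x + of_int n) * cnj (h (x + of_int l))))" for x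
    proof -
      have e: "cis (of_int (- n) * \<xi>) * cnj (cis (of_int (- l) * \<xi>)) = cis (of_int (l - n) * \<xi>)" for n l :: int
        by (simp add: cis_cnj cis_mult algebra_simps)
      have "h (x + of_int n) * cis (of_int (- n) * \<xi>) * cnj (h (x + of_int l) * cis (of_int (- l) * \<xi>))
        = cis (of_int (l - n) * \<xi>) * (h (x + of_int n) * cnj (h (x + of_int l)))" for n l :: int
        unfolding e[symmetric] complex_cnj_mult by (simp only: ac_simps)
      then show ?thesis unfolding H_def complex_norm_square cnj_sum sum_product by (simp only:)
    qed
    then have "W \<xi> = unit_integral (\<lambda>x. \<Sum>n\<in>?I. \<Sum>l\<in>?I. cis (of_int (l - n) * \<xi>) * (h (x + of_int n) * cnj (h (x + of_int l))))"
      unfolding W_def by (simp only:)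
    also have "\<dots> = (\<Sum>n\<in>?I. \<Sum>l\<in>?I. unit_integral (\<lambda>x. cis (of_int (l - n) * \<xi>) * (h (x + of_int n) * cnj (h (x + of_int l)))))"
      by (subst unit_integral_sum, (intro continuous_intros ch), intro sum.cong refl unit_integral_sum continuous_intros ch)
    finally show "W \<xi> = (\<Sum>n\<in>?I. \<Sum>l\<in>?I. unit_integral (\<lambda>x. h (x + of_int n) * cnj (h (x + of_int l))) * cis (of_int (l - n) * \<xi>))"
      by (simp only: unit_integral_cmult mult.commute)
  qed
  have tpW: "trig_poly W" unfolding W by (intro trig_poly_sum trig_poly.monomial)
  have "mean W = (\<Sum>n\<in>?I. \<Sum>l\<in>?I. unit_integral (\<lambda>x. h (x + of_int n) * cnj (h (x + of_int l))) * (if l - n = 0 then 1 else 0))"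
    unfolding W by (simp only: mean_sum trig_poly_sum trig_poly.monomial mean_cmult mean_cis)
  also have "\<dots> = (\<Sum>n\<in>?I. \<Sum>l\<in>?I. if l = n then unit_integral (\<lambda>x. h (x + of_int n) * cnj (h (x + of_int l))) else 0)"
    by (intro sum.cong refl) auto
  also have "\<dots> = (\<Sum>n\<in>?I. unit_integral (\<lambda>x. of_real ((cmod (h (x + of_int n)))\<^sup>2)))"
    by (simp add: complex_norm_square del: of_real_power)
  also have "\<dots> = (LINT x|lborel. complex_of_real ((cmod (h x))\<^sup>2))"
    by (rule integral_eq_sum_unit_integral[symmetric, OF Cc_norm_sq[OF assms]]) (simp add: R)
  also have "\<dots> = of_real (LINT x|lborel. (cmod (h x))\<^sup>2)" by (rule integral_complex_of_real)
  finally show ?thesis using that tpW ft_le by blast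
qed

section \<open>Masks, moments and stability of the wavelet system\<close>

lemma trig_poly_space_C: "trig_poly p \<Longrightarrow> p \<in> space_C"
  by (simp add: space_C_def trig_poly_continuous trig_poly_periodic)

lemma trig_poly_L2_per:
  assumes "trig_poly p"
  shows "p \<in> L2_per"
proof -
  have meas: "p \<in> borel_measurable borel" by (intro borel_measurable_continuous_onI trig_poly_continuous assms)
  have "set_integrable lborel {-pi..pi} (\<lambda>x. (cmod (p x))\<^sup>2)"
    by (intro continuous_set_integrable continuous_intros trig_poly_continuous assms)
  then have "set_integrable lborel {-pi..<pi} (\<lambda>x. (cmod (p x))\<^sup>2)" by (rule set_integrable_subset) auto
  then have "set_integrable lebesgue {-pi..<pi} (\<lambda>x. (cmod (p x))\<^sup>2)"
    unfolding set_integrable_def using meas by (subst integrable_completion) auto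
  moreover have "p \<in> borel_measurable lebesgue" using meas by (intro measurable_completion) simp
  ultimately show ?thesis by (simp add: L2_per_def trig_poly_periodic[OF assms])
qed

context uep_system
begin

lemma ft_gen:
  assumes "r \<le> q"
  shows "ft (gen r) (2 * \<xi>) = m r \<xi> * ft \<phi> \<xi>"
proof -
  let ?S = "{k. fcoef (m r) k \<noteq> 0}"
  have S: "finite ?S" by (rule fcoef_finite_support[OF tp[OF assms]])
  have shift: "2 * (LINT y|lborel. \<phi> (2 * y + of_int k) * cis (- (y * (2 * \<xi>)))) = cis (of_int k * \<xi>) * ft \<phi> \<xi>" for k :: int
  proof -
    have "cis (of_int k * \<xi>) * ft \<phi> \<xi> = (LINT x|lborel. \<phi> x * cis (- ((x - of_int k) * \<xi>)))"
    proof -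
      have "cis (of_int k * \<xi>) * (\<phi> x * cis (- (x * \<xi>))) = \<phi> x * cis (- ((x - of_int k) * \<xi>))" for x
        by (simp add: cis_mult mult.left_commute algebra_simps)
      then show ?thesis unfolding ft_def integral_mult_right_zero[symmetric] by (simp only:)
    qed
    also have "\<dots> = 2 * (LINT y|lborel. \<phi> (of_int k + 2 * y) * cis (- ((of_int k + 2 * y - of_int k) * \<xi>)))"
      using lborel_integral_real_affine[of 2 "\<lambda>x. \<phi> x * cis (- ((x - of_int k) * \<xi>))" "of_int k"]
      by (simp add: scaleR_conv_of_real)
    also have "(\<lambda>y. \<phi> (of_int k + 2 * y) * cis (- ((of_int k + 2 * y - of_int k) * \<xi>)))
       = (\<lambda>y. \<phi> (2 * y + of_int k) * cis (- (y * (2 * \<xi>))))"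
    proof
      fix y
      have "(of_int k + 2 * y - of_int k) * \<xi> = y * (2 * \<xi>)" by simp
      then show "\<phi> (of_int k + 2 * y) * cis (- ((of_int k + 2 * y - of_int k) * \<xi>))
        = \<phi> (2 * y + of_int k) * cis (- (y * (2 * \<xi>)))" by (simp only: add.commute)
    qed
    finally show ?thesis by (rule sym)
  qed
  have Cc: "(\<lambda>y. \<phi> (2 * y + of_int k) * cis (- (y * (2 * \<xi>)))) \<in> Cc" for k :: int
    by (intro Cc_mult_cis Cc_affine \<phi>_Cc) auto
  have "ft (gen r) (2 * \<xi>) = (LINT y|lborel. (\<Sum>k\<in>?S. 2 * fcoef (m r) k * (\<phi> (2 * y + of_int k) * cis (- (y * (2 * \<xi>))))))"
    unfolding ft_def gen_def by (simp only: sum_distrib_left sum_distrib_right mult.assoc)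
  also have "\<dots> = (\<Sum>k\<in>?S. (LINT y|lborel. 2 * fcoef (m r) k * (\<phi> (2 * y + of_int k) * cis (- (y * (2 * \<xi>))))))"
    by (intro Bochner_Integration.integral_sum Cc_integrable Cc_cmult Cc)
  also have "\<dots> = (\<Sum>k\<in>?S. fcoef (m r) k * (2 * (LINT y|lborel. \<phi> (2 * y + of_int k) * cis (- (y * (2 * \<xi>))))))"
    by (intro sum.cong refl) (simp only: integral_mult_right_zero ac_simps)
  also have "\<dots> = (\<Sum>k\<in>?S. fcoef (m r) k * cis (of_int k * \<xi>)) * ft \<phi> \<xi>"
    unfolding shift by (simp only: sum_distrib_right mult.assoc)
  also have "(\<Sum>k\<in>?S. fcoef (m r) k * cis (of_int k * \<xi>)) = m r \<xi>"
    by (rule fcoef_sum[OF tp[OF assms] S order_refl, symmetric])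
  finally show ?thesis .
qed

lemma ft_\<phi>_refinement: "ft \<phi> (2 * \<xi>) = m 0 \<xi> * ft \<phi> \<xi>"
  using ft_gen[of 0 \<xi>] by (simp add: gen_0)

lemma ft_\<phi>_0: "ft \<phi> 0 = 1"
  unfolding ft_def by (simp add: integral_one)

lemma refinable_\<phi>: "refinable (m 0) \<phi>"
  unfolding refinable_def fourier_Cc[OF \<phi>_Cc]
proof (intro conjI exI[of _ "ft \<phi>"])
  show "m 0 \<in> L2_per" by (intro trig_poly_L2_per tp) simp
  show "\<phi> \<in> L2_R" by (intro Cc_L2_R \<phi>_Cc)
  have "isCont (ft \<phi>) 0" using ft_continuous[OF \<phi>_Cc, of UNIV] by (simp add: continuous_on_eq_continuous_at)
  then show "(ft \<phi> \<longlongrightarrow> 1) (at 0)" by (simp add: isCont_def ft_\<phi>_0)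
qed (auto simp: ft_\<phi>_refinement)

lemma uep_masks_m: "uep_masks q m"
  unfolding uep_masks_def
proof (intro conjI ballI AE_I2 impI)
  show "m r \<in> L2_per" if "r \<in> {0..q}" for r by (intro trig_poly_L2_per tp) (use that in simp)
qed (rule unit cross)+

lemma wavelet_generators_gen: "wavelet_generators q m \<phi> gen"
  unfolding wavelet_generators_def fourier_Cc[OF \<phi>_Cc]
  by (auto simp: fourier_Cc[OF gen_Cc] ft_gen intro!: Cc_L2_R gen_Cc)

lemma parseval_wavelet_frame_gen: "parseval_wavelet_frame q m \<phi> gen"
  unfolding parseval_wavelet_frame_def
  by (intro conjI refinable_\<phi> uep_masks_m wavelet_generators_gen parseval_frame_gen)

text \<open>
  The masks satisfy \<open>|m\<^sub>r|\<^sup>2 \<le> 1 - |m\<^sub>0|\<^sup>2\<close>, so each wavelet mask, and with it the transform of each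
  generator, inherits the flatness of \<open>1 - |m\<^sub>0|\<^sup>2\<close> at 0.
\<close>

lemma vanishing_moments_gen:
  assumes "\<And>x. 1 - (cmod (m 0 x))\<^sup>2 \<le> C * (x\<^sup>2) ^ Suc N" "r \<in> {1..q}"
  shows "vanishing_moments N (gen r)"
proof -
  have C: "C \<ge> 0"
  proof -
    have "(cmod (m 0 pi))\<^sup>2 \<le> (\<Sum>r=0..q. (cmod (m r pi))\<^sup>2)" by (rule member_le_sum) auto
    then have "0 \<le> C * (pi\<^sup>2) ^ Suc N" using assms(1)[of pi] unit[of pi] by linarith
    moreover have "(pi\<^sup>2) ^ Suc N > 0" by (intro zero_less_power) simp
    ultimately show ?thesis by (meson linorder_not_less mult_neg_pos)
  qed
  have m: "cmod (m r x) \<le> sqrt C * \<bar>x\<bar> ^ Suc N" for x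
  proof -
    have "(cmod (m 0 x))\<^sup>2 + (cmod (m r x))\<^sup>2 = (\<Sum>s\<in>{0, r}. (cmod (m s x))\<^sup>2)" using assms(2) by simp
    also have "\<dots> \<le> (\<Sum>s=0..q. (cmod (m s x))\<^sup>2)" using assms(2) by (intro sum_mono2) auto
    finally have "(cmod (m r x))\<^sup>2 \<le> C * (x\<^sup>2) ^ Suc N" using assms(1)[of x] unit[of x] by linarith
    also have "(x\<^sup>2) ^ Suc N = (\<bar>x\<bar> ^ Suc N)\<^sup>2" by (metis power2_abs power_mult mult.commute)
    also have "C * (\<bar>x\<bar> ^ Suc N)\<^sup>2 = (sqrt C * \<bar>x\<bar> ^ Suc N)\<^sup>2" using C by (simp add: power_mult_distrib)
    finally show ?thesis by (rule power2_le_imp_le) (use C in simp)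
  qed
  define M where "M = (LINT x|lborel. cmod (\<phi> x))"
  have M: "cmod (ft \<phi> \<xi>) \<le> M" for \<xi> unfolding M_def by (rule ft_le[OF \<phi>_Cc])
  then have M0: "M \<ge> 0" using norm_ge_zero order_trans by blast
  have "cmod (ft (gen r) \<xi>) \<le> (sqrt C * M) * \<bar>\<xi>\<bar> ^ Suc N" for \<xi>
  proof -
    have "ft (gen r) \<xi> = m r (\<xi> / 2) * ft \<phi> (\<xi> / 2)" using ft_gen[of r "\<xi> / 2"] assms(2) by simp
    then have "cmod (ft (gen r) \<xi>) = cmod (m r (\<xi> / 2)) * cmod (ft \<phi> (\<xi> / 2))" by (simp add: norm_mult)
    also have "\<dots> \<le> (sqrt C * \<bar>\<xi> / 2\<bar> ^ Suc N) * M" by (intro mult_mono m M) (use C in auto)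
    also have "\<dots> \<le> (sqrt C * \<bar>\<xi>\<bar> ^ Suc N) * M"
      using C M0 by (intro mult_right_mono mult_left_mono power_mono) auto
    finally show ?thesis by (simp only: ac_simps)
  qed
  then show ?thesis by (rule vanishing_moments_if_flat[OF gen_Cc])
qed

text \<open>A zero of the transform at \<open>\<xi>\<close> would be inherited by \<open>\<xi> / 2\<^sup>j\<close> for every \<open>j\<close>, hence by 0.\<close>

lemma ft_\<phi>_nonzero:
  assumes "\<And>x. \<bar>x\<bar> < pi \<Longrightarrow> m 0 x \<noteq> 0" "\<bar>\<xi>\<bar> \<le> pi"
  shows "ft \<phi> \<xi> \<noteq> 0"
proof
  assume *: "ft \<phi> \<xi> = 0"
  have zero: "ft \<phi> (\<xi> / 2 ^ j) = 0" for j
  proof (induction j)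
    case (Suc j)
    have "\<bar>\<xi> / 2 ^ Suc j\<bar> \<le> \<bar>\<xi>\<bar> / 2"
    proof -
      have "\<bar>\<xi>\<bar> / 2 ^ Suc j \<le> \<bar>\<xi>\<bar> / 2 ^ 1" by (intro divide_left_mono power_increasing) auto
      then show ?thesis by simp
    qed
    then have "m 0 (\<xi> / 2 ^ Suc j) \<noteq> 0" using assms(2) pi_gt_zero by (intro assms(1)) linarith
    moreover have "ft \<phi> (\<xi> / 2 ^ j) = m 0 (\<xi> / 2 ^ Suc j) * ft \<phi> (\<xi> / 2 ^ Suc j)"
      using ft_\<phi>_refinement[of "\<xi> / 2 ^ Suc j"] by simp
    ultimately show ?case using Suc by simp
  qed (simp add: *)
  have "(\<lambda>j. \<xi> * (1/2) ^ j) \<longlonglongrightarrow> 0" by (intro tendsto_mult_right_zero LIMSEQ_realpow_zero) auto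
  then have "(\<lambda>j. \<xi> / 2 ^ j) \<longlonglongrightarrow> 0" by (simp add: power_divide)
  moreover have "isCont (ft \<phi>) 0" using ft_continuous[OF \<phi>_Cc, of UNIV] by (simp add: continuous_on_eq_continuous_at)
  ultimately have "(\<lambda>j. ft \<phi> (\<xi> / 2 ^ j)) \<longlonglongrightarrow> ft \<phi> 0" by (intro isCont_tendsto_compose[of 0 "ft \<phi>"])
  then show False unfolding zero ft_\<phi>_0 by (simp add: LIMSEQ_const_iff)
qed

text \<open>
  With the support of \<open>\<phi>\<close> in \<open>[-L, L]\<close>, at most \<open>2L + 1\<close> shifts are nonzero at any point.
\<close>

lemma shifts_upper_bound:
  obtains B where "\<And>c. finite {k::int. c k \<noteq> 0} \<Longrightarrow>
    (LINT x|lborel. (cmod (\<Sum>k | c k \<noteq> 0. c k * \<phi> (x - of_int k)))\<^sup>2) \<le> B * (\<Sum>k | c k \<noteq> 0. (cmod (c k))\<^sup>2)"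
proof -
  obtain L0 where L0: "L0 > 0" "\<And>x. L0 < \<bar>x\<bar> \<Longrightarrow> \<phi> x = 0" by (rule Cc_support[OF \<phi>_Cc]) (rule that)
  define L where "L = nat \<lceil>L0\<rceil>"
  have L: "\<phi> x = 0" if "of_nat L < \<bar>x\<bar>" for x
  proof -
    have "L0 \<le> of_nat L" unfolding L_def by (rule of_nat_ceiling)
    then show ?thesis using L0(2)[of x] that by linarith
  qed
  have sh: "(\<lambda>x. \<phi> (x - of_int k)) \<in> Cc" for k :: int
    using Cc_affine[OF \<phi>_Cc, of 1 "- of_int k"] by simp
  have "(LINT x|lborel. (cmod (\<Sum>k | c k \<noteq> 0. c k * \<phi> (x - of_int k)))\<^sup>2)
      \<le> (real (2 * L + 1) * (LINT x|lborel. (cmod (\<phi> x))\<^sup>2)) * (\<Sum>k | c k \<noteq> 0. (cmod (c k))\<^sup>2)"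
    if fin: "finite {k::int. c k \<noteq> 0}" for c
  proof -
    let ?S = "{k. c k \<noteq> 0}"
    have pw: "(cmod (\<Sum>k\<in>?S. c k * \<phi> (x - of_int k)))\<^sup>2
      \<le> (\<Sum>k\<in>?S. (real (2 * L + 1) * (cmod (c k))\<^sup>2) * (cmod (\<phi> (x - of_int k)))\<^sup>2)" for x
    proof -
      define T where "T = {k\<in>?S. \<bar>x - of_int k\<bar> \<le> of_nat L}"
      have T: "finite T" unfolding T_def using fin by simp
      have "T \<subseteq> {\<lceil>x\<rceil> - int L..\<lceil>x\<rceil> - int L + 2 * int L}"
      proof
        fix k assume "k \<in> T"
        then have "\<bar>x - of_int k\<bar> \<le> of_nat L" by (simp add: T_def)
        then have "x - of_nat L \<le> of_int k" "of_int k \<le> x + of_nat L" by linarith+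
        then have "\<lceil>x\<rceil> - int L \<le> k" "k \<le> \<lceil>x\<rceil> + int L" by linarith+
        then show "k \<in> {\<lceil>x\<rceil> - int L..\<lceil>x\<rceil> - int L + 2 * int L}" by simp
      qed
      from card_mono[OF _ this] have card: "card T \<le> 2 * L + 1" by simp
      have "(\<Sum>k\<in>?S. c k * \<phi> (x - of_int k)) = (\<Sum>k\<in>T. c k * \<phi> (x - of_int k))"
      proof (rule sum.mono_neutral_right[OF fin])
        show "\<forall>k\<in>?S - T. c k * \<phi> (x - of_int k) = 0"
        proof
          fix k assume "k \<in> ?S - T"
          then have "of_nat L < \<bar>x - of_int k\<bar>" by (auto simp: T_def not_le)
          then show "c k * \<phi> (x - of_int k) = 0" by (simp add: L)
        qed
      qed (auto simp: T_def)
      then have "cmod (\<Sum>k\<in>?S. c k * \<phi> (x - of_int k)) \<le> (\<Sum>k\<in>T. cmod (c k * \<phi> (x - of_int k)))"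
        by (metis norm_sum)
      then have "(cmod (\<Sum>k\<in>?S. c k * \<phi> (x - of_int k)))\<^sup>2 \<le> (\<Sum>k\<in>T. cmod (c k * \<phi> (x - of_int k)))\<^sup>2"
        by (intro power_mono) auto
      also have "\<dots> \<le> (\<Sum>k\<in>T. (cmod (c k * \<phi> (x - of_int k)))\<^sup>2) * real (card T)"
        by (rule sum_squared_le_sum_of_squares)
      also have "\<dots> \<le> (\<Sum>k\<in>T. (cmod (c k * \<phi> (x - of_int k)))\<^sup>2) * real (2 * L + 1)"
        by (intro mult_left_mono sum_nonneg of_nat_mono card) auto
      also have "\<dots> \<le> (\<Sum>k\<in>?S. (cmod (c k * \<phi> (x - of_int k)))\<^sup>2) * real (2 * L + 1)"
        by (intro mult_right_mono sum_mono2 fin) (auto simp: T_def)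
      finally show ?thesis unfolding sum_distrib_right norm_mult power_mult_distrib by (simp only: ac_simps)
    qed
    have "(LINT x|lborel. (cmod (\<Sum>k\<in>?S. c k * \<phi> (x - of_int k)))\<^sup>2)
      \<le> (LINT x|lborel. (\<Sum>k\<in>?S. (real (2 * L + 1) * (cmod (c k))\<^sup>2) * (cmod (\<phi> (x - of_int k)))\<^sup>2))"
      by (intro integral_mono pw Cc_norm_sq_integrable Cc_sum Cc_cmult sh Bochner_Integration.integrable_sum integrable_mult_right)
    also have "\<dots> = (\<Sum>k\<in>?S. (real (2 * L + 1) * (cmod (c k))\<^sup>2) * (LINT x|lborel. (cmod (\<phi> (x - of_int k)))\<^sup>2))"
      by (subst Bochner_Integration.integral_sum) (intro integrable_mult_right Cc_norm_sq_integrable sh, simp)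
    also have "\<dots> = (\<Sum>k\<in>?S. (real (2 * L + 1) * (cmod (c k))\<^sup>2) * (LINT x|lborel. (cmod (\<phi> x))\<^sup>2))"
    proof (rule sum.cong[OF refl])
      fix k
      have "(LINT x|lborel. (cmod (\<phi> x))\<^sup>2) = (LINT x|lborel. (cmod (\<phi> (x - of_int k)))\<^sup>2)"
        using lborel_integral_real_affine[of 1 "\<lambda>x. (cmod (\<phi> x))\<^sup>2" "- of_int k"] by simp
      then show "(real (2 * L + 1) * (cmod (c k))\<^sup>2) * (LINT x|lborel. (cmod (\<phi> (x - of_int k)))\<^sup>2)
        = (real (2 * L + 1) * (cmod (c k))\<^sup>2) * (LINT x|lborel. (cmod (\<phi> x))\<^sup>2)" by simp
    qed
    also have "\<dots> = (real (2 * L + 1) * (LINT x|lborel. (cmod (\<phi> x))\<^sup>2)) * (\<Sum>k\<in>?S. (cmod (c k))\<^sup>2)"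
      by (simp add: sum_distrib_left ac_simps)
    finally show ?thesis .
  qed
  then show ?thesis by (rule that)
qed

text \<open>
  The transform of the combination is \<open>Z\<close> times that of \<open>\<phi>\<close>, with a trigonometric polynomial \<open>Z\<close>
  that carries the coefficients. On a period \<open>|ft \<phi>|\<close> is bounded below, and the mean of \<open>|ft h|\<^sup>2\<close>
  over the period is at most the squared norm of \<open>h\<close>.
\<close>

lemma shifts_lower_bound:
  assumes "\<And>x. \<bar>x\<bar> < pi \<Longrightarrow> m 0 x \<noteq> 0"
  obtains A where "A > 0" "\<And>c. finite {k::int. c k \<noteq> 0} \<Longrightarrow>
    A * (\<Sum>k | c k \<noteq> 0. (cmod (c k))\<^sup>2) \<le> (LINT x|lborel. (cmod (\<Sum>k | c k \<noteq> 0. c k * \<phi> (x - of_int k)))\<^sup>2)"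
proof -
  have "continuous_on {-pi..pi} (\<lambda>\<xi>. cmod (ft \<phi> \<xi>))" by (intro continuous_intros ft_continuous \<phi>_Cc)
  from continuous_attains_inf[OF compact_Icc _ this]
  obtain \<xi>0 where \<xi>0: "\<xi>0 \<in> {-pi..pi}" "\<And>\<xi>. \<xi> \<in> {-pi..pi} \<Longrightarrow> cmod (ft \<phi> \<xi>0) \<le> cmod (ft \<phi> \<xi>)"
    by auto
  define d where "d = cmod (ft \<phi> \<xi>0)"
  have "\<bar>\<xi>0\<bar> \<le> pi" using \<xi>0(1) by auto
  then have d: "d > 0" unfolding d_def using ft_\<phi>_nonzero[OF assms, of \<xi>0] by simp
  have sh: "(\<lambda>x. \<phi> (x - of_int k)) \<in> Cc" for k :: int
    using Cc_affine[OF \<phi>_Cc, of 1 "- of_int k"] by simp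
  have ft_sh: "(LINT x|lborel. \<phi> (x - of_int k) * cis (- (x * \<xi>))) = cis (of_int (- k) * \<xi>) * ft \<phi> \<xi>" for k :: int and \<xi>
  proof -
    have "(LINT x|lborel. \<phi> (x - of_int k) * cis (- (x * \<xi>))) = (LINT x|lborel. \<phi> x * cis (- ((x + of_int k) * \<xi>)))"
      using lborel_integral_real_affine[of 1 "\<lambda>x. \<phi> (x - of_int k) * cis (- (x * \<xi>))" "of_int k"]
      by (simp add: add.commute)
    also have "(\<lambda>x. \<phi> x * cis (- ((x + of_int k) * \<xi>))) = (\<lambda>x. cis (of_int (- k) * \<xi>) * (\<phi> x * cis (- (x * \<xi>))))"
    proof
      fix x
      have "cis (of_int (- k) * \<xi>) * cis (- (x * \<xi>)) = cis (- ((x + of_int k) * \<xi>))" by (simp add: cis_mult algebra_simps)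
      then show "\<phi> x * cis (- ((x + of_int k) * \<xi>)) = cis (of_int (- k) * \<xi>) * (\<phi> x * cis (- (x * \<xi>)))"
        by (metis mult.left_commute)
    qed
    finally show ?thesis by (simp add: ft_def)
  qed
  have "d\<^sup>2 * (\<Sum>k | c k \<noteq> 0. (cmod (c k))\<^sup>2) \<le> (LINT x|lborel. (cmod (\<Sum>k | c k \<noteq> 0. c k * \<phi> (x - of_int k)))\<^sup>2)"
    if fin: "finite {k::int. c k \<noteq> 0}" for c
  proof -
    let ?S = "{k. c k \<noteq> 0}"
    define h where "h = (\<lambda>x. \<Sum>k\<in>?S. c k * \<phi> (x - of_int k))"
    have h: "h \<in> Cc" unfolding h_def by (intro Cc_sum Cc_cmult sh)
    define c' where "c' = (\<lambda>k. c (- k))"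
    define Z where "Z = (\<lambda>\<xi>. \<Sum>k\<in>uminus ` ?S. c' k * cis (of_int k * \<xi>))"
    have Z: "trig_poly Z" unfolding Z_def by (intro trig_poly_sum trig_poly.monomial)
    have ft_h: "ft h \<xi> = Z \<xi> * ft \<phi> \<xi>" for \<xi>
    proof -
      have "ft h \<xi> = (LINT x|lborel. (\<Sum>k\<in>?S. c k * (\<phi> (x - of_int k) * cis (- (x * \<xi>)))))"
        unfolding ft_def h_def by (simp only: sum_distrib_right mult.assoc)
      also have "\<dots> = (\<Sum>k\<in>?S. (LINT x|lborel. c k * (\<phi> (x - of_int k) * cis (- (x * \<xi>)))))"
        by (intro Bochner_Integration.integral_sum Cc_integrable Cc_cmult Cc_mult_cis sh)
      also have "\<dots> = (\<Sum>k\<in>?S. c k * cis (of_int (- k) * \<xi>)) * ft \<phi> \<xi>"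
        by (simp only: integral_mult_right_zero ft_sh sum_distrib_right mult.assoc)
      also have "(\<Sum>k\<in>?S. c k * cis (of_int (- k) * \<xi>)) = Z \<xi>"
        unfolding Z_def c'_def by (subst sum.reindex) auto
      finally show ?thesis .
    qed
    obtain W where W: "trig_poly W" "\<And>\<xi>. (cmod (ft h \<xi>))\<^sup>2 \<le> Re (W \<xi>)" "mean W = of_real (LINT x|lborel. (cmod (h x))\<^sup>2)"
      by (rule zak_bound[OF h]) (rule that)
    have "Re (mean (\<lambda>\<xi>. of_real (d\<^sup>2) * of_real ((cmod (Z \<xi>))\<^sup>2))) \<le> Re (mean W)"
    proof (rule mean_Re_mono[OF trig_poly_cmult[OF trig_poly_cmod_sq[OF Z]] W(1)])
      fix \<xi> assume "\<xi> \<in> {-pi..pi}"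
      then have "d \<le> cmod (ft \<phi> \<xi>)" unfolding d_def by (rule \<xi>0(2))
      then have "d\<^sup>2 * (cmod (Z \<xi>))\<^sup>2 \<le> (cmod (ft \<phi> \<xi>))\<^sup>2 * (cmod (Z \<xi>))\<^sup>2"
        using d by (intro mult_right_mono power_mono) auto
      also have "\<dots> = (cmod (ft h \<xi>))\<^sup>2" by (simp add: ft_h norm_mult power_mult_distrib mult.commute)
      also have "\<dots> \<le> Re (W \<xi>)" by (rule W(2))
      finally show "Re (of_real (d\<^sup>2) * of_real ((cmod (Z \<xi>))\<^sup>2)) \<le> Re (W \<xi>)"
        by (simp only: of_real_mult[symmetric] Re_complex_of_real)
    qed
    moreover have "mean (\<lambda>\<xi>. of_real (d\<^sup>2) * of_real ((cmod (Z \<xi>))\<^sup>2)) = of_real (d\<^sup>2 * (\<Sum>k\<in>?S. (cmod (c k))\<^sup>2))"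
    proof -
      have "mean (\<lambda>\<xi>. of_real ((cmod (Z \<xi>))\<^sup>2)) = of_real (\<Sum>k\<in>uminus ` ?S. (cmod (c' k))\<^sup>2)"
        unfolding Z_def by (rule mean_cmod_sum) (use fin in simp)
      also have "(\<Sum>k\<in>uminus ` ?S. (cmod (c' k))\<^sup>2) = (\<Sum>k\<in>?S. (cmod (c k))\<^sup>2)"
        unfolding c'_def by (subst sum.reindex) auto
      finally show ?thesis by (simp only: mean_cmult of_real_mult)
    qed
    ultimately show ?thesis unfolding W(3) h_def by (simp only: Re_complex_of_real)
  qed
  then show ?thesis using d by (intro that[of "d\<^sup>2"]) auto
qed

lemma stable_integer_shifts_\<phi>:
  assumes "\<And>x. \<bar>x\<bar> < pi \<Longrightarrow> m 0 x \<noteq> 0"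
  shows "stable_integer_shifts \<phi>"
proof -
  obtain A where A: "A > 0" "\<And>c. finite {k::int. c k \<noteq> 0} \<Longrightarrow>
    A * (\<Sum>k | c k \<noteq> 0. (cmod (c k))\<^sup>2) \<le> (LINT x|lborel. (cmod (\<Sum>k | c k \<noteq> 0. c k * \<phi> (x - of_int k)))\<^sup>2)"
    by (rule shifts_lower_bound[OF assms]) (assumption, rule that)
  obtain B where B: "\<And>c. finite {k::int. c k \<noteq> 0} \<Longrightarrow>
    (LINT x|lborel. (cmod (\<Sum>k | c k \<noteq> 0. c k * \<phi> (x - of_int k)))\<^sup>2) \<le> B * (\<Sum>k | c k \<noteq> 0. (cmod (c k))\<^sup>2)"
    by (rule shifts_upper_bound) (rule that)
  show ?thesis unfolding stable_integer_shifts_def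
  proof (rule exI[of _ A], rule exI[of _ "max A B"], intro conjI allI impI)
    fix c :: "int \<Rightarrow> complex" assume fin: "finite {k. c k \<noteq> 0}"
    have "(\<lambda>x. \<phi> (x - of_int k)) \<in> Cc" for k :: int
      using Cc_affine[OF \<phi>_Cc, of 1 "- of_int k"] by simp
    then have "(\<lambda>x. \<Sum>k | c k \<noteq> 0. c k * \<phi> (x - of_int k)) \<in> Cc" by (intro Cc_sum Cc_cmult)
    note eq = Cc_L2_norm[OF this]
    show "A * (\<Sum>k | c k \<noteq> 0. (cmod (c k))\<^sup>2) \<le> (L2_norm (\<lambda>x. \<Sum>k | c k \<noteq> 0. c k * \<phi> (x - of_int k)))\<^sup>2"
      unfolding eq by (rule A(2)[OF fin])
    have "B * (\<Sum>k | c k \<noteq> 0. (cmod (c k))\<^sup>2) \<le> max A B * (\<Sum>k | c k \<noteq> 0. (cmod (c k))\<^sup>2)"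
      by (intro mult_right_mono sum_nonneg) auto
    then show "(L2_norm (\<lambda>x. \<Sum>k | c k \<noteq> 0. c k * \<phi> (x - of_int k)))\<^sup>2 \<le> max A B * (\<Sum>k | c k \<noteq> 0. (cmod (c k))\<^sup>2)"
      unfolding eq using B[OF fin] by linarith
  qed (use A(1) in auto)
qed

end

section \<open>The approximation theorem\<close>

text \<open>
  The zeros of \<open>\<tau>\<close> are isolated, so there the limit of the quotient is the value of \<open>p\<close>.
\<close>

lemma tau_quotient_mult:
  assumes "continuous_on UNIV p"
  shows "tau_quotient n K (\<lambda>x. of_real (tau n x) ^ K * p x) = p"
proof
  fix \<xi>
  have quot: "of_real (tau n \<eta>) ^ K * p \<eta> / of_real (tau n \<eta>) ^ K = p \<eta>" if "tau n \<eta> \<noteq> 0" for \<eta>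
    using that by simp
  show "tau_quotient n K (\<lambda>x. of_real (tau n x) ^ K * p x) \<xi> = p \<xi>"
  proof (cases "tau n \<xi> = 0")
    case True
    then have c: "cos (\<xi> / 2) = 0" by (simp add: tau_eq_0_iff)
    have nz: "tau n \<eta> \<noteq> 0" if "\<eta> \<noteq> \<xi>" "dist \<eta> \<xi> < 2 * pi" for \<eta>
    proof -
      have "\<bar>\<eta> - \<xi>\<bar> < 2 * pi" using that(2) by (simp add: dist_real_def)
      then have "\<bar>(\<eta> - \<xi>) / 2\<bar> < pi" by simp
      then have "- pi < (\<eta> - \<xi>) / 2 \<and> (\<eta> - \<xi>) / 2 < pi" by (simp only: abs_less_iff minus_less_iff)
      then have "sin ((\<eta> - \<xi>) / 2) \<noteq> 0" using that(1) sin_eq_0_pi[of "(\<eta> - \<xi>) / 2"] by auto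
      moreover have "sin (\<xi> / 2) \<noteq> 0" using c sin_cos_squared_add[of "\<xi> / 2"] by auto
      moreover have "cos (\<eta> / 2) = - (sin (\<xi> / 2) * sin ((\<eta> - \<xi>) / 2))"
        using cos_add[of "\<xi> / 2" "(\<eta> - \<xi>) / 2"] c by (simp add: diff_divide_distrib)
      ultimately show ?thesis by (simp add: tau_eq_0_iff)
    qed
    have "isCont p \<xi>" using assms by (simp add: continuous_on_eq_continuous_at)
    then have "(p \<longlongrightarrow> p \<xi>) (at \<xi>)" by (simp add: isCont_def)
    moreover have "\<forall>\<^sub>F \<eta> in at \<xi>. p \<eta> = of_real (tau n \<eta>) ^ K * p \<eta> / of_real (tau n \<eta>) ^ K"
      unfolding eventually_at using nz quot by (intro exI[of _ "2 * pi"]) auto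
    ultimately have "((\<lambda>\<eta>. of_real (tau n \<eta>) ^ K * p \<eta> / of_real (tau n \<eta>) ^ K) \<longlongrightarrow> p \<xi>) (at \<xi>)"
      by (rule Lim_transform_eventually)
    then have "Lim (at \<xi>) (\<lambda>\<eta>. of_real (tau n \<eta>) ^ K * p \<eta> / of_real (tau n \<eta>) ^ K) = p \<xi>"
      by (intro tendsto_Lim) auto
    then show ?thesis using True by (simp add: tau_quotient_def)
  qed (simp add: tau_quotient_def quot)
qed

theorem theorem1:
  fixes f :: "real \<Rightarrow> complex" and \<epsilon> :: real and N0 :: nat
  assumes "f \<in> space_C" and "f 0 = 1" and "\<epsilon> > 0"
  shows "\<exists>K0 :: nat. K0 \<ge> 1 \<and>
    (\<exists>(q :: nat) (m :: nat \<Rightarrow> real \<Rightarrow> complex) (\<phi> :: real \<Rightarrow> complex) (\<psi> :: nat \<Rightarrow> real \<Rightarrow> complex).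
       parseval_wavelet_frame q m \<phi> \<psi> \<and>
       (\<forall>r\<in>{1..q}. compactly_supported (\<psi> r)) \<and>
       tau_quotient N0 K0 (m 0) \<in> space_C \<and>
       norm_C (\<lambda>\<xi>. f \<xi> - tau_quotient N0 K0 (m 0) \<xi>) < \<epsilon> \<and>
       (\<forall>r\<in>{1..q}. vanishing_moments N0 (\<psi> r)) \<and>
       stable_integer_shifts \<phi>)"
proof -
  have "\<epsilon> / 2 > 0" using assms(3) by simp
  from assms(1,2) this obtain K p C where K: "K \<ge> 1" and p: "trig_poly p" "\<And>x. p x \<noteq> 0"
    "\<And>x. cmod (f x - p x) \<le> \<epsilon> / 2" "p 0 = 1"
    and le_tau: "\<And>x. cmod (of_real (tau N0 x) ^ K * p x) \<le> tau N0 x"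
    and sos: "sos (\<lambda>x. 1 - (cmod (of_real (tau N0 x) ^ K * p x))\<^sup>2 - (cmod (of_real (tau N0 (x + pi)) ^ K * p (x + pi)))\<^sup>2)"
    and flat: "\<And>x. 1 - (cmod (of_real (tau N0 x) ^ K * p x))\<^sup>2 \<le> C * (x\<^sup>2) ^ Suc N0"
    by (rule refinement_mask[where n = N0]) (rule that)
  define m0 where "m0 = (\<lambda>x. of_real (tau N0 x) ^ K * p x)"
  have tp0: "trig_poly m0" unfolding m0_def
    by (intro trig_poly_mult trig_poly_power sos_trig_poly sos_tau p)
  have sos0: "sos (\<lambda>x. 1 - (cmod (m0 x))\<^sup>2 - (cmod (m0 (x + pi)))\<^sup>2)"
    unfolding m0_def by (rule sos)
  obtain q :: nat and m where m: "m 0 = m0" "\<And>r. r \<le> q \<Longrightarrow> trig_poly (m r)"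
    "\<And>x. (\<Sum>r=0..q. (cmod (m r x))\<^sup>2) = 1" "\<And>x. (\<Sum>r=0..q. m r x * cnj (m r (x + pi))) = 0"
    by (rule filter_bank_completion[OF tp0 sos0]) (rule that)
  interpret R: refinement_mask_bound N0 m0
    using tp0 le_tau p(4) by unfold_locales (auto simp: m0_def tau_0)
  obtain d where d: "trig_poly_deg d m0" using trig_poly_imp_deg[OF tp0] by blast
  have Cc: "R.\<phi> \<in> Cc" unfolding Cc_def using R.\<phi>_continuous R.\<phi>_support[OF d] by blast
  interpret U: uep_system q m "R.\<phi>"
  proof
    show "R.\<phi> y = 2 * (\<Sum>k | fcoef (m 0) k \<noteq> 0. fcoef (m 0) k * R.\<phi> (2 * y + of_int k))" for y
      unfolding m(1) by (rule R.\<phi>_refinement[OF fcoef_finite_support[OF tp0] order_refl])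
  qed (use m Cc R.integral_\<phi> in auto)
  have quot: "tau_quotient N0 K (m 0) = p"
    unfolding m(1) m0_def by (rule tau_quotient_mult[OF trig_poly_continuous[OF p(1)]])
  have "m 0 x \<noteq> 0" if "\<bar>x\<bar> < pi" for x
  proof -
    have "cos (x / 2) > 0" using that by (intro cos_gt_zero_pi) auto
    then have "tau N0 x \<noteq> 0" by (simp add: tau_eq_0_iff)
    then show ?thesis using p(2) by (simp add: m(1) m0_def)
  qed
  then have "stable_integer_shifts R.\<phi>" by (rule U.stable_integer_shifts_\<phi>)
  moreover have "vanishing_moments N0 (U.gen r)" if "r \<in> {1..q}" for r
    by (rule U.vanishing_moments_gen[OF _ that]) (use flat in \<open>simp add: m(1) m0_def\<close>)
  moreover have "norm_C (\<lambda>\<xi>. f \<xi> - tau_quotient N0 K (m 0) \<xi>) < \<epsilon>"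
  proof -
    have "norm_C (\<lambda>\<xi>. f \<xi> - p \<xi>) \<le> \<epsilon> / 2"
      unfolding norm_C_def by (rule cSUP_least) (simp, rule p(3))
    then show ?thesis using assms(3) by (simp add: quot)
  qed
  moreover have "tau_quotient N0 K (m 0) \<in> space_C" unfolding quot by (rule trig_poly_space_C[OF p(1)])
  moreover have "compactly_supported (U.gen r)" for r by (intro Cc_compactly_supported U.gen_Cc)
  ultimately show ?thesis
    using K U.parseval_wavelet_frame_gen by blast
qed

end
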